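(* Let $1\le p<+\infty$ and let $\varphi\in W^{1,p}(\mathbb{R}_+)$ be non-negative. Then the tamping $\varphi^\natural$ of $\varphi$ has a weak derivative $\nabla\varphi^\natural\in L^p(\mathbb{R}_+)$ and $$\int_{\mathbb{R}_+}|\nabla\varphi^\natural|^p\;\leq\;\int_{\mathbb{R}_+}|\nabla\varphi|^p,$$ with equality if and only if $\varphi=\varphi^\natural$ almost everywhere.
   Context: $\mathbb{R}_+=[0,+\infty)$, $\mathrm{meas}$ is Lebesgue measure, $\nabla$ denotes the (one-dimensional) weak derivative, $\mathfrak{M}_+(\mathbb{R}_+)$ is the set of non-negative measurable functions on $\mathbb{R}_+$ (identified when equal a.e.), and $\{\varphi\ge\nu\}=\{x\in\mathbb{R}_+:\varphi(x)\ge\nu\}$. Hollows. For $A\subseteq\mathbb{R}_+$ measurable, the essential convex hull is $\mathrm{conv\,ess}\,A:=\bigcap_{\mathrm{meas}(A\triangle B)=0}\mathrm{conv}\,B$. The hollows of $A$ are $\mathcal{H}(A):=(\mathrm{conv\,ess}\,A)\setminus A$ (understood up to null sets). For $\varphi\in\mathfrak{M}_+(\mathbb{R}_+)$ and $\nu\in(0,+\infty]$, $\mathcal{H}_\nu(\varphi):=\bigcup_{\lambda<\nu}\mathcal{H}(\{\varphi\ge\lambda\})$. Tamping. For $\nu>0$ let $x_\nu(\varphi):=\mathrm{inf\,ess}\{\varphi\ge\nu\}$, where $\mathrm{inf\,ess}\,A:=\sup\{a\ge0:\mathrm{meas}(A\cap[0,a])=0\}$, and, when $\mathrm{meas}\{\varphi\ge\nu\}>0$,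 $y_\nu(\varphi):=x_\nu(\varphi)-\mathrm{meas}(\mathcal{H}_\infty(\varphi)\cap[0,x_\nu(\varphi)])$. Put $S_\nu(\varphi):=[\,y_\nu(\varphi),\,y_\nu(\varphi)+\mathrm{meas}\{\varphi\ge\nu\}\,]$ (meaning $[y_\nu(\varphi),+\infty)$ if $\mathrm{meas}\{\varphi\ge\nu\}=+\infty$, and $\emptyset$ if $\mathrm{meas}\{\varphi\ge\nu\}=0$). These sets are non-increasing in $\nu$. The tamping $\varphi^\natural$ of $\varphi$ is the function whose superlevel sets $\{\varphi^\natural\ge\nu\}$ are the $S_\nu(\varphi)$; explicitly $\varphi^\natural(x):=\sup\{\nu>0: x\in S_\nu(\varphi)\}$ with $\sup\emptyset=0$ (for almost every $\nu$, $\{\varphi^\natural\ge\nu\}=S_\nu(\varphi)$ up to a null set). *)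

theory Defs
  imports "HOL-Analysis.Analysis"
begin

text \<open>
  Functions on the half-line are total functions on \<^typ>\<open>real\<close> whose values outside
  \<open>{0..}\<close> never matter. ``Measurable'' means Lebesgue measurable.
\<close>

section \<open>Weak derivatives and Sobolev functions on the half-line\<close>

text \<open>
  Smoothness is tested on all iterated derivatives: differentiability of \<open>(deriv ^^ n) \<psi>\<close> at
  every point, for all \<open>n\<close>, guarantees that \<^const>\<open>deriv\<close> is never applied outside its meaning.
\<close>

definition test_function :: "(real \<Rightarrow> real) \<Rightarrow> bool" where
  "test_function \<psi> \<longleftrightarrow>
     (\<forall>n x. (deriv ^^ n) \<psi> differentiable (at x)) \<and>
     compact (closure {x. \<psi> x \<noteq> 0}) \<and> closure {x. \<psi> x \<noteq> 0} \<subseteq> {0<..}"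

definition locally_integrable :: "(real \<Rightarrow> real) \<Rightarrow> bool" where
  "locally_integrable u \<longleftrightarrow> (\<forall>K. compact K \<and> K \<subseteq> {0<..} \<longrightarrow> u absolutely_integrable_on K)"

text \<open>
  Weak derivatives are taken on the open half-line, so no boundary condition at \<open>0\<close> is imposed.
\<close>

definition has_weak_derivative :: "(real \<Rightarrow> real) \<Rightarrow> (real \<Rightarrow> real) \<Rightarrow> bool" where
  "has_weak_derivative u g \<longleftrightarrow>
     locally_integrable u \<and> locally_integrable g \<and>
     (\<forall>\<psi>. test_function \<psi> \<longrightarrow>
        (\<integral>x. u x * deriv \<psi> x \<partial>lebesgue_on {0..}) = - (\<integral>x. g x * \<psi> x \<partial>lebesgue_on {0..}))"

definition in_Lp :: "real \<Rightarrow> (real \<Rightarrow> real) \<Rightarrow> bool" where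
  "in_Lp p u \<longleftrightarrow>
     u \<in> borel_measurable (lebesgue_on {0..}) \<and>
     integrable (lebesgue_on {0..}) (\<lambda>x. \<bar>u x\<bar> powr p)"

definition in_W1p :: "real \<Rightarrow> (real \<Rightarrow> real) \<Rightarrow> bool" where
  "in_W1p p u \<longleftrightarrow> in_Lp p u \<and> (\<exists>g. has_weak_derivative u g \<and> in_Lp p g)"


section \<open>Hollows\<close>

definition conv_ess :: "real set \<Rightarrow> real set" where
  "conv_ess A = \<Inter> {convex hull B | B. B \<subseteq> {0..} \<and> sym_diff A B \<in> null_sets lebesgue}"

definition hollows :: "real set \<Rightarrow> real set" where
  "hollows A = conv_ess A - A"

definition superlevel :: "(real \<Rightarrow> real) \<Rightarrow> real \<Rightarrow> real set" where
  "superlevel \<phi> \<nu> = {x \<in> {0..}. \<phi> x \<ge> \<nu>}"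

text \<open>
  The union is uncountable, but it is still well defined up to null sets: \<^const>\<open>conv_ess\<close> only
  depends on \<open>\<phi>\<close> up to a.e. equality, so changing \<open>\<phi>\<close> on a null set \<open>N\<close> changes the union only
  inside \<open>N\<close>.
\<close>

definition hollows_below :: "ereal \<Rightarrow> (real \<Rightarrow> real) \<Rightarrow> real set" where
  "hollows_below \<nu> \<phi> = (\<Union>t\<in>{t::real. ereal t < \<nu>}. hollows (superlevel \<phi> t))"


section \<open>Tamping\<close>

definition inf_ess :: "real set \<Rightarrow> ereal" where
  "inf_ess A = (SUP a\<in>{a. 0 \<le> a \<and> emeasure lebesgue (A \<inter> {0..a}) = 0}. ereal a)"

definition tamp_x :: "(real \<Rightarrow> real) \<Rightarrow> real \<Rightarrow> ereal" where
  "tamp_x \<phi> \<nu> = inf_ess (superlevel \<phi> \<nu>)"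

text \<open>
  Only used when the superlevel set has positive measure, in which case \<^const>\<open>tamp_x\<close> is finite.
\<close>

definition tamp_y :: "(real \<Rightarrow> real) \<Rightarrow> real \<Rightarrow> real" where
  "tamp_y \<phi> \<nu> =
     (let x = real_of_ereal (tamp_x \<phi> \<nu>)
      in x - measure lebesgue (hollows_below \<infinity> \<phi> \<inter> {0..x}))"

definition tamp_S :: "(real \<Rightarrow> real) \<Rightarrow> real \<Rightarrow> real set" where
  "tamp_S \<phi> \<nu> =
     (if emeasure lebesgue (superlevel \<phi> \<nu>) = 0 then {}
      else if emeasure lebesgue (superlevel \<phi> \<nu>) = \<infinity> then {tamp_y \<phi> \<nu>..}
      else {tamp_y \<phi> \<nu>..tamp_y \<phi> \<nu> + measure lebesgue (superlevel \<phi> \<nu>)})"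

text \<open>The supremum is taken in \<^typ>\<open>ennreal\<close>, where the supremum of the empty set is \<open>0\<close>.\<close>

definition tamping :: "(real \<Rightarrow> real) \<Rightarrow> real \<Rightarrow> ennreal" where
  "tamping \<phi> x = (SUP \<nu>\<in>{\<nu>. 0 < \<nu> \<and> x \<in> tamp_S \<phi> \<nu>}. ennreal \<nu>)"

end

(*
  Let u be the continuous representative of \<phi> and a its first maximum point. Up to null sets the
  points of [0, a] that do not lie in a hollow form the set L of records of u, and
  {\<phi>-tamped >= \<nu>} = [l(\<nu>), |L| + r(\<nu>)] with l(\<nu>) = |L \<inter> {u < \<nu>}| and r(\<nu>) = |R \<inter> {u >= \<nu>}|, where
  R is the complement of L: the tamping is the increasing rearrangement of u on L followed by the
  decreasing rearrangement of u on R.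

  No fine differentiability of u is needed. If almost every level between s and t is attained on a
  set E, then t - s is at most the integral of |u'| over E (cover E by intervals). Every level below
  the maximum is attained on L, unless it is below u(0), and every one on [a, oo), which is a part of
  R. So an increment of the tamping over [y1, y2] is bounded by the integral of |u'| over the
  preimage of [y1, y2] under the map T that sends a point to its place after the rearrangement. As T
  does not increase measure, away from the countably many fat levels, the image of |u'| dx under T
  has a density k; it dominates the slope of the tamping, and its L^p norm is at most that of u' by
  Jensen's inequality.

  In the equality case k is the slope of the tamping in absolute value, u' vanishes on the fat
  levels, and the total variation of u over R is the maximum of u. As much is already spent on
  [a, oo), so u increases up to a and decreases afterwards, and then it is its own tamping.
*)

theory Submission
  imports Defs
begin

section \<open>Comparing Borel measures on the line through intervals\<close>

text \<open>The interval S_\<nu> has the full measure of {u >= \<nu>}, while only its left end is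
  pulled back by the hollows. Whatever {u >= \<nu>} contains in R before a is thus appended on the
  right, which is why all of R, and not just [a, oo), is sorted by decreasing values.

  Points of a fat level share one rank, so T would gather them into an atom and the image of
  Lebesgue measure would have no density. Dropping these levels is free: there are countably many,
  and a crossing estimate sees levels only up to a countable set.

  Lebesgue measure on the half-line is infinite and T merely contracts it, so Jensen's inequality
  takes an integrated tangent form instead of comparing averages.

  It runs on a budget instead: strict monotonicity of the power turns equal energies into |h| = k
  almost everywhere for the slope h of the tamping, and the descending branch of the tamping can
  spend at most m.\<close>

lemma isCont_ball:
  fixes u :: "real \<Rightarrow> real"
  assumes "isCont u y" "open S" "u y \<in> S"
  obtains d where "0 < d" "\<forall>z. \<bar>z - y\<bar> < d \<longrightarrow> u z \<in> S"
proof -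
  have "\<forall>\<^sub>F z in nhds y. u z \<in> S"
    using assms by (metis isCont_def tendsto_at_iff_tendsto_nhds topological_tendstoD)
  then show ?thesis using that by (auto simp: eventually_nhds_metric dist_real_def)
qed

lemma AE_of_intervals:
  assumes "\<And>n::nat. AE x in M. x \<in> {-real n..real n} \<longrightarrow> Q x"
  shows "AE x in M. Q x"
proof -
  have "AE x in M. \<forall>n::nat. x \<in> {-real n..real n} \<longrightarrow> Q x"
    using assms unfolding AE_all_countable by blast
  then show ?thesis
  proof eventually_elim
    case (elim x)
    obtain n :: nat where "\<bar>x\<bar> \<le> real n" using real_arch_simple by blast
    then have "x \<in> {-real n..real n}" by auto
    then show ?case using elim by blast
  qed
qed

text \<open>Outer regularity provides an open set of almost the same mass; the covering lemma cuts
  it into boxes with disjoint interiors, whose masses add up because endpoints are null. Restricting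
  the density to [-r, r] makes the measure finite, as regularity asks.\<close>

lemma cover_by_intervals:
  fixes f :: "real \<Rightarrow> ennreal"
  assumes f[measurable]: "f \<in> borel_measurable borel"
    and fin: "\<And>c d. (\<integral>\<^sup>+x\<in>{c..d}. f x \<partial>lborel) < \<infinity>"
    and A[measurable]: "A \<in> sets borel" and "bounded A" and e: "0 < e"
  obtains c d :: "nat \<Rightarrow> real" where "A \<subseteq> (\<Union>i. {c i..d i})"
    "(\<Sum>i. \<integral>\<^sup>+x\<in>{c i..d i}. f x \<partial>lborel) \<le> (\<integral>\<^sup>+x\<in>A. f x \<partial>lborel) + ennreal e"
proof -
  obtain r where r: "0 < r" "A \<subseteq> {-r..r}"
    using \<open>bounded A\<close> unfolding bounded_pos
    by (metis abs_le_iff atLeastAtMost_iff minus_le_iff real_norm_def subsetI)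
  define N where "N = density lborel (\<lambda>x. f x * indicator {-r..r} x)"
  have N: "emeasure N S = (\<integral>\<^sup>+x\<in>S \<inter> {-r..r}. f x \<partial>lborel)" if "S \<in> sets borel" for S
    using that unfolding N_def
    by (subst emeasure_density) (auto intro!: nn_integral_cong split: split_indicator)
  have sN: "sets N = sets borel" by (simp add: N_def)
  have "emeasure N (space N) \<noteq> \<infinity>"
    using N[of UNIV] fin[of "-r" r] by (simp add: N_def)
  then have "emeasure N A = (INF U \<in> {U. A \<subseteq> U \<and> open U}. emeasure N U)"
    by (rule outer_regular[OF sN _ A])
  moreover have NA: "emeasure N A = (\<integral>\<^sup>+x\<in>A. f x \<partial>lborel)"
    using N[OF A] r(2) by (simp add: Int_absorb2)
  moreover have "emeasure N A < emeasure N A + ennreal e"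
  proof -
    have "emeasure N A \<le> emeasure N (space N)"
      by (rule emeasure_space)
    then have "emeasure N A < \<infinity>"
      using \<open>emeasure N (space N) \<noteq> \<infinity>\<close> by (simp add: less_top top.extremum_strict order_le_less_trans)
    then show ?thesis using e by (simp add: ennreal_less_top less_top)
  qed
  ultimately obtain U where U: "open U" "A \<subseteq> U" "emeasure N U < (\<integral>\<^sup>+x\<in>A. f x \<partial>lborel) + ennreal e"
    by (auto simp: INF_less_iff)
  \<comment> \<open>Every box of the cover lies in \<open>\<gamma> x\<close> for one of its points x
    in A, and such a point belongs to U; the gauge thus forces all boxes into U.\<close>
  define \<gamma> where "\<gamma> x = (if x \<in> U then U else UNIV)" for x
  have g: "gauge \<gamma>" using U(1) by (auto simp: gauge_def \<gamma>_def)
  have Ar: "A \<subseteq> cbox (-r) r" using r by simp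
  have ne: "box (-r) r \<noteq> {}" using r by simp
  have "\<exists>D. countable D \<and> \<Union>D \<subseteq> cbox (-r) r
    \<and> (\<forall>K\<in>D. interior K \<noteq> {} \<and> (\<exists>c d. K = cbox c d))
    \<and> pairwise (\<lambda>A B. interior A \<inter> interior B = {}) D
    \<and> (\<forall>K\<in>D. \<exists>x \<in> A \<inter> K. K \<subseteq> \<gamma> x) \<and> A \<subseteq> \<Union>D"
  proof (rule covering_lemma[OF Ar ne g], goal_cases)
    case (1 D)
    show ?case
      by (intro exI[of _ D] conjI; (rule ballI, erule 1(3) | rule ballI, erule 1(5) | fact))
  qed
  then obtain D where D: "countable D" "\<Union>D \<subseteq> cbox (-r) r"
    "\<And>K. K \<in> D \<Longrightarrow> interior K \<noteq> {} \<and> (\<exists>c d. K = cbox c d)"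
    "pairwise (\<lambda>A B. interior A \<inter> interior B = {}) D"
    "\<And>K. K \<in> D \<Longrightarrow> \<exists>x \<in> A \<inter> K. K \<subseteq> \<gamma> x" "A \<subseteq> \<Union>D"
    by (elim exE conjE) simp
  \<comment> \<open>D may be finite: the remaining indices receive the empty set, written below as
    the interval {1..0}.\<close>
  define K where "K i = (if i \<in> to_nat_on D ` D then from_nat_into D i else {})" for i
  have KD: "K i \<in> D \<or> K i = {}" for i
    using D(1) by (auto simp: K_def)
  have "\<exists>c d. K i = {c..d}" for i
    using KD[of i]
  proof
    assume "K i = {}"
    then have "K i = {1..0::real}" by simp
    then show ?thesis by blast
  qed (use D(3) in auto)
  then obtain c d where cd: "\<And>i. K i = {c i..d i}" by metis
  have KU: "K i \<subseteq> U \<inter> {-r..r}" for i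
  proof (cases "K i = {}")
    case False
    then have "K i \<in> D" using KD by blast
    moreover obtain x where "x \<in> A" "K i \<subseteq> \<gamma> x" using D(5)[OF calculation] by blast
    moreover have "\<gamma> x = U" using \<open>x \<in> A\<close> U(2) by (auto simp: \<gamma>_def)
    ultimately show ?thesis using D(2) by auto
  qed auto
  have UnK: "(\<Union>i. K i) = \<Union>D"
  proof
    show "(\<Union>i. K i) \<subseteq> \<Union>D" using KD by fastforce
    show "\<Union>D \<subseteq> (\<Union>i. K i)"
    proof
      fix x assume "x \<in> \<Union>D"
      then obtain L where L: "L \<in> D" "x \<in> L" by auto
      then have "K (to_nat_on D L) = L" using D(1) by (simp add: K_def)
      then show "x \<in> (\<Union>i. K i)" using L by blast
    qed
  qed
  have disj: "disjoint_family (\<lambda>i. interior (K i))"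
    unfolding disjoint_family_on_def
  proof (intro ballI impI)
    fix i j :: nat assume "i \<noteq> j"
    show "interior (K i) \<inter> interior (K j) = {}"
    proof (cases "i \<in> to_nat_on D ` D \<and> j \<in> to_nat_on D ` D")
      case True
      then have "K i \<in> D" "K j \<in> D" "K i \<noteq> K j"
        using D(1) \<open>i \<noteq> j\<close> by (auto simp: K_def)
      then show ?thesis using D(4) by (auto simp: pairwise_def)
    qed (auto simp: K_def)
  qed
  have eq: "(\<integral>\<^sup>+x\<in>{c i..d i}. f x \<partial>lborel) = emeasure N (interior (K i))" for i
  proof -
    have "AE x in lborel. x \<notin> {c i, d i}"
      by (rule AE_not_in) (auto intro: finite_imp_null_set_lborel)
    then have "(\<integral>\<^sup>+x\<in>{c i..d i}. f x \<partial>lborel) = (\<integral>\<^sup>+x\<in>interior (K i) \<inter> {-r..r}. f x \<partial>lborel)"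
      using KU[of i] interior_subset[of "K i"]
      by (intro nn_integral_cong_AE) (auto simp: cd split: split_indicator)
    then show ?thesis by (simp add: N)
  qed
  have "(\<Sum>i. \<integral>\<^sup>+x\<in>{c i..d i}. f x \<partial>lborel) = emeasure N (\<Union>i. interior (K i))"
    unfolding eq by (rule suminf_emeasure) (auto simp: sN disj)
  also have "\<dots> \<le> emeasure N U"
    using KU interior_subset by (intro emeasure_mono) (auto simp: sN U(1) subset_iff)
  finally have "(\<Sum>i. \<integral>\<^sup>+x\<in>{c i..d i}. f x \<partial>lborel) \<le> (\<integral>\<^sup>+x\<in>A. f x \<partial>lborel) + ennreal e"
    using U(3) by (meson less_imp_le order_trans)
  moreover have "A \<subseteq> (\<Union>i. {c i..d i})"
    using D(6) UnK by (simp add: cd)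
  ultimately show ?thesis by (rule that[rotated])
qed

text \<open>A bounded set is covered by intervals at an extra cost of e, each interval is
  controlled, and M is subadditive; unbounded sets are exhausted. This serves the contraction
  property of T, the domination of Stieltjes measures and the fundamental lemma behind weak
  derivatives.\<close>

lemma emeasure_le_density_of_intervals:
  fixes f :: "real \<Rightarrow> ennreal"
  assumes f[measurable]: "f \<in> borel_measurable borel"
    and fin: "\<And>c d. (\<integral>\<^sup>+x\<in>{c..d}. f x \<partial>lborel) < \<infinity>"
    and sM: "sets M = sets borel"
    and le: "\<And>c d. c \<le> d \<Longrightarrow> emeasure M {c..d} \<le> (\<integral>\<^sup>+x\<in>{c..d}. f x \<partial>lborel)"
    and A: "A \<in> sets borel"
  shows "emeasure M A \<le> (\<integral>\<^sup>+x\<in>A. f x \<partial>lborel)"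
proof -
  have bdd: "emeasure M B \<le> (\<integral>\<^sup>+x\<in>B. f x \<partial>lborel)" if B: "B \<in> sets borel" "bounded B" for B
  proof (rule ennreal_le_epsilon)
    fix e :: real assume "0 < e"
    obtain c d where cd: "B \<subseteq> (\<Union>i. {c i..d i})"
      "(\<Sum>i. \<integral>\<^sup>+x\<in>{c i..d i}. f x \<partial>lborel) \<le> (\<integral>\<^sup>+x\<in>B. f x \<partial>lborel) + ennreal e"
      using cover_by_intervals[OF f fin B \<open>0 < e\<close>] by blast
    have le': "emeasure M {c i..d i} \<le> (\<integral>\<^sup>+x\<in>{c i..d i}. f x \<partial>lborel)" for i
      using le[of "c i" "d i"] by (cases "c i \<le> d i") auto
    have "emeasure M B \<le> emeasure M (\<Union>i. {c i..d i})"
      using cd(1) by (rule emeasure_mono) (auto simp: sM)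
    also have "\<dots> \<le> (\<Sum>i. emeasure M {c i..d i})"
      by (rule emeasure_subadditive_countably) (auto simp: sM)
    also have "\<dots> \<le> (\<Sum>i. \<integral>\<^sup>+x\<in>{c i..d i}. f x \<partial>lborel)"
      by (rule suminf_le[OF le']) auto
    finally show "emeasure M B \<le> (\<integral>\<^sup>+x\<in>B. f x \<partial>lborel) + ennreal e"
      using cd(2) by (rule order_trans)
  qed
  define A' where "A' n = A \<inter> {-real n..real n}" for n
  have "emeasure M A = emeasure M (\<Union>n. A' n)"
  proof -
    have "(\<Union>n. A' n) = A"
    proof (auto simp: A'_def)
      fix x obtain n where "\<bar>x\<bar> \<le> real n" using real_arch_simple by blast
      then show "\<exists>n. - real n \<le> x \<and> x \<le> real n" by (intro exI[of _ n]) auto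
    qed
    then show ?thesis by simp
  qed
  also have "\<dots> = (SUP n. emeasure M (A' n))"
    using A by (intro SUP_emeasure_incseq[symmetric]) (auto simp: sM A'_def incseq_def)
  also have "\<dots> \<le> (\<integral>\<^sup>+x\<in>A. f x \<partial>lborel)"
  proof (rule SUP_least)
    fix n
    have "emeasure M (A' n) \<le> (\<integral>\<^sup>+x\<in>A' n. f x \<partial>lborel)"
      using A by (intro bdd) (auto simp: A'_def bounded_Int)
    also have "\<dots> \<le> (\<integral>\<^sup>+x\<in>A. f x \<partial>lborel)"
      by (intro nn_integral_mono) (auto simp: A'_def split: split_indicator)
    finally show "emeasure M (A' n) \<le> (\<integral>\<^sup>+x\<in>A. f x \<partial>lborel)" .
  qed
  finally show ?thesis .
qed

text \<open>A one-sided substitute for the area formula: u maps an interval of f-mass w into one of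
  length w, so a cover of E by intervals of nearly minimal total f-mass yields a cover of the
  attained levels of the same total length. The countably many missing levels have length
  zero.\<close>

lemma image_length_le:
  fixes f :: "real \<Rightarrow> ennreal" and u :: "real \<Rightarrow> real"
  assumes f: "f \<in> borel_measurable borel"
    and fin: "\<And>c d. (\<integral>\<^sup>+x\<in>{c..d}. f x \<partial>lborel) < \<infinity>"
    and u: "\<And>x y. x \<le> y \<Longrightarrow> ennreal \<bar>u y - u x\<bar> \<le> (\<integral>\<^sup>+z\<in>{x..y}. f z \<partial>lborel)"
    and E: "E \<in> sets borel" "bounded E"
    and N: "countable N" "{s<..<t} - N \<subseteq> u ` E"
  shows "ennreal (t - s) \<le> (\<integral>\<^sup>+x\<in>E. f x \<partial>lborel)"
proof (rule ennreal_le_epsilon)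
  fix e :: real assume "0 < e"
  obtain c d where cd: "E \<subseteq> (\<Union>i. {c i..d i})"
    "(\<Sum>i. \<integral>\<^sup>+x\<in>{c i..d i}. f x \<partial>lborel) \<le> (\<integral>\<^sup>+x\<in>E. f x \<partial>lborel) + ennreal e"
    using cover_by_intervals[OF f fin E \<open>0 < e\<close>] by blast
  define w where "w i = enn2real (\<integral>\<^sup>+x\<in>{c i..d i}. f x \<partial>lborel)" for i
  have w: "ennreal (w i) = (\<integral>\<^sup>+x\<in>{c i..d i}. f x \<partial>lborel)" "0 \<le> w i" for i
    using fin by (auto simp: w_def)
  have "\<forall>i. \<exists>\<alpha>. u ` {c i..d i} \<subseteq> {\<alpha>..\<alpha> + w i}"
  proof
    fix i show "\<exists>\<alpha>. u ` {c i..d i} \<subseteq> {\<alpha>..\<alpha> + w i}"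
  proof (cases "c i \<le> d i")
    case True
    have close: "\<bar>u y - u x\<bar> \<le> w i" if xy: "c i \<le> x" "x \<le> y" "y \<le> d i" for x y
    proof -
      have "ennreal \<bar>u y - u x\<bar> \<le> (\<integral>\<^sup>+z\<in>{x..y}. f z \<partial>lborel)" using u xy by simp
      also have "\<dots> \<le> (\<integral>\<^sup>+z\<in>{c i..d i}. f z \<partial>lborel)"
        using xy by (intro nn_integral_mono) (auto split: split_indicator)
      also have "\<dots> = ennreal (w i)" by (simp add: w)
      finally show ?thesis using w(2)[of i] by (simp add: ennreal_le_iff)
    qed
    have close': "\<bar>u y - u x\<bar> \<le> w i" if "x \<in> {c i..d i}" "y \<in> {c i..d i}" for x y
      using that close[of x y] close[of y x] by (cases "x \<le> y") (auto simp: abs_minus_commute)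
    have bdd: "bdd_below (u ` {c i..d i})"
    proof (rule bdd_belowI2)
      fix x assume "x \<in> {c i..d i}"
      then show "u (c i) - w i \<le> u x" using close'[of x "c i"] True by auto
    qed
    have "u x \<in> {Inf (u ` {c i..d i})..Inf (u ` {c i..d i}) + w i}" if x: "x \<in> {c i..d i}" for x
    proof -
      have "u x - w i \<le> Inf (u ` {c i..d i})"
      proof (rule cInf_greatest)
        show "u ` {c i..d i} \<noteq> {}" using x by blast
        show "u x - w i \<le> z" if "z \<in> u ` {c i..d i}" for z
          using that close'[of _ x] x by fastforce
      qed
      then show ?thesis using cInf_lower[OF _ bdd, of "u x"] x by auto
    qed
    then show ?thesis by blast
  qed auto
  qed
  then obtain \<alpha> where "\<forall>i. u ` {c i..d i} \<subseteq> {\<alpha> i..\<alpha> i + w i}"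
    unfolding choice_iff ..
  note \<alpha> = this[rule_format]
  have "{s<..<t} - N \<subseteq> (\<Union>i. {\<alpha> i..\<alpha> i + w i})"
  proof
    fix \<nu> assume "\<nu> \<in> {s<..<t} - N"
    then obtain x where x: "x \<in> E" "\<nu> = u x" using N(2) by auto
    then obtain i where "x \<in> {c i..d i}" using cd(1) by auto
    then show "\<nu> \<in> (\<Union>i. {\<alpha> i..\<alpha> i + w i})" using \<alpha>[of i] x(2) by blast
  qed
  have "ennreal (t - s) = emeasure lborel ({s<..<t} - N)"
  proof -
    have "N \<in> null_sets lborel" using N(1) by (rule countable_imp_null_set_lborel)
    then have "emeasure lborel ({s<..<t} - N) = emeasure lborel {s<..<t}"
      by (intro emeasure_Diff_null_set) auto
    then show ?thesis by (cases "s \<le> t") (auto simp: ennreal_neg)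
  qed
  also have "\<dots> \<le> emeasure lborel (\<Union>i. {\<alpha> i..\<alpha> i + w i})"
    by (rule emeasure_mono) (fact | auto)+
  also have "\<dots> \<le> (\<Sum>i. emeasure lborel {\<alpha> i..\<alpha> i + w i})"
    by (rule emeasure_subadditive_countably) auto
  also have "\<dots> = (\<Sum>i. \<integral>\<^sup>+x\<in>{c i..d i}. f x \<partial>lborel)"
    using w by (intro suminf_cong) simp
  finally show "ennreal (t - s) \<le> (\<integral>\<^sup>+x\<in>E. f x \<partial>lborel) + ennreal e"
    using cd(2) by (rule order_trans)
qed

text \<open>\<open>F Y (f x)\<close> is the rank of x, the measure of the points of Y with a larger
  value. The points strictly between two values of f occupy at most the difference of the
  corresponding ranks. Levels have to be null, since a fat level would put positive measure at a
  single rank.\<close>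

lemma rank_preimage_length_le:
  fixes f :: "real \<Rightarrow> real"
  defines "F \<equiv> \<lambda>Y \<nu>. measure lborel {x \<in> Y. \<nu> < f x}"
  assumes Y[measurable]: "Y \<in> sets borel" and f[measurable]: "f \<in> borel_measurable borel"
    and X[measurable]: "X \<in> sets borel" and "X \<subseteq> Y"
    and fin: "\<And>x. x \<in> X \<Longrightarrow> emeasure lborel {x' \<in> Y. f x < f x'} < \<infinity>"
    and null: "\<And>x. x \<in> X \<Longrightarrow> emeasure lborel {x' \<in> Y. f x' = f x} = 0"
    and B: "\<And>x. x \<in> X \<Longrightarrow> \<bar>f x\<bar> \<le> B" and y: "y1 \<le> y2"
  shows "emeasure lborel {x \<in> X. y1 \<le> F Y (f x) \<and> F Y (f x) \<le> y2} \<le> ennreal (y2 - y1)"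
proof -
  define Q where "Q = {x \<in> X. y1 \<le> F Y (f x) \<and> F Y (f x) \<le> y2}"
  show ?thesis
  proof (cases "Q = {}")
    case True
    then show ?thesis unfolding Q_def by (simp only: emeasure_empty) simp
  next
    case False
    have bdd: "bdd_below (f ` Q)" "bdd_above (f ` Q)"
      using B by (auto simp: Q_def abs_le_iff minus_le_iff intro!: bdd_belowI2[of _ "-B"] bdd_aboveI2[of _ _ B])
    define s t where "s = Inf (f ` Q)" and "t = Sup (f ` Q)"
    have st: "s \<le> f x" "f x \<le> t" if "x \<in> Q" for x
      using that bdd by (auto simp: s_def t_def intro: cInf_lower cSup_upper)
    \<comment> \<open>s and t need not be attained on Q; the margin 1/(n+1) leaves room for points
      x1 and x2 of Q whose values enclose those on \<open>A n\<close>.\<close>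
    define A where "A n = {x \<in> Y. s + 1 / Suc n < f x \<and> f x \<le> t - 1 / Suc n}" for n :: nat
    have A_meas: "A n \<in> sets lborel" for n
      unfolding A_def by measurable
    have A_le: "emeasure lborel (A n) \<le> ennreal (y2 - y1)" for n
    proof (cases "A n = {}")
      case False
      then obtain z where z: "z \<in> Y" "s + 1 / Suc n < f z" "f z \<le> t - 1 / Suc n"
        by (auto simp: A_def)
      have "Inf (f ` Q) < s + 1 / Suc n" by (simp add: s_def)
      then obtain x1 where x1: "x1 \<in> Q" "f x1 < s + 1 / Suc n"
        using cInf_lessD[of "f ` Q"] \<open>Q \<noteq> {}\<close> by auto
      have "t - 1 / Suc n < Sup (f ` Q)" by (simp add: t_def)
      then obtain x2 where x2: "x2 \<in> Q" "t - 1 / Suc n < f x2"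
        using less_cSupE[of _ "f ` Q"] \<open>Q \<noteq> {}\<close> by blast
      have fin1: "emeasure lborel {x' \<in> Y. f x1 < f x'} < \<infinity>" "emeasure lborel {x' \<in> Y. f x2 < f x'} < \<infinity>"
        using x1 x2 fin by (auto simp: Q_def)
      have meas: "{x' \<in> Y. v < f x'} \<in> sets lborel" for v by measurable
      have "emeasure lborel (A n) \<le> emeasure lborel ({x' \<in> Y. f x1 < f x'} - {x' \<in> Y. f x2 < f x'})"
        using x1 x2 meas by (intro emeasure_mono) (auto simp: A_def)
      also have "\<dots> = emeasure lborel {x' \<in> Y. f x1 < f x'} - emeasure lborel {x' \<in> Y. f x2 < f x'}"
        using fin1 meas x1 x2 z by (intro emeasure_Diff) auto
      also have "\<dots> = ennreal (F Y (f x1) - F Y (f x2))"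
        using fin1 by (simp add: F_def emeasure_eq_ennreal_measure ennreal_minus less_top)
      also have "\<dots> \<le> ennreal (y2 - y1)"
        using x1 x2 by (intro ennreal_leI) (auto simp: Q_def)
      finally show ?thesis .
    qed simp
    have "incseq A"
    proof (rule incseq_SucI)
      fix n
      have "1 / real (Suc (Suc n)) \<le> 1 / real (Suc n)" by (simp add: field_simps)
      then show "A n \<le> A (Suc n)" by (auto simp: A_def)
    qed
    have UA: "{x \<in> Y. s < f x \<and> f x < t} \<subseteq> (\<Union>n. A n)"
    proof
      fix x assume x: "x \<in> {x \<in> Y. s < f x \<and> f x < t}"
      then obtain n where n: "1 / Suc n < min (f x - s) (t - f x)"
        by (metis (no_types, lifting) diff_gt_0_iff_gt inverse_eq_divide mem_Collect_eq min_less_iff_conj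
            reals_Archimedean)
      then have "x \<in> A n" using x by (auto simp: A_def)
      then show "x \<in> (\<Union>n. A n)" by blast
    qed
    have "emeasure lborel (\<Union>n. A n) \<le> ennreal (y2 - y1)"
      using A_meas \<open>incseq A\<close> A_le by (subst SUP_emeasure_incseq[symmetric]) (auto intro: SUP_least)
    have lev: "{x \<in> X. f x = v} \<in> null_sets lborel" for v
    proof (cases "{x \<in> X. f x = v} = {}")
      case False
      then obtain x0 where x0: "x0 \<in> X" "f x0 = v" by auto
      have "emeasure lborel {x \<in> X. f x = v} \<le> emeasure lborel {x' \<in> Y. f x' = f x0}"
        using x0 \<open>X \<subseteq> Y\<close> by (intro emeasure_mono) auto
      then have "emeasure lborel {x \<in> X. f x = v} = 0" using null[OF x0(1)] by simp
      then show ?thesis by (intro null_setsI) auto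
    qed (simp only: null_sets.empty_sets)
    have "emeasure lborel Q \<le> emeasure lborel ((\<Union>n. A n) \<union> ({x \<in> X. f x = s} \<union> {x \<in> X. f x = t}))"
    proof (rule emeasure_mono)
      show "Q \<subseteq> (\<Union>n. A n) \<union> ({x \<in> X. f x = s} \<union> {x \<in> X. f x = t})"
      proof
        fix x assume x: "x \<in> Q"
        have "x \<in> {x \<in> Y. s < f x \<and> f x < t} \<or> f x = s \<or> f x = t"
          using st[OF x] x \<open>X \<subseteq> Y\<close> by (auto simp: Q_def)
        then show "x \<in> (\<Union>n. A n) \<union> ({x \<in> X. f x = s} \<union> {x \<in> X. f x = t})"
          using UA x by (auto simp: Q_def)
      qed
    qed (use A_meas in measurable)
    also have "\<dots> = emeasure lborel (\<Union>n. A n)"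
      using A_meas lev by (intro emeasure_Un_null_set null_sets.Un) auto
    finally show ?thesis
      using \<open>emeasure lborel (\<Union>n. A n) \<le> _\<close> unfolding Q_def by (rule order_trans)
  qed
qed

text \<open>A fat level is an atom of the image under u of Lebesgue measure on some bounded piece of
  Y, and a finite measure has only countably many atoms.\<close>

lemma countable_fat_levels:
  fixes u :: "real \<Rightarrow> real"
  assumes u[measurable]: "u \<in> borel_measurable borel" and Y[measurable]: "Y \<in> sets borel"
  shows "countable {\<nu>. emeasure lborel {x \<in> Y. u x = \<nu>} \<noteq> 0}"
proof -
  define Y' where "Y' n = Y \<inter> {-real n..real n}" for n :: nat
  define M where "M n = distr (density lborel (indicator (Y' n))) borel u" for n
  have [measurable]: "Y' n \<in> sets borel" for n by (simp add: Y'_def)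
  have M: "emeasure (M n) {\<nu>} = emeasure lborel {x \<in> Y' n. u x = \<nu>}" for n \<nu>
  proof -
    have "emeasure (M n) {\<nu>} = (\<integral>\<^sup>+x. indicator (Y' n) x * indicator (u -` {\<nu>}) x \<partial>lborel)"
      using measurable_sets[OF u, of "{\<nu>}"]
      by (simp add: M_def emeasure_distr emeasure_density)
    also have "\<dots> = (\<integral>\<^sup>+x. indicator {x \<in> Y' n. u x = \<nu>} x \<partial>lborel)"
      by (intro nn_integral_cong) (auto split: split_indicator)
    finally show ?thesis by simp
  qed
  have fin: "finite_measure (M n)" for n
  proof
    have "emeasure (M n) (space (M n)) = emeasure lborel (Y' n)"
      by (simp add: M_def emeasure_distr emeasure_density)
    also have "\<dots> \<le> emeasure lborel {-real n..real n}"
      by (intro emeasure_mono) (auto simp: Y'_def)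
    finally show "emeasure (M n) (space (M n)) \<noteq> \<infinity>"
      by (auto simp: top_unique)
  qed
  have "countable (\<Union>n. {\<nu>. measure (M n) {\<nu>} \<noteq> 0})"
    using finite_measure.countable_support[OF fin] by auto
  moreover have "{\<nu>. emeasure lborel {x \<in> Y. u x = \<nu>} \<noteq> 0} \<subseteq> (\<Union>n. {\<nu>. measure (M n) {\<nu>} \<noteq> 0})"
  proof
    fix \<nu> assume \<nu>: "\<nu> \<in> {\<nu>. emeasure lborel {x \<in> Y. u x = \<nu>} \<noteq> 0}"
    show "\<nu> \<in> (\<Union>n. {\<nu>. measure (M n) {\<nu>} \<noteq> 0})"
    proof (rule ccontr)
      assume "\<nu> \<notin> (\<Union>n. {\<nu>. measure (M n) {\<nu>} \<noteq> 0})"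
      then have "emeasure lborel {x \<in> Y' n. u x = \<nu>} = 0" for n
        using M[of n \<nu>] finite_measure.emeasure_eq_measure[OF fin, of n "{\<nu>}"] by simp
      then have "{x \<in> Y' n. u x = \<nu>} \<in> null_sets lborel" for n
        by (intro null_setsI) auto
      then have "(\<Union>n. {x \<in> Y' n. u x = \<nu>}) \<in> null_sets lborel" by auto
      moreover have "(\<Union>n. {x \<in> Y' n. u x = \<nu>}) = {x \<in> Y. u x = \<nu>}"
      proof (auto simp: Y'_def)
        fix x obtain n where "\<bar>x\<bar> \<le> real n" using real_arch_simple by blast
        then show "\<exists>n. - real n \<le> x \<and> x \<le> real n" by (intro exI[of _ n]) auto
      qed
      ultimately show False using \<nu> by auto
    qed
  qed
  ultimately show ?thesis by (rule countable_subset[rotated])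
qed

section \<open>Energies of pushforwards\<close>

lemma powr_tangent_le:
  fixes a b p :: real
  assumes "1 \<le> p" "0 \<le> a" "0 \<le> b"
  shows "p * (b powr (p - 1) * a) \<le> a powr p + (p - 1) * b powr p"
proof (cases "p = 1 \<or> a = 0 \<or> b = 0")
  case True
  then show ?thesis using assms by auto
next
  case False
  then have p: "1 < p" "0 < a" "0 < b" using assms by auto
  define q where "q = p / (p - 1)"
  have q: "1 < q" "1 / p + 1 / q = 1" using p by (auto simp: q_def field_simps)
  have "a * b powr (p - 1) \<le> a powr p / p + (b powr (p - 1)) powr q / q"
    using p q by (intro Youngs_inequality) auto
  also have "(b powr (p - 1)) powr q = b powr p"
    using p by (simp add: powr_powr q_def)
  finally have "p * (a * b powr (p - 1)) \<le> p * (a powr p / p + b powr p / q)"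
    using p by (intro mult_left_mono) auto
  also have "\<dots> = a powr p + (p - 1) * b powr p"
    using p by (simp add: q_def field_simps)
  finally show ?thesis by (simp add: mult_ac)
qed

abbreviation mass :: "(real \<Rightarrow> real) \<Rightarrow> real set \<Rightarrow> ennreal" where
  "mass k A \<equiv> \<integral>\<^sup>+x\<in>A. ennreal (k x) \<partial>lborel"

abbreviation energy :: "real \<Rightarrow> (real \<Rightarrow> real) \<Rightarrow> ennreal" where
  "energy p f \<equiv> \<integral>\<^sup>+x. ennreal (\<bar>f x\<bar> powr p) \<partial>lborel"

text \<open>Jensen's inequality by tangents: \<open>powr_tangent_le\<close> says that a^p lies above
  its tangent at b. Taken with a = G x and b = k (T x) and integrated over X, it gives p J <= I + (p
  - 1) J for the energy J of k, where the last term is bounded by the contraction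
  hypothesis.\<close>

lemma pushforward_powr_integral_le:
  fixes T G k :: "real \<Rightarrow> real"
  assumes p: "1 \<le> p" and X[measurable]: "X \<in> sets borel"
    and T[measurable]: "T \<in> borel_measurable borel"
    and G[measurable]: "G \<in> borel_measurable borel" and G0: "\<And>x. 0 \<le> G x"
    and k[measurable]: "k \<in> borel_measurable borel" and k0: "\<And>y. 0 \<le> k y"
    and push: "distr (density lborel (\<lambda>x. ennreal (G x) * indicator X x)) borel T = density lborel (\<lambda>y. ennreal (k y))"
    and contr: "distr (density lborel (indicator X)) borel T \<le> lborel"
  shows "(\<integral>\<^sup>+y. ennreal (k y powr p) \<partial>lborel) \<le> (\<integral>\<^sup>+x\<in>X. ennreal (G x powr p) \<partial>lborel)"
proof -
  define I where "I = (\<integral>\<^sup>+x\<in>X. ennreal (G x powr p) \<partial>lborel)"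
  \<comment> \<open>Subtracting (p - 1) J requires J to be finite, hence the truncation in height
    and in width; monotone convergence removes it at the end.\<close>
  define b where "b n y = min (k y) (real n) * indicator {-real n..real n} y" for n :: nat and y :: real
  have b0: "0 \<le> b n y" for n y using k0 by (simp add: b_def)
  have bk: "b n y \<le> k y" for n y using k0 by (auto simp: b_def split: split_indicator)
  have [measurable]: "b n \<in> borel_measurable borel" for n unfolding b_def by measurable
  have le: "(\<integral>\<^sup>+y. ennreal (b n y powr p) \<partial>lborel) \<le> I" for n
  proof -
    define J where "J = (\<integral>\<^sup>+y. ennreal (b n y powr p) \<partial>lborel)"
    have "J \<le> (\<integral>\<^sup>+y. ennreal (real n powr p) * indicator {-real n..real n} y \<partial>lborel)"
      unfolding J_def
      using p k0 by (intro nn_integral_mono) (auto simp: b_def split: split_indicator intro!: ennreal_leI powr_mono2)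
    also have "\<dots> < \<infinity>"
      by (subst nn_integral_cmult_indicator) (auto simp: ennreal_mult_less_top)
    finally have J: "J < \<infinity>" .
    have "ennreal p * J = (\<integral>\<^sup>+y. ennreal (p * (b n y powr (p - 1) * b n y)) \<partial>lborel)"
    proof -
      have "b n y powr (p - 1) * b n y = b n y powr p" for y
        using b0[of n y] by (cases "b n y = 0") (auto simp: powr_diff)
      then have "ennreal (p * (b n y powr (p - 1) * b n y)) = ennreal p * ennreal (b n y powr p)" for y
        using p by (simp add: ennreal_mult')
      then show ?thesis unfolding J_def by (simp add: nn_integral_cmult)
    qed
    also have "\<dots> \<le> (\<integral>\<^sup>+y. ennreal (k y) * ennreal (p * b n y powr (p - 1)) \<partial>lborel)"
    proof (rule nn_integral_mono)
      fix y
      have "p * (b n y powr (p - 1) * b n y) \<le> k y * (p * b n y powr (p - 1))"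
        using p bk[of n y] mult_left_mono[OF bk[of n y], of "p * b n y powr (p - 1)"] by (simp add: mult_ac)
      then show "ennreal (p * (b n y powr (p - 1) * b n y)) \<le> ennreal (k y) * ennreal (p * b n y powr (p - 1))"
        using k0 by (simp add: ennreal_mult'[symmetric] ennreal_leI)
    qed
    also have "\<dots> = (\<integral>\<^sup>+y. ennreal (p * b n y powr (p - 1)) \<partial>density lborel (\<lambda>y. ennreal (k y)))"
      by (subst nn_integral_density) auto
    also have "\<dots> = (\<integral>\<^sup>+x. ennreal (p * b n (T x) powr (p - 1)) \<partial>density lborel (\<lambda>x. ennreal (G x) * indicator X x))"
      unfolding push[symmetric] by (rule nn_integral_distr) auto
    also have "\<dots> = (\<integral>\<^sup>+x. ennreal (G x) * indicator X x * ennreal (p * b n (T x) powr (p - 1)) \<partial>lborel)"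
      by (subst nn_integral_density) auto
    also have "\<dots> \<le> (\<integral>\<^sup>+x. ennreal (G x powr p) * indicator X x
        + ennreal (p - 1) * (indicator X x * ennreal (b n (T x) powr p)) \<partial>lborel)"
    proof (rule nn_integral_mono)
      fix x
      show "ennreal (G x) * indicator X x * ennreal (p * b n (T x) powr (p - 1))
        \<le> ennreal (G x powr p) * indicator X x + ennreal (p - 1) * (indicator X x * ennreal (b n (T x) powr p))"
        using powr_tangent_le[OF p G0[of x] b0[of n "T x"]] p G0[of x] b0[of n "T x"]
        by (auto split: split_indicator simp: mult_ac simp flip: ennreal_mult' ennreal_plus intro!: ennreal_leI)
    qed
    also have "\<dots> = I + ennreal (p - 1) * (\<integral>\<^sup>+x. indicator X x * ennreal (b n (T x) powr p) \<partial>lborel)"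
      unfolding I_def by (subst nn_integral_add) (auto simp: nn_integral_cmult)
    also have "(\<integral>\<^sup>+x. indicator X x * ennreal (b n (T x) powr p) \<partial>lborel)
        = (\<integral>\<^sup>+x. ennreal (b n (T x) powr p) \<partial>density lborel (indicator X))"
      by (subst nn_integral_density) auto
    also have "\<dots> = (\<integral>\<^sup>+y. ennreal (b n y powr p) \<partial>distr (density lborel (indicator X)) borel T)"
      by (rule nn_integral_distr[symmetric]) auto
    also have "\<dots> \<le> J"
      unfolding J_def by (rule nn_integral_mono_measure[OF _ contr]) simp
    finally have "ennreal p * J \<le> I + ennreal (p - 1) * J"
      by (simp add: mult_left_mono)
    moreover have "ennreal p * J = J + ennreal (p - 1) * J"
    proof -
      have "ennreal p = ennreal (1 + (p - 1))" by simp
      also have "\<dots> = ennreal 1 + ennreal (p - 1)" using p by (intro ennreal_plus) auto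
      finally show ?thesis by (simp add: distrib_right)
    qed
    moreover have "ennreal (p - 1) * J < \<infinity>" using J by (simp add: ennreal_mult_less_top)
    ultimately show ?thesis unfolding J_def[symmetric]
      by (metis add.commute ennreal_add_left_cancel_le infinity_ennreal_def less_top not_less top.not_eq_extremum)
  qed
  have "(\<integral>\<^sup>+y. ennreal (k y powr p) \<partial>lborel) = (\<integral>\<^sup>+y. (SUP n. ennreal (b n y powr p)) \<partial>lborel)"
  proof (rule nn_integral_cong)
    fix y
    obtain N :: nat where N: "max \<bar>y\<bar> (k y) \<le> real N" using real_arch_simple by blast
    then have "b N y = k y" by (auto simp: b_def split: split_indicator)
    moreover have "ennreal (b n y powr p) \<le> ennreal (k y powr p)" for n
      using p b0 bk by (intro ennreal_leI powr_mono2) auto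
    ultimately show "ennreal (k y powr p) = (SUP n. ennreal (b n y powr p))"
      by (intro antisym SUP_least) (auto intro: SUP_upper2[of N])
  qed
  also have "\<dots> = (SUP n. \<integral>\<^sup>+y. ennreal (b n y powr p) \<partial>lborel)"
  proof (rule nn_integral_monotone_convergence_SUP)
    show "incseq (\<lambda>n y. ennreal (b n y powr p))"
    proof (rule incseq_SucI, rule le_funI, intro ennreal_leI powr_mono2)
      fix n y
      show "b n y \<le> b (Suc n) y" using k0[of y] by (auto simp: b_def split: split_indicator)
    qed (use p b0 in auto)
  qed auto
  also have "\<dots> \<le> I" using le by (rule SUP_least)
  finally show ?thesis unfolding I_def .
qed

text \<open>The Stieltjes measure of F lies below k dx on intervals, hence on all Borel sets. It is
  therefore absolutely continuous, and its Radon-Nikodym density is at most k almost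
  everywhere.\<close>

lemma dominated_increments_density:
  fixes F k :: "real \<Rightarrow> real"
  assumes k[measurable]: "k \<in> borel_measurable borel" and k0: "\<And>y. 0 \<le> k y"
    and fin: "\<And>c d. mass k {c..d} < \<infinity>"
    and mono: "\<And>x y. x \<le> y \<Longrightarrow> F x \<le> F y"
    and le: "\<And>x y. x \<le> y \<Longrightarrow> ennreal (F y - F x) \<le> mass k {x..y}"
  obtains \<eta> where "\<eta> \<in> borel_measurable borel" "\<And>y. 0 \<le> \<eta> y" "\<And>y. \<eta> y \<le> k y"
    "\<And>x y. x \<le> y \<Longrightarrow> ennreal (F y - F x) = mass \<eta> {x..y}"
proof -
  define K where "K = density lborel (\<lambda>z. ennreal (k z))"
  have K: "emeasure K A = mass k A" if "A \<in> sets borel" for A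
    using that by (simp add: K_def emeasure_density)
  have sK: "sets K = sets borel" by (simp add: K_def)
  \<comment> \<open>The measure k dx has no atoms. This yields the right continuity of F that
    \<open>interval_measure\<close> asks for, and it lets the half-open intervals on which the
    Stieltjes measure is known be compared with closed ones.\<close>
  have small: "\<exists>\<delta>>0. emeasure K {x - \<delta>..x + \<delta>} < ennreal e" if "0 < e" for x e
  proof -
    have "(\<lambda>n. emeasure K {x - 1 / Suc n..x + 1 / Suc n}) \<longlonglongrightarrow> emeasure K (\<Inter>n. {x - 1 / Suc n..x + 1 / Suc n})"
    proof (rule Lim_emeasure_decseq)
      show "decseq (\<lambda>n. {x - 1 / Suc n..x + 1 / Suc n})"
        by (rule decseq_SucI) (auto simp: field_simps intro: order_trans)
    qed (use fin in \<open>auto simp: sK K less_top\<close>)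
    also have "(\<Inter>n. {x - 1 / Suc n..x + 1 / Suc n}) = {x}"
    proof (intro antisym subsetI)
      fix z assume z: "z \<in> (\<Inter>n. {x - 1 / Suc n..x + 1 / Suc n})"
      have "\<not> 0 < \<bar>z - x\<bar>"
      proof
        assume "0 < \<bar>z - x\<bar>"
        then obtain n where "inverse (real (Suc n)) < \<bar>z - x\<bar>" using reals_Archimedean by blast
        moreover have "z \<in> {x - 1 / Suc n..x + 1 / Suc n}" using z by blast
        ultimately show False by (auto simp: inverse_eq_divide)
      qed
      then show "z \<in> {x}" by simp
    qed auto
    also have "emeasure K {x} = 0"
      by (subst K) (auto intro!: nn_integral_null_set finite_imp_null_set_lborel)
    finally have "\<forall>\<^sub>F n in sequentially. emeasure K {x - 1 / Suc n..x + 1 / Suc n} < ennreal e"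
      using \<open>0 < e\<close> by (intro order_tendstoD) auto
    then obtain n where "emeasure K {x - 1 / Suc n..x + 1 / Suc n} < ennreal e"
      by (auto simp: eventually_sequentially)
    then show ?thesis by (intro exI[of _ "1 / Suc n"]) simp
  qed
  have rc: "continuous (at_right x) F" for x
  proof (rule iffD2[OF continuous_at_right_real_increasing], erule mono, intro allI impI)
    fix e :: real assume "0 < e"
    then obtain \<delta> where \<delta>: "0 < \<delta>" "emeasure K {x - \<delta>..x + \<delta>} < ennreal e" using small by blast
    have "ennreal (F (x + \<delta>) - F x) \<le> emeasure K {x..x + \<delta>}" using le[of x "x + \<delta>"] \<delta>(1) by (simp add: K)
    also have "\<dots> \<le> emeasure K {x - \<delta>..x + \<delta>}" using \<delta>(1) by (intro emeasure_mono) (auto simp: sK)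
    also note \<delta>(2)
    finally show "\<exists>\<delta>>0. F (x + \<delta>) - F x < e"
      using mono[of x "x + \<delta>"] \<delta>(1) by (intro exI[of _ \<delta>]) (auto simp: ennreal_less_iff)
  qed
  define D where "D = interval_measure F"
  have sD: "sets D = sets borel" by (simp add: D_def)
  have DIoc: "emeasure D {x<..y} = ennreal (F y - F x)" if "x \<le> y" for x y
    unfolding D_def using that mono rc by (rule emeasure_interval_measure_Ioc)
  have D_le: "emeasure D A \<le> mass k A" if "A \<in> sets borel" for A
  proof (rule emeasure_le_density_of_intervals[OF _ fin sD _ that])
    fix c d :: real assume "c \<le> d"
    have "emeasure D {c..d} \<le> emeasure K {c..d}"
    proof (rule ennreal_le_epsilon)
      fix e :: real assume "0 < e"
      then obtain \<delta> where \<delta>: "0 < \<delta>" "emeasure K {c - \<delta>..c + \<delta>} < ennreal e" using small by blast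
      have "emeasure D {c..d} \<le> emeasure D {c - \<delta><..d}"
        using \<delta>(1) by (intro emeasure_mono) (auto simp: sD)
      also have "\<dots> \<le> emeasure K {c - \<delta>..d}"
        using le[of "c - \<delta>" d] \<open>c \<le> d\<close> \<delta>(1) by (simp add: DIoc K)
      also have "\<dots> \<le> emeasure K ({c..d} \<union> {c - \<delta>..c + \<delta>})"
        by (intro emeasure_mono) (auto simp: sK)
      also have "\<dots> \<le> emeasure K {c..d} + emeasure K {c - \<delta>..c + \<delta>}"
        by (rule emeasure_subadditive) (auto simp: sK)
      also have "\<dots> \<le> emeasure K {c..d} + ennreal e"
        using \<delta>(2) by (intro add_left_mono) simp
      finally show "emeasure D {c..d} \<le> emeasure K {c..d} + ennreal e" .
    qed
    then show "emeasure D {c..d} \<le> mass k {c..d}" by (simp add: K)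
  qed auto
  have "absolutely_continuous lborel D"
    unfolding absolutely_continuous_def
  proof
    fix A :: "real set" assume A: "A \<in> null_sets lborel"
    then have "A \<in> sets borel" by auto
    have "mass k A = 0"
      using A by (rule nn_integral_null_set)
    then show "A \<in> null_sets D"
      using D_le[OF \<open>A \<in> sets borel\<close>] \<open>A \<in> sets borel\<close> by (intro null_setsI) (auto simp: sD)
  qed
  then obtain q where q[measurable]: "q \<in> borel_measurable lborel" and Dq: "density lborel q = D"
    using sigma_finite_measure.Radon_Nikodym[OF lborel.sigma_finite_measure_axioms, of D] by (auto simp: sD)
  have Dq': "emeasure D A = (\<integral>\<^sup>+z\<in>A. q z \<partial>lborel)" if "A \<in> sets borel" for A
    using that by (simp add: Dq[symmetric] emeasure_density)
  have qk: "AE z in lborel. q z \<le> ennreal (k z)"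
  proof (rule AE_of_intervals)
    fix n :: nat
    define A where "A = {z \<in> {-real n..real n}. ennreal (k z) < q z}"
    have [measurable]: "A \<in> sets lborel" unfolding A_def by measurable
    then have Ab: "A \<in> sets borel" by simp
    have "mass k A \<le> mass k {-real n..real n}"
      by (intro nn_integral_mono) (auto simp: A_def split: split_indicator)
    then have finA: "mass k A \<noteq> \<infinity>"
      using fin[of "- real n" "real n"] by (auto simp: less_top top_unique)
    have "(\<integral>\<^sup>+z. q z * indicator A z - ennreal (k z) * indicator A z \<partial>lborel)
        = (\<integral>\<^sup>+z\<in>A. q z \<partial>lborel) - mass k A"
      using finA by (intro nn_integral_diff) (auto simp: A_def split: split_indicator)
    also have "\<dots> = 0"
      using D_le[OF Ab] Dq'[OF Ab] finA
      by (auto intro!: diff_eq_0_ennreal simp: less_top[symmetric] top_unique)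
    finally have "AE z in lborel. q z * indicator A z - ennreal (k z) * indicator A z = 0"
      by (subst (asm) nn_integral_0_iff_AE) auto
    then show "AE z in lborel. z \<in> {-real n..real n} \<longrightarrow> q z \<le> ennreal (k z)"
    proof eventually_elim
      case (elim z)
      then show ?case by (cases "z \<in> A") (auto simp: A_def diff_eq_0_iff_ennreal)
    qed
  qed
  \<comment> \<open>The minimum turns the almost everywhere bound by k into a pointwise one and
    changes the density only on a null set.\<close>
  define \<eta> where "\<eta> z = min (enn2real (q z)) (k z)" for z
  have \<eta>q: "AE z in lborel. ennreal (\<eta> z) = q z"
    using qk
  proof eventually_elim
    case (elim z)
    then have "q z < top" by (metis ennreal_less_top order_le_less_trans)
    then have "enn2real (q z) \<le> k z" using elim k0[of z] by (simp add: enn2real_leI)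
    then show ?case using \<open>q z < top\<close> by (simp add: \<eta>_def)
  qed
  show ?thesis
  proof (rule that[of \<eta>])
    show "\<eta> \<in> borel_measurable borel" unfolding \<eta>_def by measurable
    show "0 \<le> \<eta> y" "\<eta> y \<le> k y" for y using k0 by (auto simp: \<eta>_def)
    fix x y :: real assume "x \<le> y"
    have "ennreal (F y - F x) = (\<integral>\<^sup>+z\<in>{x<..y}. q z \<partial>lborel)"
      using DIoc[OF \<open>x \<le> y\<close>] Dq' by simp
    also have "\<dots> = mass \<eta> {x..y}"
      using \<eta>q AE_lborel_singleton[of x]
      by (intro nn_integral_cong_AE, eventually_elim) (auto split: split_indicator)
    finally show "ennreal (F y - F x) = mass \<eta> {x..y}" .
  qed
qed

section \<open>Test functions\<close>

text \<open>The functions x^-k exp(-1/x), extended by 0. The exponent is carried along because the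
  derivative is a combination of the members with exponents k + 1 and k + 2, so differentiation
  never leaves the linear span of the family.\<close>

definition flat_power :: "nat \<Rightarrow> real \<Rightarrow> real" where
  "flat_power k x = (if 0 < x then (1 / x) ^ k * exp (- (1 / x)) else 0)"

lemma flat_power_tendsto_0: "(flat_power k \<longlongrightarrow> 0) (at 0)"
proof -
  have "((\<lambda>t::real. t ^ k / exp t) \<longlongrightarrow> 0) at_top" by (rule tendsto_power_div_exp_0)
  then have "((\<lambda>x::real. inverse x ^ k / exp (inverse x)) \<longlongrightarrow> 0) (at_right 0)"
    by (rule filterlim_compose[OF _ filterlim_inverse_at_top_right])
  moreover have "\<forall>\<^sub>F x in at_right 0. inverse x ^ k / exp (inverse x) = flat_power k x"
    by (auto simp: eventually_at_filter flat_power_def exp_minus field_simps)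
  ultimately have "(flat_power k \<longlongrightarrow> 0) (at_right 0)" by (rule Lim_transform_eventually)
  moreover have "(flat_power k \<longlongrightarrow> 0) (at_left 0)"
    by (rule tendsto_eventually) (auto simp: eventually_at_filter flat_power_def)
  ultimately show ?thesis by (simp add: filterlim_at_split)
qed

lemma flat_power_has_derivative:
  "(flat_power k has_real_derivative (- real k * flat_power (Suc k) x + flat_power (k + 2) x)) (at x)"
proof -
  consider "x < 0" | "x = 0" | "0 < x" by linarith
  then show ?thesis
  proof cases
    case 1
    have "((\<lambda>_. 0) has_real_derivative 0) (at x)" by simp
    then have "(flat_power k has_real_derivative 0) (at x)"
      by (rule has_field_derivative_transform_within_open[where S="{..<0}"]) (use 1 in \<open>auto simp: flat_power_def\<close>)
    then show ?thesis using 1 by (simp add: flat_power_def)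
  next
    case 2
    \<comment> \<open>The difference quotient of \<open>flat_power k\<close> at 0 is
      \<open>flat_power (Suc k)\<close>.\<close>
    have "((\<lambda>y. (flat_power k y - flat_power k 0) / (y - 0)) \<longlongrightarrow> 0) (at 0)"
      by (rule Lim_transform_eventually[OF flat_power_tendsto_0[of "Suc k"]])
        (auto simp: eventually_at_filter flat_power_def)
    then show ?thesis using 2 by (simp add: has_field_derivative_iff flat_power_def)
  next
    case 3
    have d: "((\<lambda>y. 1 / y) has_real_derivative - ((1 / x)^2)) (at x)"
      using 3 by (auto intro!: derivative_eq_intros simp: power2_eq_square field_simps)
    have "((\<lambda>y. exp (- (1 / y))) has_real_derivative exp (- (1 / x)) * (1 / x)^2) (at x)"
      by (rule DERIV_cong[OF DERIV_chain2[OF DERIV_exp DERIV_minus[OF d]]]) simp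
    from DERIV_mult[OF DERIV_power[OF d, of k] this]
    have "((\<lambda>y. (1 / y) ^ k * exp (- (1 / y))) has_real_derivative
        (- real k * flat_power (Suc k) x + flat_power (k + 2) x)) (at x)"
      by (rule DERIV_cong) (use 3 in \<open>cases k; simp add: flat_power_def power2_eq_square algebra_simps add_divide_distrib diff_divide_distrib\<close>)
    then show ?thesis
      using 3 by (rule_tac has_field_derivative_transform_within_open[where S="{0<..}"]) (auto simp: flat_power_def)
  qed
qed

text \<open>An algebra of functions stable under differentiation. Membership alone gives
  differentiability of all iterated derivatives, as \<open>test_function\<close> demands, without a
  formula for them.\<close>

inductive flat_algebra :: "(real \<Rightarrow> real) \<Rightarrow> bool" where
  flat: "flat_algebra (\<lambda>x. flat_power k (a * x + b))"
| const: "flat_algebra (\<lambda>x. c)"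
| add: "flat_algebra f \<Longrightarrow> flat_algebra g \<Longrightarrow> flat_algebra (\<lambda>x. f x + g x)"
| mult: "flat_algebra f \<Longrightarrow> flat_algebra g \<Longrightarrow> flat_algebra (\<lambda>x. f x * g x)"

lemma flat_algebra_deriv:
  "flat_algebra f \<Longrightarrow> \<exists>f'. flat_algebra f' \<and> (\<forall>x. (f has_real_derivative f' x) (at x))"
proof (induction rule: flat_algebra.induct)
  case (flat k a b)
  let ?f' = "\<lambda>x. a * (- real k * flat_power (Suc k) (a * x + b) + flat_power (k + 2) (a * x + b))"
  have "((\<lambda>x. flat_power k (a * x + b)) has_real_derivative ?f' x) (at x)" for x
  proof -
    have "((\<lambda>x. a * x + b) has_real_derivative a) (at x)" by (auto intro!: derivative_eq_intros)
    from DERIV_chain2[OF flat_power_has_derivative this] show ?thesis by (simp add: mult.commute)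
  qed
  moreover have "flat_algebra ?f'" by (intro flat_algebra.intros)
  ultimately show ?case by blast
next
  case (const c)
  have "flat_algebra (\<lambda>x. 0)" by (rule flat_algebra.const)
  then show ?case by (intro exI[of _ "\<lambda>x. 0"]) simp
next
  case (add f g)
  then obtain f' g' where *: "flat_algebra f'" "\<forall>x. (f has_real_derivative f' x) (at x)"
    "flat_algebra g'" "\<forall>x. (g has_real_derivative g' x) (at x)" by blast
  then show ?case
    by (intro exI[of _ "\<lambda>x. f' x + g' x"]) (auto intro: flat_algebra.add DERIV_add)
next
  case (mult f g)
  then obtain f' g' where *: "flat_algebra f'" "\<forall>x. (f has_real_derivative f' x) (at x)"
    "flat_algebra g'" "\<forall>x. (g has_real_derivative g' x) (at x)" by blast
  then show ?case using mult.hyps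
    by (intro exI[of _ "\<lambda>x. f' x * g x + g' x * f x"])
      (auto intro!: flat_algebra.add flat_algebra.mult DERIV_mult)
qed

lemma flat_algebra_derivs: "flat_algebra f \<Longrightarrow> flat_algebra ((deriv ^^ n) f)"
proof (induction n)
  case (Suc n)
  then obtain f' where f': "flat_algebra f'" "\<forall>x. ((deriv ^^ n) f has_real_derivative f' x) (at x)"
    using flat_algebra_deriv by blast
  then have "deriv ((deriv ^^ n) f) = f'" by (auto intro: DERIV_imp_deriv)
  then show ?case using f'(1) by simp
qed simp

lemma flat_algebra_differentiable: "flat_algebra f \<Longrightarrow> f differentiable (at x)"
  using flat_algebra_deriv real_differentiable_def by blast

lemma flat_algebra_continuous: "flat_algebra f \<Longrightarrow> continuous_on S f"
  by (meson continuous_at_imp_continuous_on differentiable_imp_continuous_within flat_algebra_differentiable)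

lemma test_functionI:
  assumes "\<And>n x. (deriv ^^ n) \<psi> differentiable (at x)" and "0 < a" and "\<And>x. x \<notin> {a..b} \<Longrightarrow> \<psi> x = 0"
  shows "test_function \<psi>"
proof -
  have "closure {x. \<psi> x \<noteq> 0} \<subseteq> {a..b}"
    using assms(3) by (intro closure_minimal) (blast | simp)+
  moreover have "compact (closure {x. \<psi> x \<noteq> 0})"
    using calculation by (metis bounded_closed_interval bounded_subset closed_closure compact_eq_bounded_closed)
  ultimately show ?thesis using assms(1,2) by (auto simp: test_function_def)
qed

lemma test_function_support:
  assumes "test_function \<psi>"
  obtains a b where "0 < a" "a < b" "\<And>x. x \<notin> {a..b} \<Longrightarrow> \<psi> x = 0"
proof (cases "{x. \<psi> x \<noteq> 0} = {}")
  case True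
  then show ?thesis using that[of 1 2] by auto
next
  case False
  let ?S = "closure {x. \<psi> x \<noteq> 0}"
  have S: "compact ?S" "?S \<subseteq> {0<..}" using assms by (auto simp: test_function_def)
  then have "?S \<noteq> {}" using False by (simp add: closure_eq_empty)
  then obtain a where a: "a \<in> ?S" "\<And>x. x \<in> ?S \<Longrightarrow> a \<le> x" using compact_attains_inf[OF S(1)] by blast
  obtain b where b: "b \<in> ?S" "\<And>x. x \<in> ?S \<Longrightarrow> x \<le> b" using compact_attains_sup[OF S(1)] \<open>?S \<noteq> {}\<close> by blast
  show ?thesis
  proof (rule that[of a "b + 1"])
    show "0 < a" using a S(2) by auto
    show "a < b + 1" using a b by force
    show "\<psi> x = 0" if "x \<notin> {a..b + 1}" for x
    proof (rule ccontr)
      assume "\<psi> x \<noteq> 0"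
      then have "x \<in> ?S" by (intro subsetD[OF closure_subset]) simp
      then show False using a(2) b(2) that by force
    qed
  qed
qed

text \<open>The (n+1)-st root of the standard bump exp(-1/(x-a) - 1/(b-x)): roots keep the support
  in [a, b] while the values inside increase to 1.\<close>

definition interval_bump :: "real \<Rightarrow> real \<Rightarrow> nat \<Rightarrow> real \<Rightarrow> real" where
  "interval_bump a b n x = flat_power 0 (real (Suc n) * x + (- real (Suc n) * a))
     * flat_power 0 (- real (Suc n) * x + real (Suc n) * b)"

lemma interval_bump_flat_algebra: "flat_algebra (interval_bump a b n)"
  unfolding interval_bump_def by (intro flat_algebra.intros)

lemma interval_bump_eq:
  "interval_bump a b n x = (if a < x \<and> x < b
     then exp (- (1 / (x - a) + 1 / (b - x)) * inverse (real (Suc n))) else 0)"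
proof -
  have *: "real (Suc n) * x + (- real (Suc n) * a) = real (Suc n) * (x - a)"
    "- real (Suc n) * x + real (Suc n) * b = real (Suc n) * (b - x)"
    by (auto simp: algebra_simps)
  have "0 < real (Suc n) * (x - a) \<longleftrightarrow> a < x" "0 < real (Suc n) * (b - x) \<longleftrightarrow> x < b"
    by (auto simp: zero_less_mult_iff simp del: of_nat_Suc)
  moreover have "exp (- (1 / (x - a) + 1 / (b - x)) * inverse (real (Suc n)))
     = exp (- (1 / (real (Suc n) * (x - a)))) * exp (- (1 / (real (Suc n) * (b - x))))"
    by (subst exp_add[symmetric], rule arg_cong[where f=exp])
      (simp add: inverse_eq_divide diff_divide_distrib mult.commute del: of_nat_Suc)
  ultimately show ?thesis
    unfolding interval_bump_def * by (auto simp: flat_power_def simp del: of_nat_Suc)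
qed

lemma interval_bump_test_function: "0 < a \<Longrightarrow> test_function (interval_bump a b n)"
  by (rule test_functionI[of _ a b])
    (auto intro: flat_algebra_differentiable flat_algebra_derivs interval_bump_flat_algebra simp: interval_bump_eq)

lemma interval_bump_bounds: "0 \<le> interval_bump a b n x" "interval_bump a b n x \<le> indicator {a..b} x"
proof -
  have "- (1 / (x - a) + 1 / (b - x)) * inverse (real (Suc n)) \<le> 0" if "a < x" "x < b"
  proof -
    have "0 \<le> 1 / (x - a) + 1 / (b - x)" using that by (intro add_nonneg_nonneg) auto
    then show ?thesis by (intro mult_nonpos_nonneg) (simp_all only: neg_le_0_iff_le inverse_nonnegative_iff_nonnegative of_nat_0_le_iff)
  qed
  then show "interval_bump a b n x \<le> indicator {a..b} x"
    by (simp add: interval_bump_eq del: of_nat_Suc)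
qed (simp add: interval_bump_eq)

lemma interval_bump_tendsto:
  "(\<lambda>n. interval_bump a b n x) \<longlonglongrightarrow> indicator {a<..<b} x"
proof (cases "a < x \<and> x < b")
  case True
  have "(\<lambda>n. exp (- (1 / (x - a) + 1 / (b - x)) * inverse (real (Suc n)))) \<longlonglongrightarrow> exp (- (1 / (x - a) + 1 / (b - x)) * 0)"
    by (intro tendsto_intros LIMSEQ_inverse_real_of_nat)
  then show ?thesis using True by (simp add: interval_bump_eq)
qed (auto simp: interval_bump_eq)

section \<open>Weak derivatives on the half-line\<close>

lemma AE_half_line_iff: "(AE x in lebesgue_on {0::real..}. P x) \<longleftrightarrow> (AE x in lborel. 0 \<le> x \<longrightarrow> P x)"
  by (subst AE_restrict_space_iff) (auto simp: AE_completion_iff)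

lemma integral_half_line:
  fixes f :: "real \<Rightarrow> real"
  assumes [measurable]: "f \<in> borel_measurable borel" and "\<And>x. x < 0 \<Longrightarrow> f x = 0"
  shows "(\<integral>x. f x \<partial>lebesgue_on {0..}) = (\<integral>x. f x \<partial>lborel)"
    "integrable (lebesgue_on {0..}) f \<longleftrightarrow> integrable lborel f"
proof -
  have *: "(\<lambda>x. indicator {0..} x *\<^sub>R f x) = f" using assms(2) by (auto split: split_indicator)
  show "(\<integral>x. f x \<partial>lebesgue_on {0..}) = (\<integral>x. f x \<partial>lborel)"
    by (subst integral_restrict_space) (auto simp: *[unfolded real_scaleR_def] integral_completion)
  show "integrable (lebesgue_on {0..}) f \<longleftrightarrow> integrable lborel f"
    by (subst integrable_restrict_space) (auto simp: *[unfolded real_scaleR_def] integrable_completion)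
qed

lemma half_line_measurable:
  "f \<in> borel_measurable borel \<Longrightarrow> (f :: real \<Rightarrow> real) \<in> borel_measurable (lebesgue_on {0..})"
  by (intro measurable_restrict_space1 measurable_completion) simp

lemma set_integrable_lborel_iff:
  fixes f :: "real \<Rightarrow> real"
  assumes "f \<in> borel_measurable borel" "A \<in> sets borel"
  shows "set_integrable lebesgue A f \<longleftrightarrow> set_integrable lborel A f"
  using assms unfolding set_integrable_def by (intro integrable_completion) auto

lemma eventually_in_interval:
  "0 < x \<Longrightarrow> \<exists>N. \<forall>n\<ge>N. x \<in> {1 / real (Suc n)..real n}"
proof -
  assume "0 < x"
  obtain N1 :: nat where N1: "x \<le> real N1" using real_arch_simple by blast
  obtain N2 where N2: "inverse (real (Suc N2)) < x" using reals_Archimedean[OF \<open>0 < x\<close>] by blast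
  have "x \<in> {1 / real (Suc n)..real n}" if "max N1 N2 \<le> n" for n
  proof -
    have "1 / real (Suc n) \<le> 1 / real (Suc N2)" using that by (intro divide_left_mono) auto
    then show ?thesis using N1 N2 that by (auto simp: inverse_eq_divide)
  qed
  then show ?thesis by blast
qed

text \<open>Local integrability only speaks of compact subsets of the open half-line, so
  measurability is glued together from the intervals [1/(n+1), n]. Putting u' = 0 on the nonpositive
  axis allows integrals over the half-line to be written as integrals over the line.\<close>

lemma borel_representative:
  assumes "locally_integrable u"
  obtains u' where "u' \<in> borel_measurable borel" "\<forall>x\<le>0. u' x = 0"
    "AE x in lebesgue_on {0..}. u x = u' x" "\<forall>a>0. \<forall>b. set_integrable lborel {a..b} u'"
    "u \<in> borel_measurable (lebesgue_on {0..})"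
proof -
  have int: "set_integrable lebesgue {a..b} u" if "0 < a" for a b
  proof -
    have "{a..b} \<subseteq> {0<..}" using that by auto
    then show ?thesis using assms[unfolded locally_integrable_def, rule_format, of "{a..b}"] by simp
  qed
  define v where "v x = indicator {0<..} x * u x" for x
  have v: "v \<in> borel_measurable lebesgue"
  proof (rule borel_measurable_LIMSEQ_real)
    show "(\<lambda>x. indicator {1 / real (Suc n)..real n} x * u x) \<in> borel_measurable lebesgue" for n
      using int[of "1 / real (Suc n)" "real n"] by (auto simp: set_integrable_def)
    fix x :: real
    have "\<forall>\<^sub>F n in sequentially. indicator {1 / real (Suc n)..real n} x * u x = v x"
    proof (cases "0 < x")
      case True
      then obtain N where N: "\<forall>n\<ge>N. x \<in> {1 / real (Suc n)..real n}" using eventually_in_interval by blast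
      show ?thesis
        using eventually_ge_at_top[of N]
      proof eventually_elim
        case (elim n)
        then have "x \<in> {1 / real (Suc n)..real n}" using N by blast
        then show ?case using True by (simp add: v_def del: of_nat_Suc atLeastAtMost_iff)
      qed
    next
      case False
      have "\<not> 1 / real (Suc n) \<le> x" for n
        using False by (smt (verit) divide_pos_pos of_nat_0_less_iff zero_less_Suc)
      then show ?thesis using False by (intro always_eventually) (auto simp: v_def split: split_indicator)
    qed
    then show "(\<lambda>n. indicator {1 / real (Suc n)..real n} x * u x) \<longlonglongrightarrow> v x"
      by (rule tendsto_eventually)
  qed
  then obtain w where w[measurable]: "w \<in> borel_measurable lborel" and vw: "AE x in lborel. v x = w x"
    using completion_ex_borel_measurable_real by blast
  define u' where "u' x = indicator {0<..} x * w x" for x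
  have u'[measurable]: "u' \<in> borel_measurable borel" unfolding u'_def by measurable
  have eq: "AE x in lborel. 0 \<le> x \<longrightarrow> u x = u' x"
    using vw AE_lborel_singleton[of 0] by eventually_elim (auto simp: v_def u'_def)
  show ?thesis
  proof (rule that[of u'])
    show "AE x in lebesgue_on {0..}. u x = u' x" using eq by (simp add: AE_half_line_iff)
    show "\<forall>a>0. \<forall>b. set_integrable lborel {a..b} u'"
    proof (intro allI impI)
      fix a b :: real assume that: "0 < a"
      have "integrable lebesgue (\<lambda>x. indicator {a..b} x *\<^sub>R u' x) \<longleftrightarrow> integrable lebesgue (\<lambda>x. indicator {a..b} x *\<^sub>R u x)"
      proof (rule integrable_cong_AE)
        have "AE x in lborel. indicator {a..b} x *\<^sub>R u' x = indicator {a..b} x *\<^sub>R u x"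
          using eq by eventually_elim (use that in \<open>auto split: split_indicator\<close>)
        then show "AE x in lebesgue. indicator {a..b} x *\<^sub>R u' x = indicator {a..b} x *\<^sub>R u x"
          by (rule AE_completion)
        show "(\<lambda>x. indicator {a..b} x *\<^sub>R u' x) \<in> borel_measurable lebesgue"
          by (rule measurable_completion) simp
      qed (use int[OF that, of b] in \<open>auto simp: set_integrable_def\<close>)
      then show "set_integrable lborel {a..b} u'"
        using int[OF that, of b] set_integrable_lborel_iff[of u' "{a..b}"] by (simp add: set_integrable_def)
    qed
    have "(\<lambda>x. indicator {0..} x *\<^sub>R u x) = (\<lambda>x. v x + indicator {0} x * u 0)"
      by (auto simp: v_def split: split_indicator)
    moreover have "(\<lambda>x. v x + indicator {0} x * u 0) \<in> borel_measurable lebesgue" 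
    by (intro borel_measurable_add v borel_measurable_times borel_measurable_const borel_measurable_indicator) simp
    ultimately show "u \<in> borel_measurable (lebesgue_on {0..})"
      by (subst borel_measurable_restrict_space_iff) auto
  qed (auto simp: u'_def)
qed

lemma weak_integral_eq:
  fixes u u' \<psi> :: "real \<Rightarrow> real"
  assumes u: "u \<in> borel_measurable (lebesgue_on {0..})" and eq: "AE x in lebesgue_on {0..}. u x = u' x"
    and u'[measurable]: "u' \<in> borel_measurable borel" and u'0: "\<And>x. x < 0 \<Longrightarrow> u' x = 0"
    and \<psi>[measurable]: "\<psi> \<in> borel_measurable borel"
  shows "(\<integral>x. u x * \<psi> x \<partial>lebesgue_on {0..}) = (\<integral>x. u' x * \<psi> x \<partial>lborel)"
proof -
  have m: "f \<in> borel_measurable (lebesgue_on {0..})" if "f \<in> borel_measurable borel" for f :: "real \<Rightarrow> real"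
    using that by (rule half_line_measurable)
  have "(\<integral>x. u x * \<psi> x \<partial>lebesgue_on {0..}) = (\<integral>x. u' x * \<psi> x \<partial>lebesgue_on {0..})"
    using u m[OF u'] m[OF \<psi>] eq by (intro integral_cong_AE) (auto elim!: eventually_mono)
  also have "\<dots> = (\<integral>x. u' x * \<psi> x \<partial>lborel)"
    using u'0 by (intro integral_half_line) auto
  finally show ?thesis .
qed

section \<open>The fundamental lemma and the lemma of du Bois-Reymond\<close>

lemma AE_eq_0_of_interval_integrals:
  fixes w :: "real \<Rightarrow> real"
  assumes w[measurable]: "w \<in> borel_measurable borel"
    and int: "\<And>a b. 0 < a \<Longrightarrow> set_integrable lborel {a..b} w"
    and zero: "\<And>a b. 0 < a \<Longrightarrow> (LINT x:{a..b}|lborel. w x) = 0"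
  shows "AE x in lborel. 0 < x \<longrightarrow> w x = 0"
proof -
  have main: "AE x in lborel. x \<in> {a..b} \<longrightarrow> w x \<le> 0"
    if a: "0 < a" and w[measurable]: "w \<in> borel_measurable borel"
      and int: "\<And>a b. 0 < a \<Longrightarrow> set_integrable lborel {a..b} w"
      and zero: "\<And>a b. 0 < a \<Longrightarrow> (LINT x:{a..b}|lborel. w x) = 0" for a b and w :: "real \<Rightarrow> real"
  proof -
    let ?p = "\<lambda>x. ennreal (indicator {a..b} x * max 0 (w x))"
    let ?m = "\<lambda>x. ennreal (indicator {a..b} x * max 0 (- w x))"
    have eq: "(\<integral>\<^sup>+x\<in>{c..d}. ?p x \<partial>lborel) = (\<integral>\<^sup>+x\<in>{c..d}. ?m x \<partial>lborel)
      \<and> (\<integral>\<^sup>+x\<in>{c..d}. ?m x \<partial>lborel) < \<infinity>" for c d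
    proof -
      let ?I = "{max a c..min b d}"
      have i: "set_integrable lborel ?I w" using a by (intro int) auto
      have ip: "set_integrable lborel ?I (\<lambda>x. max 0 (w x))"
        using i unfolding set_integrable_def by (rule Bochner_Integration.integrable_bound) (auto split: split_indicator)
      have im: "set_integrable lborel ?I (\<lambda>x. max 0 (- w x))"
        using i unfolding set_integrable_def by (rule Bochner_Integration.integrable_bound) (auto split: split_indicator)
      have "(LINT x:?I|lborel. max 0 (w x)) - (LINT x:?I|lborel. max 0 (- w x)) = (LINT x:?I|lborel. w x)"
      proof -
        have "(\<lambda>x. max 0 (w x) - max 0 (- w x)) = w" by auto
        then show ?thesis using set_integral_diff(2)[OF ip im] by simp
      qed
      then have e: "(LINT x:?I|lborel. max 0 (w x)) = (LINT x:?I|lborel. max 0 (- w x))"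
        using zero[of "max a c" "min b d"] a by simp
      have "(\<integral>\<^sup>+x\<in>{c..d}. ?p x \<partial>lborel) = (\<integral>\<^sup>+x. ennreal (indicator ?I x *\<^sub>R max 0 (w x)) \<partial>lborel)"
        by (intro nn_integral_cong) (auto split: split_indicator)
      also have "\<dots> = ennreal (LINT x:?I|lborel. max 0 (w x))"
        using ip unfolding set_integrable_def set_lebesgue_integral_def by (intro nn_integral_eq_integral) auto
      finally have 1: "(\<integral>\<^sup>+x\<in>{c..d}. ?p x \<partial>lborel) = ennreal (LINT x:?I|lborel. max 0 (w x))" .
      have "(\<integral>\<^sup>+x\<in>{c..d}. ?m x \<partial>lborel) = (\<integral>\<^sup>+x. ennreal (indicator ?I x *\<^sub>R max 0 (- w x)) \<partial>lborel)"
        by (intro nn_integral_cong) (auto split: split_indicator)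
      also have "\<dots> = ennreal (LINT x:?I|lborel. max 0 (- w x))"
        using im unfolding set_integrable_def set_lebesgue_integral_def by (intro nn_integral_eq_integral) auto
      finally show ?thesis using 1 e by simp
    qed
    \<comment> \<open>As measures, the positive part of w lies below the negative part on intervals,
      hence on all Borel sets. On A the negative part is 0, so the positive part has no mass
      there.\<close>
    define A where "A = {x \<in> {a..b}. 0 < w x}"
    have A[measurable]: "A \<in> sets borel" unfolding A_def by measurable
    have "emeasure (density lborel ?p) A \<le> (\<integral>\<^sup>+x\<in>A. ?m x \<partial>lborel)"
      by (rule emeasure_le_density_of_intervals[OF _ _ _ _ A]) (use eq in \<open>auto simp: emeasure_density\<close>)
    also have "\<dots> = (\<integral>\<^sup>+x. 0 \<partial>(lborel :: real measure))"
      by (intro nn_integral_cong) (auto simp: A_def split: split_indicator)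
    finally have "(\<integral>\<^sup>+x. ?p x * indicator A x \<partial>lborel) = 0"
      using A by (simp add: emeasure_density)
    then have "AE x in lborel. ?p x * indicator A x = 0"
      by (subst (asm) nn_integral_0_iff_AE) auto
    then show ?thesis
      by eventually_elim (auto simp: A_def split: split_indicator_asm)
  qed
  have le: "AE x in lborel. x \<in> {1 / real (Suc n)..real n} \<longrightarrow> w x \<le> 0" for n
    using w int zero by (intro main) auto
  have ge: "AE x in lborel. x \<in> {1 / real (Suc n)..real n} \<longrightarrow> - w x \<le> 0" for n
    using w int zero by (intro main) (auto simp: set_integrable_def set_lebesgue_integral_def)
  have "AE x in lborel. x \<in> {1 / real (Suc n)..real n} \<longrightarrow> w x = 0" for n
    using le[of n] ge[of n] by eventually_elim auto
  then have "AE x in lborel. \<forall>n. x \<in> {1 / real (Suc n)..real n} \<longrightarrow> w x = 0"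
    unfolding AE_all_countable by blast
  then show ?thesis
  proof eventually_elim
    case (elim x)
    show ?case
    proof
      assume "0 < x"
      then show "w x = 0" using elim eventually_in_interval by blast
    qed
  qed
qed

lemma integrable_mult_compact_support:
  fixes w \<psi> :: "real \<Rightarrow> real"
  assumes w[measurable]: "w \<in> borel_measurable borel" and int: "set_integrable lborel {a..b} w"
    and \<psi>: "continuous_on UNIV \<psi>" and supp: "\<And>x. x \<notin> {a..b} \<Longrightarrow> \<psi> x = 0"
  shows "integrable lborel (\<lambda>x. w x * \<psi> x)"
proof -
  have [measurable]: "\<psi> \<in> borel_measurable borel" using \<psi> by (rule borel_measurable_continuous_onI)
  have "bounded (\<psi> ` {a..b})"
    by (intro compact_imp_bounded compact_continuous_image continuous_on_subset[OF \<psi>]) auto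
  then obtain B where "\<forall>z\<in>\<psi> ` {a..b}. norm z \<le> B" unfolding bounded_iff ..
  then have B: "\<bar>\<psi> x\<bar> \<le> B" if "x \<in> {a..b}" for x using that by simp
  have "integrable lborel (\<lambda>x. B * (indicator {a..b} x *\<^sub>R w x))"
    using int unfolding set_integrable_def by (rule integrable_mult_right)
  then show ?thesis
  proof (rule Bochner_Integration.integrable_bound)
    have "norm (w x * \<psi> x) \<le> norm (B * (indicator {a..b} x *\<^sub>R w x))" for x
    proof (cases "x \<in> {a..b}")
      case True
      then have "\<bar>\<psi> x\<bar> \<le> \<bar>B\<bar>" using B[OF True] by linarith
      then show ?thesis using True by (simp add: abs_mult mult.commute mult_right_mono)
    qed (simp add: supp)
    then show "AE x in lborel. norm (w x * \<psi> x) \<le> norm (B * (indicator {a..b} x *\<^sub>R w x))" by simp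
  qed simp
qed

lemma set_integrable_one: "set_integrable lborel {a..b::real} (\<lambda>_. 1::real)"
  by (intro borel_integrable_atLeastAtMost' continuous_on_const)

text \<open>The bumps alone suffice: they converge to the indicator of an interval and stay below
  it. The assumption is confined to \<open>flat_algebra\<close> because in the lemma of du
  Bois-Reymond these are the functions whose antiderivatives are known to be smooth.\<close>

lemma fundamental_lemma:
  fixes w :: "real \<Rightarrow> real"
  assumes w[measurable]: "w \<in> borel_measurable borel"
    and int: "\<And>a b. 0 < a \<Longrightarrow> set_integrable lborel {a..b} w"
    and zero: "\<And>\<psi>. flat_algebra \<psi> \<Longrightarrow> test_function \<psi> \<Longrightarrow> (\<integral>x. w x * \<psi> x \<partial>lborel) = 0"
  shows "AE x in lborel. 0 < x \<longrightarrow> w x = 0"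
proof (rule AE_eq_0_of_interval_integrals[OF w int])
  fix a b :: real assume "0 < a"
  have [measurable]: "interval_bump a b n \<in> borel_measurable borel" for n
    by (intro borel_measurable_continuous_onI flat_algebra_continuous interval_bump_flat_algebra)
  have "(\<lambda>n. \<integral>x. w x * interval_bump a b n x \<partial>lborel) \<longlonglongrightarrow> (\<integral>x. w x * indicator {a<..<b} x \<partial>lborel)"
  proof (rule integral_dominated_convergence)
    show "integrable lborel (\<lambda>x. norm (indicator {a..b} x *\<^sub>R w x))"
      using int[OF \<open>0 < a\<close>, of b] unfolding set_integrable_def by (rule integrable_norm)
    show "AE x in lborel. (\<lambda>n. w x * interval_bump a b n x) \<longlonglongrightarrow> w x * indicator {a<..<b} x"
      by (intro AE_I2 tendsto_intros interval_bump_tendsto)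
    show "AE x in lborel. norm (w x * interval_bump a b n x) \<le> norm (indicator {a..b} x *\<^sub>R w x)" for n
    proof (rule AE_I2)
      fix x
      show "norm (w x * interval_bump a b n x) \<le> norm (indicator {a..b} x *\<^sub>R w x)"
        using interval_bump_bounds[of a b n x] by (simp add: abs_mult mult.commute mult_left_mono)
    qed
  qed auto
  moreover have "(\<integral>x. w x * interval_bump a b n x \<partial>lborel) = 0" for n
    using \<open>0 < a\<close> by (intro zero interval_bump_flat_algebra interval_bump_test_function)
  ultimately have "(\<integral>x. w x * indicator {a<..<b} x \<partial>lborel) = 0"
    by (simp add: LIMSEQ_const_iff)
  moreover have "(LINT x:{a..b}|lborel. w x) = (\<integral>x. w x * indicator {a<..<b} x \<partial>lborel)"
    unfolding set_lebesgue_integral_def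
    using AE_lborel_singleton[of a] AE_lborel_singleton[of b]
    by (intro integral_cong_AE) (auto elim!: eventually_elim2 split: split_indicator)
  ultimately show "(LINT x:{a..b}|lborel. w x) = 0" by simp
qed

text \<open>The primitive from 0 vanishes below a, and beyond b it equals the whole integral, which
  is zero; so its support is compact. Its iterated derivatives are those of \<open>\<xi>\<close>
  shifted by one order.\<close>

lemma flat_algebra_antiderivative:
  assumes \<xi>: "flat_algebra \<xi>" and supp: "\<And>x. x \<notin> {a..b} \<Longrightarrow> \<xi> x = 0" and "0 < a"
    and zero: "(\<integral>x. \<xi> x \<partial>lborel) = 0"
  obtains f where "test_function f" "deriv f = \<xi>"
proof -
  define f where "f x = integral {0..x} \<xi>" for x
  have cont: "continuous_on S \<xi>" for S using \<xi> by (rule flat_algebra_continuous)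
  have int: "\<xi> integrable_on {c..d}" for c d by (rule integrable_continuous_real[OF cont])
  have f0: "f x = 0" if "x < a" for x
  proof -
    have "integral {0..x} \<xi> = integral {0..x} (\<lambda>_. 0)"
      using that by (intro integral_cong) (auto intro: supp)
    then show ?thesis by (simp add: f_def)
  qed
  have fb: "f x = 0" if "b < x" for x
  proof -
    have "integrable lborel (\<lambda>x. 1 * \<xi> x)"
      by (rule integrable_mult_compact_support[OF _ set_integrable_one cont supp]) auto
    then have "(\<xi> has_integral (\<integral>x. \<xi> x \<partial>lborel)) UNIV"
      by (intro has_integral_integral_lborel) simp
    moreover have "(\<xi> has_integral f x) {0..x}"
      unfolding f_def by (rule integrable_integral[OF int])
    then have "(\<xi> has_integral f x) UNIV"
      by (rule has_integral_on_superset) (use that \<open>0 < a\<close> in \<open>auto intro: supp\<close>)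
    ultimately show ?thesis using zero by (metis has_integral_unique)
  qed
  have D: "(f has_real_derivative \<xi> x) (at x)" for x
  proof (cases "x < a")
    case True
    have "((\<lambda>_. 0) has_real_derivative \<xi> x) (at x)" using True supp by simp
    then show ?thesis
      by (rule has_field_derivative_transform_within_open[where S="{..<a}"]) (use True f0 in auto)
  next
    case False
    then have "0 < x" using \<open>0 < a\<close> by linarith
    have "(f has_real_derivative \<xi> x) (at x within {0..x + 1})"
      unfolding f_def has_real_derivative_iff_has_vector_derivative
      using \<open>0 < x\<close> by (intro integral_has_vector_derivative cont) auto
    then show ?thesis
      using at_within_Icc_at[of 0 x "x + 1"] \<open>0 < x\<close> by simp
  qed
  then have df: "deriv f = \<xi>" by (auto intro: DERIV_imp_deriv)
  show ?thesis
  proof (rule that[OF _ df], rule test_functionI[OF _ \<open>0 < a\<close>])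
    show "(deriv ^^ n) f differentiable (at x)" for n x
    proof (cases n)
      case 0
      then show ?thesis using D by (auto simp: real_differentiable_def)
    next
      case (Suc m)
      then have "(deriv ^^ n) f = (deriv ^^ m) \<xi>" by (simp add: funpow_swap1 df del: funpow.simps) (simp add: funpow_swap1 df)
      then show ?thesis using \<xi> by (simp add: flat_algebra_differentiable flat_algebra_derivs)
    qed
    show "f x = 0" if "x \<notin> {a..b}" for x using that f0 fb by force
  qed
qed

text \<open>A member of \<open>flat_algebra\<close> with support in some [a, b], 0 < a, and integral
  zero is the derivative of a test function. Subtracting from \<psi> the multiple of a fixed bump
  with the same integral leads to this case, and the constant C is what the subtracted multiple
  contributes.\<close>

lemma du_Bois_Reymond:
  fixes w :: "real \<Rightarrow> real"
  assumes w[measurable]: "w \<in> borel_measurable borel"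
    and int: "\<And>a b. 0 < a \<Longrightarrow> set_integrable lborel {a..b} w"
    and zero: "\<And>\<psi>. test_function \<psi> \<Longrightarrow> (\<integral>x. w x * deriv \<psi> x \<partial>lborel) = 0"
  obtains C where "AE x in lborel. 0 < x \<longrightarrow> w x = C"
proof -
  define \<psi>\<^sub>0 where "\<psi>\<^sub>0 = interval_bump 1 2 0"
  have \<psi>0: "flat_algebra \<psi>\<^sub>0" "\<And>x. x \<notin> {1..2} \<Longrightarrow> \<psi>\<^sub>0 x = 0" "\<And>x. 0 \<le> \<psi>\<^sub>0 x"
    using interval_bump_bounds(1)[of 1 2 0]
    by (auto simp: \<psi>\<^sub>0_def interval_bump_flat_algebra interval_bump_eq)
  have cont0: "continuous_on UNIV \<psi>\<^sub>0" by (rule flat_algebra_continuous[OF \<psi>0(1)])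
  define I where "I = (\<integral>x. \<psi>\<^sub>0 x \<partial>lborel)"
  have i0: "integrable lborel \<psi>\<^sub>0"
    using integrable_mult_compact_support[OF _ set_integrable_one cont0 \<psi>0(2)] by simp
  have "I \<noteq> 0"
  proof
    assume "I = 0"
    then have "AE x in lborel. \<psi>\<^sub>0 x = 0"
      using i0 \<psi>0(3) by (simp add: I_def integral_nonneg_eq_0_iff_AE)
    then have "AE x in lborel. x \<notin> {1<..<2::real}"
      by eventually_elim (auto simp: \<psi>\<^sub>0_def interval_bump_eq split: if_splits)
    then have "{1<..<2::real} \<in> null_sets lborel" by (subst (asm) AE_iff_null_sets[symmetric]) auto
    then show False by (auto dest: null_setsD1)
  qed
  define C where "C = (\<integral>x. w x * \<psi>\<^sub>0 x \<partial>lborel) / I"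
  have "AE x in lborel. 0 < x \<longrightarrow> w x - C = 0"
  proof (rule fundamental_lemma)
    show "set_integrable lborel {a..b} (\<lambda>x. w x - C)" if "0 < a" for a b
      by (rule set_integral_diff(1)[OF int[OF that] borel_integrable_atLeastAtMost'[OF continuous_on_const]])
    fix \<psi> assume \<psi>: "flat_algebra \<psi>" "test_function \<psi>"
    obtain a b where ab: "0 < a" "\<And>x. x \<notin> {a..b} \<Longrightarrow> \<psi> x = 0"
      using test_function_support[OF \<psi>(2)] by metis
    have cont: "continuous_on UNIV \<psi>" by (rule flat_algebra_continuous[OF \<psi>(1)])
    have i: "integrable lborel \<psi>"
      using integrable_mult_compact_support[OF _ set_integrable_one cont ab(2)] by simp
    define J where "J = (\<integral>x. \<psi> x \<partial>lborel)"
    define \<xi> where "\<xi> x = \<psi> x + (- J / I) * \<psi>\<^sub>0 x" for x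
    have \<xi>: "flat_algebra \<xi>" unfolding \<xi>_def by (intro flat_algebra.intros \<psi> \<psi>0)
    have "(\<integral>x. \<xi> x \<partial>lborel) = J + (- J / I) * I"
      using i i0 by (simp add: \<xi>_def J_def I_def)
    then have "(\<integral>x. \<xi> x \<partial>lborel) = 0" using \<open>I \<noteq> 0\<close> by simp
    moreover have "\<xi> x = 0" if "x \<notin> {min a 1..max b 2}" for x
    proof -
      have "x \<notin> {a..b}" "x \<notin> {1..2}" using that by auto
      then show ?thesis using ab(2)[of x] \<psi>0(2)[of x] by (simp add: \<xi>_def)
    qed
    ultimately obtain f where f: "test_function f" "deriv f = \<xi>"
      using flat_algebra_antiderivative[OF \<xi>, of "min a 1" "max b 2"] ab(1) by auto
    have iw: "integrable lborel (\<lambda>x. w x * \<psi> x)"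
      by (rule integrable_mult_compact_support[OF w int[OF ab(1)] cont ab(2)])
    have iw0: "integrable lborel (\<lambda>x. w x * \<psi>\<^sub>0 x)"
      by (rule integrable_mult_compact_support[OF w int cont0 \<psi>0(2)]) auto
    have "0 = (\<integral>x. w x * \<psi> x + (- J / I) * (w x * \<psi>\<^sub>0 x) \<partial>lborel)"
      using zero[OF f(1)] by (simp add: f(2) \<xi>_def algebra_simps)
    also have "\<dots> = (\<integral>x. w x * \<psi> x \<partial>lborel) - C * J"
      using iw iw0 by (simp add: C_def)
    also have "\<dots> = (\<integral>x. (w x - C) * \<psi> x \<partial>lborel)"
      using iw i by (simp add: left_diff_distrib J_def)
    finally show "(\<integral>x. (w x - C) * \<psi> x \<partial>lborel) = 0" by simp
  qed simp
  then show ?thesis by (intro that[of C]) (auto elim!: eventually_mono)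
qed

lemma test_function_derivative:
  assumes "test_function \<psi>"
  shows "(\<psi> has_real_derivative deriv \<psi> x) (at x)" "continuous_on S \<psi>" "continuous_on S (deriv \<psi>)"
proof -
  have d: "(deriv ^^ n) \<psi> differentiable (at x)" for n x using assms by (auto simp: test_function_def)
  show "(\<psi> has_real_derivative deriv \<psi> x) (at x)" for x
    using d[of 0 x] by (simp add: DERIV_deriv_iff_real_differentiable)
  show "continuous_on S \<psi>"
    using d[of 0] by (auto intro: continuous_at_imp_continuous_on differentiable_imp_continuous_within)
  show "continuous_on S (deriv \<psi>)"
    using d[of 1] by (auto intro: continuous_at_imp_continuous_on differentiable_imp_continuous_within)
qed

lemma test_function_measurable:
  assumes "test_function \<psi>"
  shows "deriv \<psi> \<in> borel_measurable borel" "\<psi> \<in> borel_measurable borel"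
  using test_function_derivative[OF assms] by (auto intro: borel_measurable_continuous_onI)

lemma deriv_eq_0_outside:
  assumes "\<And>x. x \<notin> {a..b} \<Longrightarrow> \<psi> x = (0::real)" "x \<notin> {a..b}"
  shows "deriv \<psi> x = 0"
proof -
  have "((\<lambda>_. 0) has_real_derivative 0) (at x)" by simp
  then have "(\<psi> has_real_derivative 0) (at x)"
    by (rule has_field_derivative_transform_within_open[where S="- {a..b}"]) (use assms in auto)
  then show ?thesis by (rule DERIV_imp_deriv)
qed

section \<open>Primitives and the continuous representative\<close>

lemma primitive_continuous:
  fixes v h :: "real \<Rightarrow> real"
  assumes int: "\<And>x y. set_integrable lborel {x..y} h"
    and v: "\<And>x y. 0 \<le> x \<Longrightarrow> x \<le> y \<Longrightarrow> v y - v x = (LINT t:{x..y}|lborel. h t)"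
  shows "continuous_on {0..} v"
proof -
  have "continuous_on {0..b} v" for b
  proof (rule continuous_on_eq)
    have hi: "h integrable_on {0..b}" for b
      using set_borel_integral_eq_integral(1)[OF int[of 0 b]] .
    show "continuous_on {0..b} (\<lambda>x. v 0 + integral {0..x} h)"
      by (intro continuous_intros indefinite_integral_continuous_1 hi)
    show "v 0 + integral {0..x} h = v x" if "x \<in> {0..b}" for x
      using v[of 0 x] set_borel_integral_eq_integral(2)[OF int[of 0 x]] that by simp
  qed
  then have "continuous (at x within {0..x + 1}) v" if "0 \<le> x" for x
    using that by (simp add: continuous_on_eq_continuous_within)
  moreover have "at x within {0..x + 1} = at x within {0..}" for x :: real
    by (rule at_within_nhd[of x "{..<x + 1}"]) auto
  ultimately show ?thesis by (auto simp: continuous_on_eq_continuous_within)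
qed

text \<open>Integration by parts through Fubini: v y - v 0 is the integral of h over [0, y], and
  integrating \<open>deriv \<psi>\<close> over [t, b] first leaves - \<psi> t. The constant v 0
  drops out because \<open>deriv \<psi>\<close> has integral zero.\<close>

lemma primitive_test_integral:
  fixes v h \<psi> :: "real \<Rightarrow> real"
  assumes h[measurable]: "h \<in> borel_measurable borel" and int: "\<And>x y. set_integrable lborel {x..y} h"
    and v: "\<And>x y. 0 \<le> x \<Longrightarrow> x \<le> y \<Longrightarrow> v y - v x = (LINT t:{x..y}|lborel. h t)"
    and h0: "\<And>x. x < 0 \<Longrightarrow> h x = 0" and \<psi>: "test_function \<psi>"
  shows "(\<integral>x. indicator {0..} x * v x * deriv \<psi> x \<partial>lborel) = - (\<integral>x. h x * \<psi> x \<partial>lborel)"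
proof -
  obtain a b where ab: "0 < a" "a < b" and supp: "\<And>x. x \<notin> {a..b} \<Longrightarrow> \<psi> x = 0"
    using test_function_support[OF \<psi>] by metis
  note D = test_function_derivative[OF \<psi>]
  have supp': "deriv \<psi> x = 0" if "x \<notin> {a..b}" for x using deriv_eq_0_outside[OF supp that] .
  note [measurable] = test_function_measurable[OF \<psi>]
  have i': "integrable lborel (deriv \<psi>)"
    using integrable_mult_compact_support[OF _ set_integrable_one D(3) supp'] by simp
  have ftc: "(\<integral>y. deriv \<psi> y * indicator {t..b} y \<partial>lborel) = \<psi> b - \<psi> t" if "t \<le> b" for t
    using that D(1) D(3)[of UNIV] by (intro integral_FTC_Icc_real) (auto simp: continuous_on_eq_continuous_at)
  \<comment> \<open>The support condition only speaks of points outside [a, b]; the endpoint itself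
    is reached by continuity.\<close>
  have \<psi>b: "\<psi> b = 0"
  proof -
    have "isCont \<psi> b"
      using D(2)[of UNIV] by (simp add: continuous_on_eq_continuous_at)
    then have "(\<psi> \<longlongrightarrow> \<psi> b) (at_right b)"
      by (simp add: isCont_def filterlim_at_split)
    moreover have "(\<psi> \<longlongrightarrow> 0) (at_right b)"
      by (rule tendsto_eventually) (auto simp: eventually_at_filter supp)
    ultimately show ?thesis by (rule tendsto_unique[rotated]) simp
  qed
  define H where "H t y = (if 0 \<le> t \<and> t \<le> y \<and> y \<le> b then h t * deriv \<psi> y else 0)" for t y
  have Hm[measurable]: "case_prod H \<in> borel_measurable (lborel \<Otimes>\<^sub>M lborel)"
    unfolding H_def by measurable
  have Ht: "H t y = indicator {0..b} t * h t * (deriv \<psi> y * indicator {t..b} y)" for t y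
    by (auto simp: H_def split: split_indicator)
  have "integrable (lborel \<Otimes>\<^sub>M lborel) (case_prod H)"
  proof (rule lborel_pair.Fubini_integrable[OF Hm])
    show "integrable lborel (\<lambda>t. \<integral>y. norm (case_prod H (t, y)) \<partial>lborel)"
    proof (rule Bochner_Integration.integrable_bound)
      show "integrable lborel (\<lambda>t. (indicator {0..b} t *\<^sub>R h t) * (\<integral>y. \<bar>deriv \<psi> y\<bar> \<partial>lborel))"
        using int[of 0 b] unfolding set_integrable_def by (rule integrable_mult_left)
      show "AE t in lborel. norm (\<integral>y. norm (case_prod H (t, y)) \<partial>lborel)
          \<le> norm ((indicator {0..b} t *\<^sub>R h t) * (\<integral>y. \<bar>deriv \<psi> y\<bar> \<partial>lborel))"
      proof (rule AE_I2)
        fix t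
        have "(\<integral>y. norm (case_prod H (t, y)) \<partial>lborel)
          = \<bar>indicator {0..b} t * h t\<bar> * (\<integral>y. \<bar>deriv \<psi> y * indicator {t..b} y\<bar> \<partial>lborel)"
          by (simp add: Ht abs_mult)
        moreover have "(\<integral>y. \<bar>deriv \<psi> y * indicator {t..b} y\<bar> \<partial>lborel) \<le> (\<integral>y. \<bar>deriv \<psi> y\<bar> \<partial>lborel)"
        proof (rule integral_mono)
          show "integrable lborel (\<lambda>y. \<bar>deriv \<psi> y\<bar>)" using i' by simp
          then show "integrable lborel (\<lambda>y. \<bar>deriv \<psi> y * indicator {t..b} y\<bar>)"
            by (rule Bochner_Integration.integrable_bound) (auto split: split_indicator)
        qed (auto split: split_indicator)
        moreover have "0 \<le> (\<integral>y. \<bar>deriv \<psi> y * indicator {t..b} y\<bar> \<partial>lborel)" by simp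
        ultimately show "norm (\<integral>y. norm (case_prod H (t, y)) \<partial>lborel)
          \<le> norm ((indicator {0..b} t *\<^sub>R h t) * (\<integral>y. \<bar>deriv \<psi> y\<bar> \<partial>lborel))"
          by (simp add: abs_mult mult_left_mono)
      qed
    qed measurable
    show "AE t in lborel. integrable lborel (\<lambda>y. case_prod H (t, y))"
      using i' by (auto simp: Ht intro!: integrable_mult_right integrable_mult_indicator[of _ _ "deriv \<psi>", simplified, unfolded mult.commute[of "indicator _ _"]])
  qed
  then have swap: "(\<integral>y. (\<integral>t. H t y \<partial>lborel) \<partial>lborel) = (\<integral>t. (\<integral>y. H t y \<partial>lborel) \<partial>lborel)"
    by (rule lborel_pair.Fubini_integral)
  have 1: "(\<integral>y. H t y \<partial>lborel) = - (h t * \<psi> t)" for t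
  proof (cases "t \<in> {0..b}")
    case True
    then show ?thesis using ftc[of t] by (simp add: Ht \<psi>b)
  next
    case False
    then show ?thesis using ab supp[of t] h0[of t] by (auto simp: Ht)
  qed
  have 2: "(\<integral>t. H t y \<partial>lborel) = indicator {0..} y * v y * deriv \<psi> y - v 0 * deriv \<psi> y" for y
  proof (cases "y \<in> {a..b}")
    case True
    then have "(\<integral>t. H t y \<partial>lborel) = (\<integral>t. (indicator {0..y} t *\<^sub>R h t) * deriv \<psi> y \<partial>lborel)"
      by (intro Bochner_Integration.integral_cong) (auto simp: H_def split: split_indicator)
    also have "\<dots> = (LINT t:{0..y}|lborel. h t) * deriv \<psi> y"
      by (simp add: set_lebesgue_integral_def)
    also have "\<dots> = (v y - v 0) * deriv \<psi> y"
      using True ab by (subst v[symmetric]) auto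
    finally show ?thesis using True ab by (simp add: left_diff_distrib)
  next
    case False
    have "(\<lambda>t. H t y) = (\<lambda>_. 0)" by (auto simp: H_def supp'[OF False])
    then show ?thesis using supp'[OF False] by simp
  qed
  have "integrable lborel (\<lambda>x. indicator {0..} x * v x * deriv \<psi> x)"
  proof (rule integrable_mult_compact_support[OF _ _ D(3) supp'])
    have c: "continuous_on {0..} v" by (rule primitive_continuous[OF int v])
    have "(\<lambda>x. indicator {0..} x *\<^sub>R v x) \<in> borel_measurable borel"
      by (rule borel_measurable_continuous_on_indicator[OF _ c]) simp
    then show "(\<lambda>x. indicator {0..} x * v x) \<in> borel_measurable borel" by simp
    have "set_integrable lborel {a..b} v"
      by (intro borel_integrable_atLeastAtMost' continuous_on_subset[OF c]) (use ab in auto)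
    moreover have "(\<lambda>x. indicator {a..b} x *\<^sub>R (indicator {0..} x * v x)) = (\<lambda>x. indicator {a..b} x *\<^sub>R v x)"
      using ab by (auto split: split_indicator)
    ultimately show "set_integrable lborel {a..b} (\<lambda>x. indicator {0..} x * v x)"
      by (simp add: set_integrable_def)
  qed
  then have "(\<integral>y. (\<integral>t. H t y \<partial>lborel) \<partial>lborel)
      = (\<integral>x. indicator {0..} x * v x * deriv \<psi> x \<partial>lborel) - v 0 * (\<integral>x. deriv \<psi> x \<partial>lborel)"
    unfolding 2 using i' by simp
  moreover have "(\<integral>x. deriv \<psi> x \<partial>lborel) = 0"
  proof -
    have "(\<integral>x. deriv \<psi> x \<partial>lborel) = (\<integral>y. deriv \<psi> y * indicator {0..b} y \<partial>lborel)"
      using ab supp' by (intro Bochner_Integration.integral_cong) (auto split: split_indicator)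
    then show ?thesis using ftc[of 0] ab supp[of 0] by (simp add: \<psi>b)
  qed
  ultimately show ?thesis using swap 1 by simp
qed

theorem primitive_has_weak_derivative:
  fixes v h :: "real \<Rightarrow> real"
  assumes h[measurable]: "h \<in> borel_measurable borel" and int: "\<And>x y. set_integrable lborel {x..y} h"
    and v: "\<And>x y. 0 \<le> x \<Longrightarrow> x \<le> y \<Longrightarrow> v y - v x = (LINT t:{x..y}|lborel. h t)"
    and h0: "\<And>x. x < 0 \<Longrightarrow> h x = 0"
  shows "has_weak_derivative v h"
proof -
  have c: "continuous_on {0..} v" by (rule primitive_continuous[OF int v])
  have V: "(\<lambda>x. indicator {0..} x * v x) \<in> borel_measurable borel"
    using borel_measurable_continuous_on_indicator[OF _ c] by simp
  have vm: "v \<in> borel_measurable (lebesgue_on {0..})"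
    using measurable_completion[of "\<lambda>x. indicator {0..} x * v x" lborel borel] V
    by (subst borel_measurable_restrict_space_iff) auto
  have hm: "h \<in> borel_measurable (lebesgue_on {0..})"
    by (rule half_line_measurable) simp
  have "v absolutely_integrable_on K \<and> h absolutely_integrable_on K" if K: "compact K" "K \<subseteq> {0<..}" for K
  proof -
    obtain r where r: "\<And>x. x \<in> K \<Longrightarrow> \<bar>x\<bar> \<le> r"
      using compact_imp_bounded[OF K(1)] by (auto simp: bounded_iff)
    then have sub: "K \<subseteq> {0..r}" using K(2) by force
    have Kl: "K \<in> sets lebesgue" using K(1) by (simp add: borel_compact)
    have "v absolutely_integrable_on {0..r}"
      by (intro absolutely_integrable_continuous_real continuous_on_subset[OF c]) auto
    moreover have "h absolutely_integrable_on {0..r}"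
      using set_integrable_lborel_iff[of h "{0..r}"] int by simp
    ultimately show ?thesis using set_integrable_subset[OF _ Kl sub] by blast
  qed
  moreover have "(\<integral>x. v x * deriv \<psi> x \<partial>lebesgue_on {0..}) = - (\<integral>x. h x * \<psi> x \<partial>lebesgue_on {0..})"
    if \<psi>: "test_function \<psi>" for \<psi>
  proof -
    note D = test_function_derivative[OF \<psi>]
    note [measurable] = test_function_measurable[OF \<psi>]
    have "(\<integral>x. v x * deriv \<psi> x \<partial>lebesgue_on {0..}) = (\<integral>x. indicator {0..} x * v x * deriv \<psi> x \<partial>lborel)"
      by (rule weak_integral_eq[OF vm _ V]) (auto simp: AE_half_line_iff)
    also have "\<dots> = - (\<integral>x. h x * \<psi> x \<partial>lborel)"
      by (rule primitive_test_integral[OF h int v h0 \<psi>])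
    also have "(\<integral>x. h x * \<psi> x \<partial>lborel) = (\<integral>x. h x * \<psi> x \<partial>lebesgue_on {0..})"
      by (rule weak_integral_eq[OF hm _ h h0, symmetric]) auto
    finally show ?thesis .
  qed
  ultimately show ?thesis by (simp add: has_weak_derivative_def locally_integrable_def)
qed

lemma AE_half_line_iff_pos: "(AE x in lebesgue_on {0::real..}. P x) \<longleftrightarrow> (AE x in lborel. 0 < x \<longrightarrow> P x)"
proof -
  have "(AE x in lborel. 0 \<le> x \<longrightarrow> P x) \<longleftrightarrow> (AE x in lborel. 0 < x \<longrightarrow> P x)"
  proof
    assume "AE x in lborel. 0 \<le> x \<longrightarrow> P x"
    then show "AE x in lborel. 0 < x \<longrightarrow> P x" by eventually_elim auto
  next
    assume "AE x in lborel. 0 < x \<longrightarrow> P x"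
    then show "AE x in lborel. 0 \<le> x \<longrightarrow> P x"
      using AE_lborel_singleton[of "0::real"] by eventually_elim auto
  qed
  then show ?thesis by (simp only: AE_half_line_iff)
qed

text \<open>\<open>in_W1p\<close> and the main statement each bring a weak derivative of their own,
  and these have to be identified. The same fact settles the easy direction of the equality
  case.\<close>

theorem has_weak_derivative_unique:
  assumes "has_weak_derivative u1 g1" "has_weak_derivative u2 g2"
    and eq: "AE x in lebesgue_on {0..}. u1 x = u2 x"
  shows "AE x in lebesgue_on {0..}. g1 x = g2 x"
proof -
  have li: "locally_integrable g1" "locally_integrable g2" "locally_integrable u1" "locally_integrable u2"
    using assms by (auto simp: has_weak_derivative_def)
  obtain h1 where h1: "h1 \<in> borel_measurable borel" "\<forall>x\<le>0. h1 x = 0"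
    "AE x in lebesgue_on {0..}. g1 x = h1 x" "\<forall>a>0. \<forall>b. set_integrable lborel {a..b} h1"
    "g1 \<in> borel_measurable (lebesgue_on {0..})" by (rule borel_representative[OF li(1)])
  note h1 = h1[rule_format]
  obtain h2 where h2: "h2 \<in> borel_measurable borel" "\<forall>x\<le>0. h2 x = 0"
    "AE x in lebesgue_on {0..}. g2 x = h2 x" "\<forall>a>0. \<forall>b. set_integrable lborel {a..b} h2"
    "g2 \<in> borel_measurable (lebesgue_on {0..})" by (rule borel_representative[OF li(2)])
  note h2 = h2[rule_format]
  obtain v1 where v1: "u1 \<in> borel_measurable (lebesgue_on {0..})" by (rule borel_representative[OF li(3)])
  obtain v2 where v2: "u2 \<in> borel_measurable (lebesgue_on {0..})" by (rule borel_representative[OF li(4)])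
  have "AE x in lborel. 0 < x \<longrightarrow> h1 x - h2 x = 0"
  proof (rule fundamental_lemma)
    show "(\<lambda>x. h1 x - h2 x) \<in> borel_measurable borel" using h1(1) h2(1) by measurable
    show "set_integrable lborel {a..b} (\<lambda>x. h1 x - h2 x)" if "0 < a" for a b
      using h1(4)[OF that] h2(4)[OF that] by (rule set_integral_diff(1))
    fix \<psi> assume \<psi>: "flat_algebra \<psi>" "test_function \<psi>"
    note D = test_function_derivative[OF \<psi>(2)]
    note m = test_function_measurable[OF \<psi>(2)]
    have m': "deriv \<psi> \<in> borel_measurable (lebesgue_on {0..})"
      by (rule half_line_measurable) (rule m)
    obtain a b where ab: "0 < a" "\<And>x. x \<notin> {a..b} \<Longrightarrow> \<psi> x = 0"
      using test_function_support[OF \<psi>(2)] by metis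
    have "(\<integral>x. h1 x * \<psi> x \<partial>lborel) = (\<integral>x. g1 x * \<psi> x \<partial>lebesgue_on {0..})"
      by (rule weak_integral_eq[OF h1(5,3,1) _ m(2), symmetric]) (simp add: h1(2))
    also have "\<dots> = - (\<integral>x. u1 x * deriv \<psi> x \<partial>lebesgue_on {0..})"
      using assms(1) \<psi>(2) by (simp add: has_weak_derivative_def)
    also have "(\<integral>x. u1 x * deriv \<psi> x \<partial>lebesgue_on {0..}) = (\<integral>x. u2 x * deriv \<psi> x \<partial>lebesgue_on {0..})"
      using v1 v2 m' eq by (intro integral_cong_AE) (auto elim!: eventually_mono)
    also have "- \<dots> = (\<integral>x. g2 x * \<psi> x \<partial>lebesgue_on {0..})"
      using assms(2) \<psi>(2) by (simp add: has_weak_derivative_def)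
    also have "\<dots> = (\<integral>x. h2 x * \<psi> x \<partial>lborel)"
      by (rule weak_integral_eq[OF h2(5,3,1) _ m(2)]) (simp add: h2(2))
    finally show "(\<integral>x. (h1 x - h2 x) * \<psi> x \<partial>lborel) = 0"
      using integrable_mult_compact_support[OF h1(1) h1(4)[OF ab(1)] D(2) ab(2)]
        integrable_mult_compact_support[OF h2(1) h2(4)[OF ab(1)] D(2) ab(2)]
      by (simp add: left_diff_distrib)
  qed
  then have "AE x in lebesgue_on {0..}. h1 x - h2 x = 0" by (simp only: AE_half_line_iff_pos)
  then show ?thesis using h1(3) h2(3) by eventually_elim simp
qed

lemma abs_le_1_add_powr: "1 \<le> p \<Longrightarrow> \<bar>x\<bar> \<le> 1 + \<bar>x::real\<bar> powr p"
proof (cases "\<bar>x\<bar> \<le> 1")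
  case False
  assume "1 \<le> p"
  then have "\<bar>x\<bar> powr 1 \<le> \<bar>x\<bar> powr p" using False by (intro powr_mono) auto
  then show ?thesis by simp
qed (simp add: add_increasing2)

lemma set_integrable_of_powr:
  fixes f :: "real \<Rightarrow> real"
  assumes "1 \<le> p" and [measurable]: "f \<in> borel_measurable borel"
    and "integrable lborel (\<lambda>x. \<bar>f x\<bar> powr p)"
  shows "set_integrable lborel {x..y} f"
  unfolding set_integrable_def
proof (rule Bochner_Integration.integrable_bound)
  show "integrable lborel (\<lambda>t. indicator {x..y} t *\<^sub>R 1 + \<bar>f t\<bar> powr p)"
    using set_integrable_one[of x y] assms(3) unfolding set_integrable_def by (rule Bochner_Integration.integrable_add)
  show "AE t in lborel. norm (indicator {x..y} t *\<^sub>R f t) \<le> norm (indicator {x..y} t *\<^sub>R 1 + \<bar>f t\<bar> powr p)"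
    using abs_le_1_add_powr[OF assms(1)] by (intro AE_I2) (auto split: split_indicator)
qed measurable

text \<open>A primitive of the weak derivative has the same weak derivative as \<phi>, so the two
  differ by a constant. That g lies in L^p is inherited from the derivative supplied by
  \<open>in_W1p\<close>. As g' vanishes on the nonpositive axis, u is constant there.\<close>

theorem W1p_representative:
  assumes p: "1 \<le> p" and W: "in_W1p p \<phi>" and wd: "has_weak_derivative \<phi> g"
  obtains u g' where "g' \<in> borel_measurable borel" "\<forall>x\<le>0. g' x = 0"
    "\<forall>x y. set_integrable lborel {x..y} g'"
    "\<forall>x y. x \<le> y \<longrightarrow> u y - u x = (LINT t:{x..y}|lborel. g' t)" "continuous_on UNIV u"
    "AE x in lebesgue_on {0..}. \<phi> x = u x" "AE x in lebesgue_on {0..}. g x = g' x"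
    "integrable lborel (\<lambda>x. \<bar>g' x\<bar> powr p)" "integrable lborel (\<lambda>x. indicator {0..} x * \<bar>u x\<bar> powr p)"
proof -
  obtain g0 where g0: "has_weak_derivative \<phi> g0" "in_Lp p g0" and \<phi>: "in_Lp p \<phi>"
    using W by (auto simp: in_W1p_def)
  have gg0: "AE x in lebesgue_on {0..}. g x = g0 x"
    by (rule has_weak_derivative_unique[OF wd g0(1)]) simp
  have li: "locally_integrable g" "locally_integrable \<phi>" using wd by (auto simp: has_weak_derivative_def)
  obtain h where h: "h \<in> borel_measurable borel" "\<forall>x\<le>0. h x = 0"
    "AE x in lebesgue_on {0..}. g x = h x" "\<forall>a>0. \<forall>b. set_integrable lborel {a..b} h"
    "g \<in> borel_measurable (lebesgue_on {0..})" by (rule borel_representative[OF li(1)])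
  note h = h[rule_format]
  obtain \<phi>' where \<phi>': "\<phi>' \<in> borel_measurable borel" "\<forall>x\<le>0. \<phi>' x = 0"
    "AE x in lebesgue_on {0..}. \<phi> x = \<phi>' x" "\<forall>a>0. \<forall>b. set_integrable lborel {a..b} \<phi>'"
    "\<phi> \<in> borel_measurable (lebesgue_on {0..})" by (rule borel_representative[OF li(2)])
  note \<phi>' = \<phi>'[rule_format]
  have [measurable]: "h \<in> borel_measurable borel" by fact
  have Lp: "integrable lborel (\<lambda>x. \<bar>f' x\<bar> powr p)"
    if f: "in_Lp p f" and eq: "AE x in lebesgue_on {0..}. f x = f' x"
      and f'[measurable]: "f' \<in> borel_measurable borel" and f'0: "\<And>x. x < 0 \<Longrightarrow> f' x = 0" for f f'
  proof -
    have m: "(\<lambda>x. \<bar>f' x\<bar> powr p) \<in> borel_measurable (lebesgue_on {0..})"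
      by (rule half_line_measurable) simp
    have "integrable (lebesgue_on {0..}) (\<lambda>x. \<bar>f x\<bar> powr p)" using f by (simp add: in_Lp_def)
    then have "integrable (lebesgue_on {0..}) (\<lambda>x. \<bar>f' x\<bar> powr p)"
      by (rule integrable_cong_AE_imp[OF _ m]) (use eq in \<open>auto elim!: eventually_mono\<close>)
    then show ?thesis
      using f'0 by (subst (asm) integral_half_line(2)) auto
  qed
  have hp: "integrable lborel (\<lambda>x. \<bar>h x\<bar> powr p)"
  proof (rule Lp[OF g0(2) _ h(1)])
    show "AE x in lebesgue_on {0..}. g0 x = h x" using gg0 h(3) by eventually_elim simp
  qed (simp add: h(2))
  note hint = set_integrable_of_powr[OF p h(1) hp]
  define u0 where "u0 x = (LINT t:{0..x}|lborel. h t)" for x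
  have u0: "u0 y - u0 x = (LINT t:{x..y}|lborel. h t)" if "x \<le> y" for x y
  proof -
    have "(LINT t:{0..y}|lborel. h t) = (LINT t:{0..x}|lborel. h t) + (LINT t:{x..y}|lborel. h t)"
    proof -
      have "(LINT t:{0..y}|lborel. h t) = (\<integral>t. indicator {0..x} t *\<^sub>R h t + indicator {x..y} t *\<^sub>R h t \<partial>lborel)"
        unfolding set_lebesgue_integral_def
        using AE_lborel_singleton[of x] that h(2)
        by (intro integral_cong_AE) (auto elim!: eventually_mono split: split_indicator)
      also have "\<dots> = (LINT t:{0..x}|lborel. h t) + (LINT t:{x..y}|lborel. h t)"
        using hint unfolding set_lebesgue_integral_def set_integrable_def
        by (intro Bochner_Integration.integral_add) auto
      finally show ?thesis .
    qed
    then show ?thesis by (simp add: u0_def)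
  qed
  have u0wd: "has_weak_derivative u0 h"
    by (rule primitive_has_weak_derivative[OF h(1) hint u0]) (auto simp: h(2))
  have c0: "continuous_on {0..} u0" by (rule primitive_continuous[OF hint u0]) auto
  have u0neg: "u0 x = 0" if "x \<le> 0" for x
  proof -
    have "(LINT t:{0..x}|lborel. h t) = (LINT t:{0..x}|lborel. 0)"
      using that h(2) by (intro set_lebesgue_integral_cong) auto
    then show ?thesis by (simp add: u0_def)
  qed
  have cont: "continuous_on UNIV u0"
  proof -
    have "continuous_on UNIV (\<lambda>x. u0 (max 0 x))"
      by (rule continuous_on_compose2[OF c0]) (auto intro!: continuous_intros)
    moreover have "u0 (max 0 x) = u0 x" for x using u0neg[of x] u0neg[of 0] by (simp add: max_def)
    ultimately show ?thesis by simp
  qed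
  have [measurable]: "u0 \<in> borel_measurable borel" using cont by (rule borel_measurable_continuous_onI)
  obtain C where C: "AE x in lborel. 0 < x \<longrightarrow> \<phi>' x - u0 x = C"
  proof (rule du_Bois_Reymond)
    show "(\<lambda>x. \<phi>' x - u0 x) \<in> borel_measurable borel" using \<phi>'(1) by measurable
    have iu: "set_integrable lborel {a..b} u0" for a b
      by (intro borel_integrable_atLeastAtMost' continuous_on_subset[OF cont]) auto
    show "set_integrable lborel {a..b} (\<lambda>x. \<phi>' x - u0 x)" if "0 < a" for a b
      by (rule set_integral_diff(1)[OF \<phi>'(4)[OF that] iu])
    fix \<psi> assume \<psi>: "test_function \<psi>"
    note D = test_function_derivative[OF \<psi>]
    note m = test_function_measurable[OF \<psi>]
    have m': "\<psi> \<in> borel_measurable (lebesgue_on {0..})"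
      by (rule half_line_measurable) (rule m)
    obtain a b where ab: "0 < a" "\<And>x. x \<notin> {a..b} \<Longrightarrow> \<psi> x = 0"
      using test_function_support[OF \<psi>] by metis
    have supp': "deriv \<psi> x = 0" if "x \<notin> {a..b}" for x using deriv_eq_0_outside[OF ab(2) that] .
    have hm: "h \<in> borel_measurable (lebesgue_on {0..})"
      by (rule half_line_measurable) simp
    have um: "u0 \<in> borel_measurable (lebesgue_on {0..})"
      by (rule half_line_measurable) simp
    have "(\<integral>x. \<phi>' x * deriv \<psi> x \<partial>lborel) = (\<integral>x. \<phi> x * deriv \<psi> x \<partial>lebesgue_on {0..})"
      by (rule weak_integral_eq[OF \<phi>'(5,3,1) _ m(1), symmetric]) (simp add: \<phi>'(2))
    also have "\<dots> = - (\<integral>x. g x * \<psi> x \<partial>lebesgue_on {0..})"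
      using wd \<psi> by (simp add: has_weak_derivative_def)
    also have "(\<integral>x. g x * \<psi> x \<partial>lebesgue_on {0..}) = (\<integral>x. h x * \<psi> x \<partial>lebesgue_on {0..})"
      using h(5) hm m' h(3) by (intro integral_cong_AE) (auto elim!: eventually_mono)
    also have "- \<dots> = (\<integral>x. u0 x * deriv \<psi> x \<partial>lebesgue_on {0..})"
      using u0wd \<psi> by (simp add: has_weak_derivative_def)
    also have "\<dots> = (\<integral>x. u0 x * deriv \<psi> x \<partial>lborel)"
      by (rule weak_integral_eq[OF um _ _ _ m(1)]) (auto simp: u0neg)
    finally show "(\<integral>x. (\<phi>' x - u0 x) * deriv \<psi> x \<partial>lborel) = 0"
      using integrable_mult_compact_support[OF \<phi>'(1) \<phi>'(4)[OF ab(1)] D(3) supp']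
        integrable_mult_compact_support[OF _ iu[of a b] D(3) supp']
      by (simp add: left_diff_distrib)
  qed
  have "AE x in lebesgue_on {0..}. \<phi>' x - u0 x = C" using C by (simp only: AE_half_line_iff_pos)
  then have eq: "AE x in lebesgue_on {0..}. \<phi> x = C + u0 x"
    using \<phi>'(3) by eventually_elim simp
  show ?thesis
  proof (rule that[of h "\<lambda>x. C + u0 x"])
    show "continuous_on UNIV (\<lambda>x. C + u0 x)" by (intro continuous_intros cont)
    have "integrable lborel (\<lambda>x. \<bar>indicator {0..} x * (C + u0 x)\<bar> powr p)"
    proof (rule Lp[OF \<phi>])
      show "AE x in lebesgue_on {0..}. \<phi> x = indicator {0..} x * (C + u0 x)"
        using eq by (auto simp: AE_half_line_iff elim!: eventually_mono)
    qed auto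
    moreover have "(\<lambda>x. \<bar>indicator {0..} x * (C + u0 x)\<bar> powr p) = (\<lambda>x. indicator {0..} x * \<bar>C + u0 x\<bar> powr p)"
      using p by (auto split: split_indicator)
    ultimately show "integrable lborel (\<lambda>x. indicator {0..} x * \<bar>C + u0 x\<bar> powr p)" by simp
  qed (use h hint u0 eq hp in auto)
qed

section \<open>The rearrangement of a continuous profile\<close>

text \<open>The continuous representative of a nonzero nonnegative function, with a its first
  maximum point on the half-line. It lives on the whole line, where it can be continued by its value
  at 0, so that continuity at 0 is no special case.\<close>

locale half_line_profile =
  fixes p a m :: real and g u :: "real \<Rightarrow> real"
  assumes p: "1 \<le> p"
    and g_meas [measurable]: "g \<in> borel_measurable borel"
    and g_int: "set_integrable lborel {x..y} g"
    and g_powr: "integrable lborel (\<lambda>x. \<bar>g x\<bar> powr p)"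
    and u_diff: "x \<le> y \<Longrightarrow> u y - u x = (LINT t:{x..y}|lborel. g t)"
    and u_cont: "continuous_on UNIV u"
    and u_nonneg: "0 \<le> u x"
    and u_lim: "(u \<longlongrightarrow> 0) at_top"
    and m_pos: "0 < m" and a_nonneg: "0 \<le> a" and u_a: "u a = m" and u_le: "u x \<le> m"
    and u_less: "0 \<le> x \<Longrightarrow> x < a \<Longrightarrow> u x < m"
begin

abbreviation variation :: "real set \<Rightarrow> ennreal" where
  "variation A \<equiv> \<integral>\<^sup>+x\<in>A. ennreal \<bar>g x\<bar> \<partial>lborel"

lemma u_meas [measurable]: "u \<in> borel_measurable borel"
  using u_cont by (rule borel_measurable_continuous_onI)

lemma u_isCont: "isCont u x"
  using u_cont by (simp add: continuous_on_eq_continuous_at)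

text \<open>The points before the peak at which u equals its running maximum. The inequality is
  weak: a point on a plateau of the running maximum has no strictly larger value before it and so,
  up to null sets, belongs to no hollow.\<close>

definition L :: "real set" where "L = {x. 0 \<le> x \<and> x < a \<and> (\<forall>y\<in>{0..x}. u y \<le> u x)}"
definition R :: "real set" where "R = {0..} - L"
definition c :: real where "c = measure lborel L"
definition l :: "real \<Rightarrow> real" where "l \<nu> = measure lborel {x \<in> L. u x < \<nu>}"
definition r :: "real \<Rightarrow> real" where "r \<nu> = measure lborel {x \<in> R. \<nu> \<le> u x}"
definition P :: "real set" where "P = {\<nu>. emeasure lborel {x \<in> {0..}. u x = \<nu>} \<noteq> 0}"
definition W :: "real set" where "W = {x \<in> {0..}. 0 < u x \<and> u x \<notin> P}"

text \<open>
  \<open>T\<close> sends a point to its position after the rearrangement: the points of \<open>L\<close> are sorted by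
  increasing \<open>u\<close>, followed by those of \<open>R\<close> sorted by decreasing \<open>u\<close>. Ties are not broken, so
  \<open>T\<close> collapses the levels of positive measure, which are those in \<open>P\<close>.
\<close>

definition T :: "real \<Rightarrow> real" where
  "T x = (if x \<in> L then l (u x) else c + measure lborel {x' \<in> R. u x < u x'})"

text \<open>The tamping, as the supremum of the levels whose interval [l(\<nu>), c + r(\<nu>)]
  contains y. The top level m is left out since {u >= m} may be null; the inserted 0 gives the
  supremum a value where no level qualifies.\<close>

definition v :: "real \<Rightarrow> real" where
  "v y = Sup (insert 0 {\<nu>. 0 < \<nu> \<and> \<nu> < m \<and> l \<nu> \<le> y \<and> y \<le> c + r \<nu>})"

lemma L_subset: "L \<subseteq> {0..<a}"
  by (auto simp: L_def)

text \<open>Testing the record condition on rational points is enough: a larger value at some y < x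
  persists, by continuity, at rationals just to the right of y.\<close>

lemma L_meas [measurable]: "L \<in> sets borel"
proof -
  have "L = {x. 0 \<le> x \<and> x < a \<and> (\<forall>q::rat. 0 \<le> real_of_rat q \<and> real_of_rat q \<le> x \<longrightarrow> u (real_of_rat q) \<le> u x)}"
    (is "_ = ?L")
  proof (intro set_eqI iffI)
    fix x assume x: "x \<in> ?L"
    have "u y \<le> u x" if y: "0 \<le> y" "y \<le> x" for y
    proof (rule ccontr)
      assume "\<not> u y \<le> u x"
      then have "u x < u y" by simp
      then have "y < x" using y by (cases "y = x") auto
      obtain d where d: "0 < d" "\<forall>z. \<bar>z - y\<bar> < d \<longrightarrow> u z \<in> {u x<..}"
        by (rule isCont_ball[OF u_isCont[of y], of "{u x<..}"]) (use \<open>u x < u y\<close> in auto)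
      obtain q where q: "y < real_of_rat q" "real_of_rat q < min x (y + d)"
        using of_rat_dense[of y "min x (y + d)"] \<open>y < x\<close> d(1) by auto
      then have "u x < u (real_of_rat q)" using d(2) by auto
      moreover have "0 \<le> real_of_rat q" "real_of_rat q \<le> x" using q y by linarith+
      then have "u (real_of_rat q) \<le> u x" using x by blast
      ultimately show False by simp
    qed
    then show "x \<in> L" using x by (auto simp: L_def)
  qed (auto simp: L_def)
  also have "\<dots> \<in> sets borel" by measurable
  finally show ?thesis .
qed

lemma R_meas [measurable]: "R \<in> sets borel" by (simp add: R_def)

lemma R_subset: "R \<subseteq> {0..}" by (auto simp: R_def)

lemma L_fin: "emeasure lborel {x \<in> L. Q x} < \<infinity>"
proof -
  have "emeasure lborel {x \<in> L. Q x} \<le> emeasure lborel {0..a}"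
    using L_subset by (intro emeasure_mono) auto
  also have "\<dots> < \<infinity>" by (simp add: emeasure_lborel_Icc_eq)
  finally show ?thesis .
qed

lemma u_small:
  assumes "0 < \<nu>"
  obtains N where "a \<le> N" "\<And>x. N \<le> x \<Longrightarrow> u x < \<nu>"
proof -
  have "\<forall>\<^sub>F x in at_top. u x < \<nu>" using u_lim assms by (rule order_tendstoD)
  then obtain N where "\<And>x. N \<le> x \<Longrightarrow> u x < \<nu>" by (auto simp: eventually_at_top_linorder)
  then show ?thesis using that[of "max a N"] by auto
qed

lemma superlevel_fin:
  assumes "0 < \<nu>" shows "emeasure lborel {x \<in> {0..}. \<nu> \<le> u x} < \<infinity>"
proof -
  obtain N where N: "\<And>x. N \<le> x \<Longrightarrow> u x < \<nu>" using u_small[OF assms] by blast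
  have "{x \<in> {0..}. \<nu> \<le> u x} \<subseteq> {0..N}"
  proof
    fix x assume x: "x \<in> {x \<in> {0..}. \<nu> \<le> u x}"
    have "\<not> N < x" using N[of x] x by auto
    then show "x \<in> {0..N}" using x by auto
  qed
  then have "emeasure lborel {x \<in> {0..}. \<nu> \<le> u x} \<le> emeasure lborel {0..N}"
    by (intro emeasure_mono) auto
  also have "\<dots> < \<infinity>" by (simp add: emeasure_lborel_Icc_eq)
  finally show ?thesis .
qed

lemma R_fin:
  assumes "0 < \<nu>" "\<And>x. Q x \<Longrightarrow> \<nu> \<le> u x" shows "emeasure lborel {x \<in> R. Q x} < \<infinity>"
proof -
  have "emeasure lborel {x \<in> R. Q x} \<le> emeasure lborel {x \<in> {0..}. \<nu> \<le> u x}"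
    using assms R_subset by (intro emeasure_mono) auto
  also note superlevel_fin[OF assms(1)]
  finally show ?thesis .
qed

lemma L_mono: "{x \<in> L. Q x} \<in> sets borel \<Longrightarrow> {x \<in> L. Q' x} \<in> sets borel \<Longrightarrow> (\<And>x. x \<in> L \<Longrightarrow> Q x \<Longrightarrow> Q' x)
  \<Longrightarrow> measure lborel {x \<in> L. Q x} \<le> measure lborel {x \<in> L. Q' x}"
  using L_fin by (intro measure_mono_fmeasurable fmeasurableI) (auto simp: less_top)

lemma l_mono: "\<nu> \<le> \<nu>' \<Longrightarrow> l \<nu> \<le> l \<nu>'"
  unfolding l_def by (rule L_mono) auto

lemma l_bounds: "0 \<le> l \<nu>" "l \<nu> \<le> c"
  using L_mono[of "\<lambda>x. u x < \<nu>" "\<lambda>_. True"] by (auto simp: l_def c_def)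

lemma r_nonneg: "0 \<le> r \<nu>" by (simp add: r_def)

lemma c_nonneg: "0 \<le> c" by (simp add: c_def)

lemma r_antimono:
  assumes "0 < \<nu>" "\<nu> \<le> \<nu>'" shows "r \<nu>' \<le> r \<nu>"
  unfolding r_def using assms R_fin[OF assms(1), of "\<lambda>x. \<nu> \<le> u x"]
  by (intro measure_mono_fmeasurable fmeasurableI) (auto simp: less_top)

lemma v_bdd: "bdd_above (insert 0 {\<nu>. 0 < \<nu> \<and> \<nu> < m \<and> l \<nu> \<le> y \<and> y \<le> c + r \<nu>})"
  using m_pos by (intro bdd_aboveI[of _ m]) auto

lemma v_geI: "0 < \<nu> \<Longrightarrow> \<nu> < m \<Longrightarrow> l \<nu> \<le> y \<Longrightarrow> y \<le> c + r \<nu> \<Longrightarrow> \<nu> \<le> v y"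
  unfolding v_def using v_bdd by (intro cSup_upper) auto

lemma v_bounds: "0 \<le> v y" "v y \<le> m"
  unfolding v_def using v_bdd m_pos by (auto intro!: cSup_upper cSup_least)

text \<open>As the level rises, l does not decrease and r does not increase, so the levels
  qualifying at y form an interval reaching down to 0.\<close>

lemma less_vD:
  assumes "0 < \<nu>" "\<nu> < v y" shows "\<nu> < m" "l \<nu> \<le> y" "y \<le> c + r \<nu>"
proof -
  obtain \<nu>' where "\<nu>' \<in> insert 0 {\<nu>. 0 < \<nu> \<and> \<nu> < m \<and> l \<nu> \<le> y \<and> y \<le> c + r \<nu>}" "\<nu> < \<nu>'"
    using less_cSupE[OF assms(2)[unfolded v_def]] by blast
  then have "\<nu>' < m" "l \<nu>' \<le> y" "y \<le> c + r \<nu>'" "\<nu> < \<nu>'" using assms(1) by auto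
  then show "\<nu> < m" "l \<nu> \<le> y" "y \<le> c + r \<nu>"
    using l_mono[of \<nu> \<nu>'] r_antimono[OF assms(1), of \<nu>'] by auto
qed

lemma v_leI: "0 \<le> B \<Longrightarrow> (\<And>\<nu>. 0 < \<nu> \<Longrightarrow> \<nu> < v y \<Longrightarrow> \<nu> \<le> B) \<Longrightarrow> v y \<le> B"
  using dense_le[of "v y" B] v_bounds(1)[of y] by (meson dense_le_bounded not_le order_le_less_trans)

lemma v_mono:
  assumes "y1 \<le> y2" "y2 \<le> c" shows "v y1 \<le> v y2"
proof (rule v_leI[OF v_bounds(1)])
  fix \<nu> assume \<nu>: "0 < \<nu>" "\<nu> < v y1"
  show "\<nu> \<le> v y2"
    using \<nu>(1) less_vD[OF \<nu>] assms r_nonneg[of \<nu>] by (intro v_geI) linarith+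
qed

lemma v_antimono:
  assumes "c \<le> y1" "y1 \<le> y2" shows "v y2 \<le> v y1"
proof (rule v_leI[OF v_bounds(1)])
  fix \<nu> assume \<nu>: "0 < \<nu>" "\<nu> < v y2"
  show "\<nu> \<le> v y1"
    using \<nu>(1) less_vD[OF \<nu>] assms l_bounds(2)[of \<nu>] by (intro v_geI) linarith+
qed

lemma v_c: "v c = m"
proof (rule antisym[OF v_bounds(2)])
  show "m \<le> v c"
  proof (rule dense_le_bounded[OF m_pos])
    show "\<nu> \<le> v c" if "0 < \<nu>" "\<nu> < m" for \<nu>
      using that l_bounds[of \<nu>] r_nonneg[of \<nu>] by (intro v_geI) auto
  qed
qed

text \<open>Records have values at least u 0, so l vanishes below that level. This makes v y1 an
  admissible lower level for \<open>ascending_crossing\<close>, which starts at u 0.\<close>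

lemma u_0_le_v:
  assumes "0 \<le> y" "y \<le> c" shows "u 0 \<le> v y"
proof (cases "u 0 = 0")
  case False
  then have "0 < u 0" using u_nonneg[of 0] by simp
  then show ?thesis
  proof (rule dense_le_bounded)
    fix \<nu> assume \<nu>: "0 < \<nu>" "\<nu> < u 0"
    have "u 0 \<le> u x" if "x \<in> L" for x using that by (auto simp: L_def)
    then have "{x \<in> L. u x < \<nu>} = {}" using \<nu>(2) by force
    then have "l \<nu> = 0" by (simp only: l_def measure_empty)
    then show "\<nu> \<le> v y"
      using \<nu> u_le[of 0] assms r_nonneg[of \<nu>] by (intro v_geI) auto
  qed
qed (use v_bounds in simp)

lemma P_countable: "countable P"
  unfolding P_def by (rule countable_fat_levels) auto

lemma P_meas [measurable]: "P \<in> sets borel"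
  using P_countable by (rule sets.countable[rotated]) auto

lemma W_meas [measurable]: "W \<in> sets borel"
  unfolding W_def by measurable

section \<open>The rearrangement map does not increase measure\<close>

lemma T_meas [measurable]: "T \<in> borel_measurable borel"
proof -
  \<comment> \<open>The measure of a section depends measurably on the parameter, being an inner
    integral in Tonelli's theorem.\<close>
  have m: "(\<lambda>x. measure lborel {z \<in> A. Q (u z) (u x)}) \<in> borel_measurable borel"
    if [measurable]: "A \<in> sets borel" "Measurable.pred (borel \<Otimes>\<^sub>M borel) (case_prod Q)" for A Q
  proof -
    have "(\<lambda>x. enn2real (\<integral>\<^sup>+z. indicator {z \<in> A. Q (u z) (u x)} z \<partial>lborel)) \<in> borel_measurable borel"
    proof (rule borel_measurable_enn2real, rule lborel.borel_measurable_nn_integral)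
      have "(\<lambda>(x, z). indicator {w. snd w \<in> A \<and> Q (u (snd w)) (u (fst w))} (x, z) :: ennreal)
          \<in> borel_measurable (borel \<Otimes>\<^sub>M lborel)"
        by measurable
      then show "(\<lambda>(x, z). indicator {z \<in> A. Q (u z) (u x)} z :: ennreal) \<in> borel_measurable (borel \<Otimes>\<^sub>M lborel)"
        by (simp add: indicator_def cong: if_cong)
    qed
    moreover have "{z \<in> A. Q (u z) (u x)} \<in> sets lborel" for x by measurable
    ultimately show ?thesis by (simp add: measure_def)
  qed
  have "(\<lambda>x. l (u x)) \<in> borel_measurable borel"
    unfolding l_def by (rule m) auto
  moreover have "(\<lambda>x. measure lborel {z \<in> R. u x < u z}) \<in> borel_measurable borel"
    by (rule m) auto
  ultimately show ?thesis unfolding T_def by measurable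
qed

lemma level_null: "x \<in> W \<Longrightarrow> A \<subseteq> {0..} \<Longrightarrow> emeasure lborel {z \<in> A. u z = u x} = 0"
proof -
  assume x: "x \<in> W" "A \<subseteq> {0..}"
  have "emeasure lborel {z \<in> A. u z = u x} \<le> emeasure lborel {z \<in> {0..}. u z = u x}"
    using x(2) by (intro emeasure_mono) auto
  then show ?thesis using x(1) by (simp add: W_def P_def)
qed

lemma T_R:
  assumes "x \<in> W" "x \<in> R" shows "T x = c + r (u x)"
proof -
  have "0 < u x" using assms by (simp add: W_def)
  have "{z \<in> R. u x \<le> u z} = {z \<in> R. u x < u z} \<union> {z \<in> R. u z = u x}" by auto
  moreover have "{z \<in> R. u z = u x} \<in> null_sets lborel"
    using level_null[OF assms(1) R_subset] by (intro null_setsI) auto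
  ultimately have "measure lborel {z \<in> R. u x \<le> u z} = measure lborel {z \<in> R. u x < u z}"
    by (simp add: measure_Un_null_set)
  then show ?thesis using assms by (simp add: T_def r_def R_def)
qed

lemma T_L_interval_length_le:
  assumes "y1 \<le> y2"
  shows "emeasure lborel {x \<in> W \<inter> L. y1 \<le> T x \<and> T x \<le> y2} \<le> ennreal (y2 - y1)"
proof -
  \<comment> \<open>L is sorted by increasing u, so the rank lemma is applied to -u.\<close>
  let ?F = "\<lambda>\<nu>. measure lborel {z \<in> L. \<nu> < - u z}"
  have "emeasure lborel {x \<in> W \<inter> L. y1 \<le> ?F (- u x) \<and> ?F (- u x) \<le> y2} \<le> ennreal (y2 - y1)"
  proof (rule rank_preimage_length_le[where B = m])
    show "emeasure lborel {z \<in> L. - u z = - u x} = 0" if "x \<in> W \<inter> L" for x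
      using level_null[of x L] that L_subset by force
    show "\<bar>- u x\<bar> \<le> m" for x using u_le[of x] u_nonneg[of x] by simp
  qed (use assms L_fin in auto)
  moreover have "{x \<in> W \<inter> L. y1 \<le> T x \<and> T x \<le> y2} = {x \<in> W \<inter> L. y1 \<le> ?F (- u x) \<and> ?F (- u x) \<le> y2}"
    by (auto simp: T_def l_def)
  ultimately show ?thesis by simp
qed

lemma T_R_interval_length_le:
  assumes "y1 \<le> y2"
  shows "emeasure lborel {x \<in> W \<inter> R. y1 \<le> T x \<and> T x \<le> y2} \<le> ennreal (y2 - y1)"
proof -
  let ?F = "\<lambda>\<nu>. measure lborel {z \<in> R. \<nu> < u z}"
  have "emeasure lborel {x \<in> W \<inter> R. y1 - c \<le> ?F (u x) \<and> ?F (u x) \<le> y2 - c} \<le> ennreal ((y2 - c) - (y1 - c))"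
  proof (rule rank_preimage_length_le[where B = m])
    show "emeasure lborel {z \<in> R. u z = u x} = 0" if "x \<in> W \<inter> R" for x
      using level_null[of x R] that R_subset by force
    show "\<bar>u x\<bar> \<le> m" for x using u_le[of x] u_nonneg[of x] by simp
    show "emeasure lborel {z \<in> R. u x < u z} < \<infinity>" if "x \<in> W \<inter> R" for x
      using that by (intro R_fin[of "u x"]) (auto simp: W_def)
  qed (use assms in auto)
  moreover have "{x \<in> W \<inter> R. y1 \<le> T x \<and> T x \<le> y2} = {x \<in> W \<inter> R. y1 - c \<le> ?F (u x) \<and> ?F (u x) \<le> y2 - c}"
    by (auto simp: T_def R_def)
  ultimately show ?thesis by simp
qed

text \<open>T sends L into [0, c] and R into [c, oo), so the two images can meet only at c. An
  interval containing c is split there, and the bounds for the two halves add up to its length;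
  bounding both parts on the whole interval would count it twice.\<close>

lemma T_contraction: "distr (density lborel (indicator W)) borel T \<le> lborel"
proof -
  define M where "M = distr (density lborel (indicator W)) borel T"
  have sM: "sets M = sets borel" by (simp add: M_def)
  have M: "emeasure M A = emeasure lborel {x \<in> W. T x \<in> A}" if "A \<in> sets borel" for A
  proof -
    have "emeasure M A = (\<integral>\<^sup>+x. indicator W x * indicator (T -` A) x \<partial>lborel)"
      using that measurable_sets[OF T_meas that] by (simp add: M_def emeasure_distr emeasure_density)
    also have "\<dots> = (\<integral>\<^sup>+x. indicator {x \<in> W. T x \<in> A} x \<partial>lborel)"
      by (intro nn_integral_cong) (auto split: split_indicator)
    finally show ?thesis using that by simp
  qed
  have T_ge: "c \<le> T x" if "x \<in> R" for x using that by (simp add: T_def R_def)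
  have T_le: "T x \<le> c" if "x \<in> L" for x using that l_bounds by (simp add: T_def)
  have "emeasure M A \<le> (\<integral>\<^sup>+x\<in>A. 1 \<partial>lborel)" if A: "A \<in> sets borel" for A
  proof (rule emeasure_le_density_of_intervals[OF _ _ sM _ A])
    fix y1 y2 :: real assume y: "y1 \<le> y2"
    let ?L = "\<lambda>y1 y2. {x \<in> W \<inter> L. y1 \<le> T x \<and> T x \<le> y2}"
    let ?R = "\<lambda>y1 y2. {x \<in> W \<inter> R. y1 \<le> T x \<and> T x \<le> y2}"
    have "{x \<in> W. T x \<in> {y1..y2}} = ?L y1 y2 \<union> ?R y1 y2" by (auto simp: W_def R_def)
    moreover have "emeasure lborel (?L y1 y2 \<union> ?R y1 y2) \<le> ennreal (y2 - y1)"
    proof -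
      consider "y2 < c" | "c < y1" | "y1 \<le> c" "c \<le> y2" by linarith
      then show ?thesis
      proof cases
        case 1
        then have "?L y1 y2 \<union> ?R y1 y2 = ?L y1 y2" using T_ge by force
        then show ?thesis using T_L_interval_length_le[OF y] by simp
      next
        case 2
        then have "?L y1 y2 \<union> ?R y1 y2 = ?R y1 y2" using T_le by force
        then show ?thesis using T_R_interval_length_le[OF y] by simp
      next
        case 3
        have "?L y1 y2 \<subseteq> ?L y1 c" "?R y1 y2 \<subseteq> ?R c y2" using T_le T_ge by auto
        then have "emeasure lborel (?L y1 y2 \<union> ?R y1 y2) \<le> emeasure lborel (?L y1 c \<union> ?R c y2)"
          by (intro emeasure_mono Un_mono) auto
        also have "\<dots> \<le> emeasure lborel (?L y1 c) + emeasure lborel (?R c y2)"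
          by (rule emeasure_subadditive) auto
        also have "\<dots> \<le> ennreal (c - y1) + ennreal (y2 - c)"
          by (intro add_mono T_L_interval_length_le T_R_interval_length_le 3)
        also have "\<dots> = ennreal (y2 - y1)"
          using 3 by (simp flip: ennreal_plus)
        finally show ?thesis .
      qed
    qed
    ultimately show "emeasure M {y1..y2} \<le> (\<integral>\<^sup>+x\<in>{y1..y2}. 1 \<partial>lborel)"
      using y by (simp add: M)
  qed (auto simp: emeasure_lborel_Icc_eq)
  then show ?thesis
    unfolding M_def[symmetric] by (subst le_measure) (auto simp: sM)
qed

end

section \<open>Crossing estimates and the increments of the tamping\<close>

context half_line_profile
begin

lemma abs_g_interval_finite: "variation {x..y} < \<infinity>"
proof -
  have "integrable lborel (\<lambda>t. norm (indicator {x..y} t *\<^sub>R g t))"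
    using g_int[of x y] unfolding set_integrable_def by (rule integrable_norm)
  then have "(\<integral>\<^sup>+t. ennreal (norm (indicator {x..y} t *\<^sub>R g t)) \<partial>lborel) < \<infinity>"
    by (simp add: nn_integral_eq_integral)
  moreover have "(\<integral>\<^sup>+t. ennreal (norm (indicator {x..y} t *\<^sub>R g t)) \<partial>lborel) = variation {x..y}"
    by (intro nn_integral_cong) (auto split: split_indicator)
  ultimately show ?thesis by simp
qed

lemma u_increment_le: "x \<le> y \<Longrightarrow> ennreal \<bar>u y - u x\<bar> \<le> variation {x..y}"
proof -
  assume "x \<le> y"
  have i: "integrable lborel (\<lambda>t. indicator {x..y} t *\<^sub>R g t)" using g_int[of x y] by (simp add: set_integrable_def)
  have "\<bar>u y - u x\<bar> \<le> (\<integral>t. norm (indicator {x..y} t *\<^sub>R g t) \<partial>lborel)"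
    unfolding u_diff[OF \<open>x \<le> y\<close>] set_lebesgue_integral_def
    using integral_norm_bound[of lborel "\<lambda>t. indicator {x..y} t *\<^sub>R g t"] by simp
  then have "ennreal \<bar>u y - u x\<bar> \<le> ennreal (\<integral>t. norm (indicator {x..y} t *\<^sub>R g t) \<partial>lborel)"
    by (rule ennreal_leI)
  also have "\<dots> = (\<integral>\<^sup>+t. ennreal (norm (indicator {x..y} t *\<^sub>R g t)) \<partial>lborel)"
    using i by (intro nn_integral_eq_integral[symmetric]) auto
  also have "\<dots> = variation {x..y}"
    by (intro nn_integral_cong) (auto split: split_indicator)
  finally show ?thesis .
qed

lemma crossing_bound:
  assumes "E \<in> sets borel" "bounded E" "countable N" "{s<..<t} - N \<subseteq> u ` E"
  shows "ennreal (t - s) \<le> variation E"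
  using assms by (intro image_length_le[OF _ abs_g_interval_finite u_increment_le]) auto

lemma tail_in_R: "a \<le> x \<Longrightarrow> x \<in> R"
  using a_nonneg by (auto simp: R_def L_def)

text \<open>Beyond a every level strictly between 0 and m is attained, by decay and the intermediate
  value theorem. Level 0 may never be reached, and \<open>crossing_bound\<close> asks for a bounded
  set: raising the lower level by e confines the crossings to [a, N].\<close>

lemma descending_crossing:
  assumes "0 \<le> s" "s \<le> t" "t \<le> m"
  shows "ennreal (t - s) \<le> variation {x \<in> W. a \<le> x \<and> s < u x \<and> u x < t}"
proof (rule ennreal_le_epsilon)
  fix e :: real assume e: "0 < e"
  obtain N where N: "a \<le> N" "\<And>x. N \<le> x \<Longrightarrow> u x < s + e" using u_small[of "s + e"] assms(1) e by auto
  let ?E = "{x \<in> W. a \<le> x \<and> s < u x \<and> u x < t}"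
  let ?E' = "?E \<inter> {a..N}"
  have "ennreal (t - (s + e)) \<le> variation ?E'"
  proof (rule crossing_bound[OF _ _ P_countable])
    show "{s + e<..<t} - P \<subseteq> u ` ?E'"
    proof
      fix \<nu> assume \<nu>: "\<nu> \<in> {s + e<..<t} - P"
      obtain x where x: "a \<le> x" "x \<le> N" "u x = \<nu>"
        using IVT2'[of u N \<nu> a] \<nu> N u_a assms(3) continuous_on_subset[OF u_cont, of "{a..N}"]
        by (metis DiffD1 greaterThanLessThan_iff less_eq_real_def order_refl order_trans top_greatest)
      then have "x \<in> ?E'" using \<nu> assms(1) e a_nonneg by (auto simp: W_def)
      then show "\<nu> \<in> u ` ?E'" using x(3) by blast
    qed
    show "bounded ?E'" by (rule bounded_subset[of "{a..N}"]) auto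
  qed measurable
  also have "\<dots> \<le> variation ?E"
    by (intro nn_integral_mono) (auto split: split_indicator)
  finally have "ennreal (t - (s + e)) + ennreal e \<le> variation ?E + ennreal e"
    by (rule add_right_mono)
  moreover have "ennreal (t - s) \<le> ennreal (t - (s + e)) + ennreal e"
  proof (cases "s + e \<le> t")
    case True
    then show ?thesis using e by (simp flip: ennreal_plus)
  next
    case False
    then show ?thesis using e by (intro order_trans[OF ennreal_leI[of "t - s" e]]) auto
  qed
  ultimately show "ennreal (t - s) \<le> variation ?E + ennreal e"
    by (rule order_trans[rotated])
qed

text \<open>The first point x at which u reaches a level \<nu> above u 0 is a record: all earlier
  values are below \<nu>, and the intermediate value theorem excludes u x > \<nu>. So L alone meets
  every level between u 0 and m.\<close>

lemma ascending_crossing: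
  assumes "u 0 \<le> s" "t \<le> m"
  shows "ennreal (t - s) \<le> variation {x \<in> W \<inter> L. s < u x \<and> u x < t}"
proof (rule crossing_bound[OF _ _ P_countable])
  let ?E = "{x \<in> W \<inter> L. s < u x \<and> u x < t}"
  show "{s<..<t} - P \<subseteq> u ` ?E"
  proof
    fix \<nu> assume \<nu>: "\<nu> \<in> {s<..<t} - P"
    let ?K = "{0..a} \<inter> {x. \<nu> \<le> u x}"
    have "closed {x. \<nu> \<le> u x}" by (intro closed_Collect_le continuous_on_const u_cont)
    then have "compact ?K" by (intro compact_Int_closed) auto
    moreover have "a \<in> ?K" using \<nu> assms(2) a_nonneg u_a by auto
    ultimately obtain x where x: "x \<in> ?K" "\<And>z. z \<in> ?K \<Longrightarrow> x \<le> z"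
      using compact_attains_inf[of ?K] by blast
    have below: "u z < \<nu>" if "0 \<le> z" "z < x" for z
      using x(2)[of z] that x(1) by force
    have "u x = \<nu>"
    proof (rule ccontr)
      assume "u x \<noteq> \<nu>"
      then have "\<nu> < u x" using x(1) by auto
      obtain z where z: "0 \<le> z" "z \<le> x" "u z = \<nu>"
        using IVT'[of u 0 \<nu> x] \<nu> assms(1) x(1) continuous_on_subset[OF u_cont, of "{0..x}"] by auto
      then show False using below[of z] \<open>\<nu> < u x\<close> by (cases "z = x") auto
    qed
    have "x < a"
      using \<open>u x = \<nu>\<close> x(1) u_a \<nu> assms(2) by (cases "x = a") auto
    have "x \<in> L" unfolding L_def using x(1) \<open>x < a\<close> \<open>u x = \<nu>\<close> below by (auto simp: le_less)
    moreover have "x \<in> W" using \<nu> \<open>u x = \<nu>\<close> x(1) assms(1) u_nonneg[of 0] by (auto simp: W_def)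
    ultimately show "\<nu> \<in> u ` ?E" using \<nu> \<open>u x = \<nu>\<close> by force
  qed
  show "bounded ?E" by (rule bounded_subset[of "{0..a}"]) (use L_subset in auto)
qed measurable

lemma preimage_integral_eq:
  assumes A: "A \<in> sets borel"
  shows "emeasure (distr (density lborel (\<lambda>x. ennreal \<bar>g x\<bar> * indicator W x)) borel T) A
    = variation {x \<in> W. T x \<in> A}"
proof -
  have "emeasure (distr (density lborel (\<lambda>x. ennreal \<bar>g x\<bar> * indicator W x)) borel T) A
      = (\<integral>\<^sup>+x. ennreal \<bar>g x\<bar> * indicator W x * indicator (T -` A) x \<partial>lborel)"
    using A measurable_sets[OF T_meas A] by (simp add: emeasure_distr emeasure_density)
  also have "\<dots> = variation {x \<in> W. T x \<in> A}"
    by (intro nn_integral_cong) (auto split: split_indicator)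
  finally show ?thesis .
qed

lemma preimage_emeasure_le:
  assumes A: "A \<in> sets borel"
  shows "emeasure lborel {x \<in> W. T x \<in> A} \<le> emeasure lborel A"
proof -
  have [measurable]: "A \<in> sets borel" by fact
  have "emeasure lborel {x \<in> W. T x \<in> A} = (\<integral>\<^sup>+x. indicator {x \<in> W. T x \<in> A} x \<partial>lborel)"
    by (rule nn_integral_indicator[symmetric]) measurable
  also have "\<dots> = (\<integral>\<^sup>+x. indicator W x * indicator (T -` A) x \<partial>lborel)"
    by (intro nn_integral_cong) (auto split: split_indicator)
  also have "\<dots> = emeasure (distr (density lborel (indicator W)) borel T) A"
    using A measurable_sets[OF T_meas A] by (simp add: emeasure_distr emeasure_density)
  also have "\<dots> \<le> emeasure lborel A"
    using T_contraction A by (subst (asm) le_measure) auto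
  finally show ?thesis .
qed

text \<open>The preimage of a bounded interval may be unbounded, so local integrability of g does
  not decide this. Its measure is finite by contraction, and |g| <= 1 + |g|^p does the rest.\<close>

lemma preimage_integral_finite: "variation {x \<in> W. T x \<in> {y1..y2}} < \<infinity>"
proof -
  let ?A = "{x \<in> W. T x \<in> {y1..y2}}"
  have "variation ?A \<le> (\<integral>\<^sup>+x. indicator ?A x + ennreal (\<bar>g x\<bar> powr p) \<partial>lborel)"
  proof (rule nn_integral_mono)
    fix x
    have "ennreal \<bar>g x\<bar> \<le> ennreal (1 + \<bar>g x\<bar> powr p)"
      by (intro ennreal_leI abs_le_1_add_powr p)
    then show "ennreal \<bar>g x\<bar> * indicator ?A x \<le> indicator ?A x + ennreal (\<bar>g x\<bar> powr p)"
      by (auto split: split_indicator)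
  qed
  also have "\<dots> = emeasure lborel ?A + energy p g"
    by (subst nn_integral_add) auto
  also have "\<dots> < \<infinity>"
  proof -
    have "emeasure lborel ?A \<le> emeasure lborel {y1..y2}" by (rule preimage_emeasure_le) simp
    then have "emeasure lborel ?A < \<infinity>" by (rule order_le_less_trans) (simp add: emeasure_lborel_Icc_eq)
    moreover have "energy p g < \<infinity>"
      using g_powr by (simp add: nn_integral_eq_integral)
    ultimately show ?thesis by simp
  qed
  finally show ?thesis .
qed

text \<open>Within W, null sets have null preimages under T, so the image measure has a density; the
  density is finite almost everywhere because bounded intervals carry finite mass.\<close>

lemma pushforward_density:
  obtains k :: "real \<Rightarrow> real" where "k \<in> borel_measurable borel" "\<forall>y. 0 \<le> k y"
    "distr (density lborel (\<lambda>x. ennreal \<bar>g x\<bar> * indicator W x)) borel T = density lborel (\<lambda>y. ennreal (k y))"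
proof -
  define M where "M = distr (density lborel (\<lambda>x. ennreal \<bar>g x\<bar> * indicator W x)) borel T"
  have "absolutely_continuous lborel M"
    unfolding absolutely_continuous_def
  proof
    fix A :: "real set" assume A: "A \<in> null_sets lborel"
    then have Ab: "A \<in> sets borel" by auto
    then have [measurable]: "A \<in> sets borel" .
    have "emeasure lborel {x \<in> W. T x \<in> A} \<le> 0"
      using preimage_emeasure_le[OF Ab] A by auto
    then have "{x \<in> W. T x \<in> A} \<in> null_sets lborel" by (intro null_setsI) auto
    then have "emeasure M A = 0"
      unfolding M_def preimage_integral_eq[OF Ab] by (rule nn_integral_null_set)
    then show "A \<in> null_sets M" using Ab by (intro null_setsI) (auto simp: M_def)
  qed
  then obtain q where q[measurable]: "q \<in> borel_measurable lborel" and Mq: "density lborel q = M"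
    using sigma_finite_measure.Radon_Nikodym[OF lborel.sigma_finite_measure_axioms, of M] by (auto simp: M_def)
  have "AE y in lborel. q y \<noteq> \<infinity>"
  proof (rule AE_of_intervals)
    fix n :: nat
    have "(\<integral>\<^sup>+y. q y * indicator {-real n..real n} y \<partial>lborel) = emeasure M {-real n..real n}"
      by (simp add: Mq[symmetric] emeasure_density)
    also have "\<dots> < \<infinity>"
      unfolding M_def by (subst preimage_integral_eq) (use preimage_integral_finite in auto)
    finally have "AE y in lborel. q y * indicator {-real n..real n} y \<noteq> \<infinity>"
      by (intro nn_integral_PInf_AE) auto
    then show "AE y in lborel. y \<in> {-real n..real n} \<longrightarrow> q y \<noteq> \<infinity>"
      by eventually_elim (auto split: split_indicator_asm)
  qed
  then have qfin: "AE y in lborel. q y = ennreal (enn2real (q y))"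
    by eventually_elim (simp add: less_top)
  have "density lborel (\<lambda>y. ennreal (enn2real (q y))) = M"
    unfolding Mq[symmetric] using qfin by (intro density_cong) (auto elim!: eventually_mono)
  then show ?thesis
    by (intro that[of "\<lambda>y. enn2real (q y)"]) (auto simp: M_def)
qed

text \<open>A point of W that the crossing estimates supply, with value strictly between v y1 and v
  y2, is placed by T inside [y1, y2]: its level qualifies at the end where v is larger and cannot
  qualify at the other, where v is smaller than u x. Left of c the points come from L. Right of c
  those beyond a already cross all levels, although T also sends there the points of R before
  a.\<close>

lemma v_increment_le:
  assumes "0 \<le> y1" "y1 \<le> y2" "y2 \<le> c \<or> c \<le> y1"
  shows "ennreal \<bar>v y2 - v y1\<bar> \<le> variation {x \<in> W. T x \<in> {y1..y2}}"
  using assms(3)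
proof
  assume y2: "y2 \<le> c"
  have le: "v y1 \<le> v y2" using assms(2) y2 by (rule v_mono)
  have "ennreal (v y2 - v y1) \<le> variation {x \<in> W \<inter> L. v y1 < u x \<and> u x < v y2}"
    using assms y2 by (intro ascending_crossing u_0_le_v v_bounds) auto
  also have "\<dots> \<le> variation {x \<in> W. T x \<in> {y1..y2}}"
  proof (rule nn_integral_mono)
    fix x
    have "T x \<in> {y1..y2}" if x: "x \<in> W" "x \<in> L" "v y1 < u x" "u x < v y2"
    proof -
      have pos: "0 < u x" using x by (simp add: W_def)
      have T: "T x = l (u x)" using x by (simp add: T_def)
      have "l (u x) \<le> y2" using less_vD[OF pos x(4)] by simp
      moreover have "y1 \<le> l (u x)"
      proof (rule ccontr)
        assume "\<not> y1 \<le> l (u x)"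
        then have "u x \<le> v y1"
          using pos less_vD(1)[OF pos x(4)] r_nonneg[of "u x"] assms y2 by (intro v_geI) auto
        then show False using x(3) by simp
      qed
      ultimately show ?thesis by (simp add: T)
    qed
    then show "ennreal \<bar>g x\<bar> * indicator {x \<in> W \<inter> L. v y1 < u x \<and> u x < v y2} x
        \<le> ennreal \<bar>g x\<bar> * indicator {x \<in> W. T x \<in> {y1..y2}} x"
      by (auto split: split_indicator)
  qed
  finally show ?thesis using le by simp
next
  assume y1: "c \<le> y1"
  have le: "v y2 \<le> v y1" using y1 assms(2) by (rule v_antimono)
  have "ennreal (v y1 - v y2) \<le> variation {x \<in> W. a \<le> x \<and> v y2 < u x \<and> u x < v y1}"
    using le by (intro descending_crossing v_bounds)
  also have "\<dots> \<le> variation {x \<in> W. T x \<in> {y1..y2}}"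
  proof (rule nn_integral_mono)
    fix x
    have "T x \<in> {y1..y2}" if x: "x \<in> W" "a \<le> x" "v y2 < u x" "u x < v y1"
    proof -
      have pos: "0 < u x" using x by (simp add: W_def)
      have T: "T x = c + r (u x)" using x tail_in_R by (intro T_R) auto
      have "y1 \<le> c + r (u x)" using less_vD[OF pos x(4)] by simp
      moreover have "c + r (u x) \<le> y2"
      proof (rule ccontr)
        assume "\<not> c + r (u x) \<le> y2"
        then have "u x \<le> v y2"
          using pos less_vD(1)[OF pos x(4)] l_bounds(2)[of "u x"] assms y1 by (intro v_geI) auto
        then show False using x(3) by simp
      qed
      ultimately show ?thesis by (simp add: T)
    qed
    then show "ennreal \<bar>g x\<bar> * indicator {x \<in> W. a \<le> x \<and> v y2 < u x \<and> u x < v y1} x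
        \<le> ennreal \<bar>g x\<bar> * indicator {x \<in> W. T x \<in> {y1..y2}} x"
      by (auto split: split_indicator)
  qed
  finally show ?thesis using le by simp
qed

end

text \<open>The common conclusion for a positive profile and for the zero function. It is phrased
  with a primitive, so that the passage to weak derivatives is made only once.\<close>

definition energy_controlled :: "real \<Rightarrow> (real \<Rightarrow> real) \<Rightarrow> (real \<Rightarrow> real) \<Rightarrow> (real \<Rightarrow> real) \<Rightarrow> bool" where
  "energy_controlled p g u V \<longleftrightarrow>
    (\<exists>h. h \<in> borel_measurable borel \<and> (\<forall>y<0. h y = 0) \<and> (\<forall>x y. set_integrable lborel {x..y} h) \<and>
      (\<forall>x y. 0 \<le> x \<longrightarrow> x \<le> y \<longrightarrow> V y - V x = (LINT t:{x..y}|lborel. h t)) \<and>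
      energy p h \<le> energy p g \<and> (energy p h = energy p g \<longrightarrow> (\<forall>y\<ge>0. V y = u y)))"

lemma AE_eq_of_nn_integral_eq:
  fixes f g :: "'a \<Rightarrow> ennreal"
  assumes [measurable]: "f \<in> borel_measurable M" "g \<in> borel_measurable M"
    and le: "AE x in M. f x \<le> g x" and fin: "(\<integral>\<^sup>+x. f x \<partial>M) < \<infinity>"
    and ge: "(\<integral>\<^sup>+x. g x \<partial>M) \<le> (\<integral>\<^sup>+x. f x \<partial>M)"
  shows "AE x in M. f x = g x"
proof -
  have "(\<integral>\<^sup>+x. g x - f x \<partial>M) = (\<integral>\<^sup>+x. g x \<partial>M) - (\<integral>\<^sup>+x. f x \<partial>M)"
    using fin le by (intro nn_integral_diff) auto
  also have "\<dots> = 0"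
    using ge fin by (intro diff_eq_0_ennreal) auto
  finally have "AE x in M. g x - f x = 0"
    by (subst (asm) nn_integral_0_iff_AE) auto
  then show ?thesis
    using le nn_integral_PInf_AE[OF assms(1)] fin
    by (auto simp: diff_eq_0_iff_ennreal intro: antisym elim!: eventually_elim2)
qed

context half_line_profile
begin

text \<open>Besides the slope h of v, the equality case needs the density k that dominates |h|, and
  the bound m on the mass of |h| beyond c: there v only descends, from m at c to values that stay
  nonnegative.\<close>

lemma tamped_density:
  obtains h k :: "real \<Rightarrow> real" where "h \<in> borel_measurable borel" "\<forall>y<0. h y = 0"
    "\<forall>x y. set_integrable lborel {x..y} h"
    "\<forall>x y. 0 \<le> x \<longrightarrow> x \<le> y \<longrightarrow> v y - v x = (LINT t:{x..y}|lborel. h t)"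
    "k \<in> borel_measurable borel" "\<forall>y. \<bar>h y\<bar> \<le> k y"
    "(\<integral>\<^sup>+y\<in>{c..}. ennreal \<bar>h y\<bar> \<partial>lborel) \<le> ennreal m"
    "distr (density lborel (\<lambda>x. ennreal \<bar>g x\<bar> * indicator W x)) borel T = density lborel (\<lambda>y. ennreal (k y))"
proof -
  obtain k where k[measurable]: "k \<in> borel_measurable borel" and k0: "\<forall>y. 0 \<le> k y"
    and push: "distr (density lborel (\<lambda>x. ennreal \<bar>g x\<bar> * indicator W x)) borel T = density lborel (\<lambda>y. ennreal (k y))"
    by (rule pushforward_density)
  have kint: "mass k A = variation {x \<in> W. T x \<in> A}"
    if "A \<in> sets borel" for A
    using preimage_integral_eq[OF that] that by (simp add: push emeasure_density)
  \<comment> \<open>Reflecting the descending branch at the height m = v c makes v monotone, so one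
    application of the Stieltjes argument covers both branches. Left of 0 the function is frozen at
    v 0, since v itself may jump there.\<close>
  define F where "F y = (if y \<le> c then v (max 0 y) else 2 * m - v y)" for y
  have mono: "F x \<le> F y" if "x \<le> y" for x y
  proof -
    consider "y \<le> c" | "x \<le> c" "c < y" | "c < x" by linarith
    then show ?thesis
    proof cases
      case 1
      then have "v (max 0 x) \<le> v (max 0 y)" using that c_nonneg by (intro v_mono) auto
      then show ?thesis using 1 that by (simp add: F_def)
    next
      case 2
      then show ?thesis using v_bounds(2)[of "max 0 x"] v_bounds(2)[of y] by (simp add: F_def)
    next
      case 3
      then show ?thesis using v_antimono[of x y] that by (simp add: F_def)
    qed
  qed
  have le: "ennreal (F y - F x) \<le> mass k {x..y}" if "x \<le> y" for x y
  proof -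
    have *: "ennreal \<bar>v y - v x\<bar> \<le> mass k {x..y}"
      if "0 \<le> x" "x \<le> y" "y \<le> c \<or> c \<le> x" for x y
      using v_increment_le[OF that] by (simp add: kint)
    have lower: "ennreal (v y - v (max 0 x)) \<le> mass k {x..y}"
      if "x \<le> y" "0 \<le> y" "y \<le> c" for x y
    proof -
      have "ennreal (v y - v (max 0 x)) \<le> ennreal \<bar>v y - v (max 0 x)\<bar>" by (simp add: ennreal_leI)
      also have "\<dots> \<le> mass k {max 0 x..y}" using that by (intro *) auto
      also have "\<dots> \<le> mass k {x..y}"
        by (intro nn_integral_mono) (auto split: split_indicator)
      finally show ?thesis .
    qed
    consider "y < 0" | "0 \<le> y" "y \<le> c" | "x \<le> c" "c < y" | "c < x" by linarith
    then show ?thesis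
    proof cases
      case 1
      then show ?thesis using that c_nonneg by (simp add: F_def max_def)
    next
      case 2
      then show ?thesis using lower[OF that 2] that by (simp add: F_def max_def split: if_splits)
    next
      case 3
      have "ennreal (F y - F x) = ennreal ((v c - v (max 0 x)) + (v c - v y))"
        using 3 by (simp add: F_def v_c algebra_simps)
      also have "\<dots> = ennreal (v c - v (max 0 x)) + ennreal (v c - v y)"
        using v_bounds by (intro ennreal_plus) (auto simp: v_c)
      also have "\<dots> \<le> mass k {x..c} + mass k {c..y}"
      proof (rule add_mono)
        show "ennreal (v c - v (max 0 x)) \<le> mass k {x..c}"
          using 3 c_nonneg by (intro lower) auto
        have "ennreal (v c - v y) \<le> ennreal \<bar>v y - v c\<bar>" by (intro ennreal_leI) simp
        also have "\<dots> \<le> mass k {c..y}"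
          using 3 c_nonneg by (intro *) auto
        finally show "ennreal (v c - v y) \<le> mass k {c..y}" .
      qed
      also have "\<dots> = (\<integral>\<^sup>+z. ennreal (k z) * indicator {x..c} z + ennreal (k z) * indicator {c..y} z \<partial>lborel)"
        by (rule nn_integral_add[symmetric]) auto
      also have "\<dots> = mass k {x..y}"
        using AE_lborel_singleton[of c] 3
        by (intro nn_integral_cong_AE) (auto elim!: eventually_mono split: split_indicator)
      finally show ?thesis .
    next
      case 4
      have "ennreal (F y - F x) \<le> ennreal \<bar>v y - v x\<bar>"
        using 4 that by (intro ennreal_leI) (simp add: F_def)
      also have "\<dots> \<le> mass k {x..y}"
        using 4 that c_nonneg by (intro *) auto
      finally show ?thesis .
    qed
  qed
  have fin: "mass k {a..b} < \<infinity>" for a b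
    using preimage_integral_finite by (simp add: kint)
  obtain \<eta> where \<eta>m: "\<eta> \<in> borel_measurable borel" and \<eta>0: "\<And>y. 0 \<le> \<eta> y" and \<eta>k: "\<And>y. \<eta> y \<le> k y"
    and \<eta>F: "\<And>x y. x \<le> y \<Longrightarrow> ennreal (F y - F x) = mass \<eta> {x..y}"
    using dominated_increments_density[OF k k0[rule_format] fin mono le] by metis
  note [measurable] = \<eta>m
  have \<eta>int: "set_integrable lborel {x..y} \<eta>" for x y
  proof (cases "x \<le> y")
    case True
    have "integrable lborel (\<lambda>z. indicator {x..y} z * \<eta> z)"
    proof (rule integrableI_nn_integral_finite)
      have "(\<integral>\<^sup>+z. ennreal (indicator {x..y} z * \<eta> z) \<partial>lborel) = mass \<eta> {x..y}"
        by (intro nn_integral_cong) (auto split: split_indicator)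
      then show "(\<integral>\<^sup>+z. ennreal (indicator {x..y} z * \<eta> z) \<partial>lborel) = ennreal (F y - F x)"
        using \<eta>F[OF True] by simp
    qed (use \<eta>0 mono[OF True] in \<open>auto intro!: AE_I2 mult_nonneg_nonneg\<close>)
    then show ?thesis by (simp add: set_integrable_def)
  qed (simp add: set_integrable_def)
  have \<eta>L: "(LINT z:{x..y}|lborel. \<eta> z) = F y - F x" if "x \<le> y" for x y
  proof -
    have "ennreal (LINT z:{x..y}|lborel. \<eta> z) = (\<integral>\<^sup>+z. ennreal (indicator {x..y} z *\<^sub>R \<eta> z) \<partial>lborel)"
      using \<eta>int[of x y] \<eta>0 unfolding set_lebesgue_integral_def set_integrable_def
      by (intro nn_integral_eq_integral[symmetric]) (auto intro!: AE_I2 mult_nonneg_nonneg)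
    also have "\<dots> = mass \<eta> {x..y}"
      by (intro nn_integral_cong) (auto split: split_indicator)
    finally have "ennreal (LINT z:{x..y}|lborel. \<eta> z) = ennreal (F y - F x)" using \<eta>F[OF that] by simp
    moreover have "0 \<le> (LINT z:{x..y}|lborel. \<eta> z)"
      unfolding set_lebesgue_integral_def using \<eta>0 by (intro integral_nonneg_AE AE_I2) simp
    ultimately show ?thesis using mono[OF that] by simp
  qed
  \<comment> \<open>The sign undoes the reflection beyond c.\<close>
  define h where "h y = (if y < 0 then 0 else if y \<le> c then \<eta> y else - \<eta> y)" for y
  have h[measurable]: "h \<in> borel_measurable borel" unfolding h_def by measurable
  have hk: "\<bar>h y\<bar> \<le> \<eta> y" for y using \<eta>0[of y] by (simp add: h_def)
  have hint: "set_integrable lborel {x..y} h" for x y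
    using \<eta>int[of x y] unfolding set_integrable_def
    by (rule Bochner_Integration.integrable_bound) (use hk \<eta>0 in \<open>auto split: split_indicator\<close>)
  have hlow: "v y - v x = (LINT t:{x..y}|lborel. h t)" if "0 \<le> x" "x \<le> y" "y \<le> c" for x y
  proof -
    have "(LINT t:{x..y}|lborel. h t) = (LINT t:{x..y}|lborel. \<eta> t)"
      using that by (intro set_lebesgue_integral_cong) (auto simp: h_def)
    then show ?thesis using \<eta>L[OF that(2)] that by (simp add: F_def max_def)
  qed
  have hhigh: "v y - v x = (LINT t:{x..y}|lborel. h t)" if "c \<le> x" "x \<le> y" for x y
  proof -
    have "(LINT t:{x..y}|lborel. h t) = (LINT t:{x..y}|lborel. - \<eta> t)"
      unfolding set_lebesgue_integral_def
      using that c_nonneg AE_lborel_singleton[of c]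
      by (intro integral_cong_AE) (auto simp: h_def elim!: eventually_mono split: split_indicator)
    also have "\<dots> = - (F y - F x)"
      using \<eta>L[OF that(2)] by (simp add: set_lebesgue_integral_def)
    also have "\<dots> = v y - v x"
      using that v_c c_nonneg by (auto simp: F_def max_def)
    finally show ?thesis by simp
  qed
  have split: "(LINT t:{x..y}|lborel. h t) = (LINT t:{x..c}|lborel. h t) + (LINT t:{c..y}|lborel. h t)"
    if "x \<le> c" "c \<le> y" for x y
  proof -
    have "(LINT t:{x..y}|lborel. h t) = (\<integral>t. indicator {x..c} t *\<^sub>R h t + indicator {c..y} t *\<^sub>R h t \<partial>lborel)"
      unfolding set_lebesgue_integral_def
      using AE_lborel_singleton[of c] that
      by (intro integral_cong_AE) (auto elim!: eventually_mono split: split_indicator)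
    also have "\<dots> = (LINT t:{x..c}|lborel. h t) + (LINT t:{c..y}|lborel. h t)"
      using hint unfolding set_lebesgue_integral_def set_integrable_def
      by (intro Bochner_Integration.integral_add) auto
    finally show ?thesis .
  qed
  have hv: "v y - v x = (LINT t:{x..y}|lborel. h t)" if "0 \<le> x" "x \<le> y" for x y
  proof -
    consider "y \<le> c" | "c \<le> x" | "x \<le> c" "c \<le> y" by linarith
    then show ?thesis
    proof cases
      case 1
      with that show ?thesis by (rule hlow)
    next
      case 2
      then show ?thesis using that(2) by (rule hhigh)
    next
      case 3
      then show ?thesis
        using that hlow[of x c] hhigh[of c y] split[OF 3] by linarith
    qed
  qed
  have "(\<integral>\<^sup>+y\<in>{c..}. ennreal \<bar>h y\<bar> \<partial>lborel) \<le> mass \<eta> {c..}"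
    using hk by (intro nn_integral_mono mult_right_mono ennreal_leI) auto
  also have "\<dots> = (\<integral>\<^sup>+y. (SUP n::nat. ennreal (\<eta> y) * indicator {c..c + real n} y) \<partial>lborel)"
  proof (rule nn_integral_cong)
    fix y
    obtain N :: nat where N: "y - c \<le> real N" using real_arch_simple by blast
    show "ennreal (\<eta> y) * indicator {c..} y = (SUP n::nat. ennreal (\<eta> y) * indicator {c..c + real n} y)"
      by (intro antisym SUP_least SUP_upper2[of N])
        (use N in \<open>auto split: split_indicator\<close>)
  qed
  also have "\<dots> = (SUP n::nat. \<integral>\<^sup>+y\<in>{c..c + real n}. ennreal (\<eta> y) \<partial>lborel)"
    by (rule nn_integral_monotone_convergence_SUP)
      (auto simp: incseq_def le_fun_def split: split_indicator)
  also have "\<dots> \<le> ennreal m"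
  proof (rule SUP_least)
    fix n :: nat
    have "mass \<eta> {c..c + real n} = ennreal (F (c + real n) - F c)"
      by (rule \<eta>F[symmetric]) simp
    also have "\<dots> \<le> ennreal m"
      using v_bounds[of "c + real n"] v_c c_nonneg m_pos by (intro ennreal_leI) (auto simp: F_def)
    finally show "mass \<eta> {c..c + real n} \<le> ennreal m" .
  qed
  finally have "(\<integral>\<^sup>+y\<in>{c..}. ennreal \<bar>h y\<bar> \<partial>lborel) \<le> ennreal m" .
  moreover have "\<forall>y. \<bar>h y\<bar> \<le> k y" using hk \<eta>k by (meson order_trans)
  ultimately show ?thesis
    using h hint hv k push by (intro that[of h k]) (auto simp: h_def)
qed

end

section \<open>The equality case\<close>

context half_line_profile
begin

text \<open>Here L = [0, a) and R = [a, oo), so c = a, nothing is moved, and the sets measured by l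
  and r are intervals.\<close>

lemma v_eq_u_of_unimodal:
  assumes inc: "\<And>x y. 0 \<le> x \<Longrightarrow> x \<le> y \<Longrightarrow> y \<le> a \<Longrightarrow> u x \<le> u y"
    and dec: "\<And>x y. a \<le> x \<Longrightarrow> x \<le> y \<Longrightarrow> u y \<le> u x" and "0 \<le> y"
  shows "v y = u y"
proof -
  have L: "L = {0..<a}" using inc by (auto simp: L_def)
  then have c: "c = a" using a_nonneg by (simp add: c_def)
  have R: "R = {a..}" using a_nonneg by (auto simp: R_def L)
  have meas_le: "measure lborel A \<le> measure lborel B"
    if "A \<subseteq> B" "A \<in> sets borel" "B \<in> sets borel" "emeasure lborel B < \<infinity>" for A B :: "real set"
    using that by (intro measure_mono_fmeasurable fmeasurableI) auto
  show ?thesis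
  proof (rule antisym)
    show "u y \<le> v y"
    proof (cases "u y = 0")
      case False
      then have "0 < u y" using u_nonneg[of y] by simp
      then show ?thesis
      proof (rule dense_le_bounded)
        fix \<nu> assume \<nu>: "0 < \<nu>" "\<nu> < u y"
        show "\<nu> \<le> v y"
        proof (rule v_geI)
          show "\<nu> < m" using \<nu>(2) u_le[of y] by simp
          show "l \<nu> \<le> y"
          proof (cases "y < a")
            case True
            have "{x \<in> L. u x < \<nu>} \<subseteq> {0..y}"
            proof
              fix x assume x: "x \<in> {x \<in> L. u x < \<nu>}"
              have "\<not> y < x" using inc[of y x] x \<nu>(2) \<open>0 \<le> y\<close> by (auto simp: L)
              then show "x \<in> {0..y}" using x by (auto simp: L)
            qed
            then have "l \<nu> \<le> measure lborel {0..y}"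
              unfolding l_def by (rule meas_le) (auto simp: emeasure_lborel_Icc_eq)
            then show ?thesis using \<open>0 \<le> y\<close> by simp
          next
            case False
            then show ?thesis using l_bounds(2)[of \<nu>] c by simp
          qed
          show "y \<le> c + r \<nu>"
          proof (cases "y < a")
            case True
            then show ?thesis using r_nonneg[of \<nu>] c by simp
          next
            case False
            have "{a..y} \<subseteq> {x \<in> R. \<nu> \<le> u x}"
              using dec[of _ y] \<nu>(2) by (force simp: R)
            then have "measure lborel {a..y} \<le> r \<nu>"
              unfolding r_def using R_fin[OF \<nu>(1), of "\<lambda>x. \<nu> \<le> u x"] by (intro meas_le) auto
            then show ?thesis using False c by simp
          qed
        qed fact
      qed
    qed (use v_bounds in simp)
    show "v y \<le> u y"
    proof (rule ccontr)
      assume "\<not> v y \<le> u y"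
      then obtain \<nu> where \<nu>: "u y < \<nu>" "\<nu> < v y" using dense[of "u y" "v y"] by auto
      have pos: "0 < \<nu>" using \<nu>(1) u_nonneg[of y] by simp
      note D = less_vD[OF pos \<nu>(2)]
      \<comment> \<open>The inequalities l(\<nu>) <= y <= c + r(\<nu>) are not strict, so a
        contradiction needs some room: continuity extends u < \<nu> from y to a point e closer to a,
        which pushes l(\<nu>) above y or c + r(\<nu>) below it.\<close>
      obtain d where "0 < d" "\<forall>z. \<bar>z - y\<bar> < d \<longrightarrow> u z \<in> {..<\<nu>}"
        by (rule isCont_ball[OF u_isCont[of y], of "{..<\<nu>}"]) (use \<nu>(1) in auto)
      then have d: "0 < d" "\<And>z. \<bar>z - y\<bar> < d \<Longrightarrow> u z < \<nu>" by auto
      have "y \<noteq> a" using u_a \<nu>(1) D(1) by auto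
      then consider "y < a" | "a < y" by linarith
      then show False
      proof cases
        case 1
        define e where "e = min (y + d / 2) ((y + a) / 2)"
        have e: "y < e" "e < a" "e - y < d" using 1 d(1) by (auto simp: e_def min_def)
        have "u x < \<nu>" if "0 \<le> x" "x \<le> e" for x
        proof -
          have "u e < \<nu>" using e by (intro d(2)) auto
          then show ?thesis using inc[of x e] that e by simp
        qed
        then have "{0..e} \<subseteq> {x \<in> L. u x < \<nu>}" using e by (auto simp: L)
        then have "measure lborel {0..e} \<le> l \<nu>"
          unfolding l_def using L_fin by (intro meas_le) auto
        then show False using D(2) e \<open>0 \<le> y\<close> by simp
      next
        case 2
        define e where "e = max (y - d / 2) ((y + a) / 2)"
        have e1: "y - d / 2 \<le> e" "(y + a) / 2 \<le> e" "e < y"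
          using 2 d(1) by (auto simp: e_def)
        have e: "e < y" "a < e" "y - e < d" using 2 d(1) e1 by (simp_all add: field_simps)
        have "{x \<in> R. \<nu> \<le> u x} \<subseteq> {a..e}"
        proof
          fix x assume x: "x \<in> {x \<in> R. \<nu> \<le> u x}"
          have "u e < \<nu>" using e by (intro d(2)) auto
          then have "\<not> e < x" using dec[of e x] x e by auto
          then show "x \<in> {a..e}" using x by (auto simp: R)
        qed
        then have "r \<nu> \<le> measure lborel {a..e}"
          unfolding r_def by (rule meas_le) (auto simp: emeasure_lborel_Icc_eq)
        then show False using D(3) e c by simp
      qed
    qed
  qed
qed

text \<open>The tail [a, oo) descends from m to 0, which already costs m. Nothing is left for R
  before a, where any descent of u would cross levels at non-records, and the tail itself cannot
  afford an additional ascent.\<close>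

lemma unimodal_of_small_variation:
  assumes off: "AE x in lborel. x \<notin> W \<longrightarrow> g x = 0"
    and small: "variation (W \<inter> R) \<le> ennreal m"
  shows "\<And>x y. 0 \<le> x \<Longrightarrow> x \<le> y \<Longrightarrow> y \<le> a \<Longrightarrow> u x \<le> u y"
    and "\<And>x y. a \<le> x \<Longrightarrow> x \<le> y \<Longrightarrow> u y \<le> u x"
proof -
  have W_eq: "variation A = variation (W \<inter> A)" for A
    using off by (intro nn_integral_cong_AE) (auto elim!: eventually_mono split: split_indicator)
  have tail: "ennreal m \<le> variation {a..}"
  proof -
    have "ennreal (m - 0) \<le> variation {x \<in> W. a \<le> x \<and> 0 < u x \<and> u x < m}"
      using m_pos by (intro descending_crossing) auto
    also have "\<dots> \<le> variation {a..}"
      by (intro nn_integral_mono) (auto split: split_indicator)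
    finally show ?thesis by simp
  qed
  have sum: "variation (R \<inter> {..<a}) + variation {a..} \<le> ennreal m"
  proof -
    have "variation (R \<inter> {..<a}) + variation {a..}
      = (\<integral>\<^sup>+x. ennreal \<bar>g x\<bar> * indicator (R \<inter> {..<a}) x + ennreal \<bar>g x\<bar> * indicator {a..} x \<partial>lborel)"
      by (rule nn_integral_add[symmetric]) auto
    also have "\<dots> = variation R"
      using tail_in_R by (intro nn_integral_cong) (auto split: split_indicator)
    also have "\<dots> \<le> ennreal m" using small by (simp add: W_eq[of R])
    finally show ?thesis .
  qed
  have tail_le: "variation {a..} \<le> ennreal m"
    using sum by (rule order_trans[rotated]) simp
  have zero: "variation (R \<inter> {..<a}) = 0"
  proof -
    have "variation {a..} = ennreal m"
      using tail tail_le by (rule antisym[rotated])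
    then have "ennreal m + variation (R \<inter> {..<a}) \<le> ennreal m + 0"
      using sum by (simp add: add.commute)
    then show ?thesis by (subst (asm) ennreal_add_left_cancel_le) auto
  qed
  show "u x \<le> u y" if xy: "0 \<le> x" "x \<le> y" "y \<le> a" for x y
  proof (rule ccontr)
    assume "\<not> u x \<le> u y"
    then have less: "u y < u x" by simp
    have "ennreal (u x - u y) \<le> variation (R \<inter> {..<a})"
    proof (rule crossing_bound[where N = "{}"])
      show "bounded (R \<inter> {..<a})" by (rule bounded_subset[of "{0..a}"]) (use R_subset in auto)
      show "{u y<..<u x} - {} \<subseteq> u ` (R \<inter> {..<a})"
      proof
        fix \<nu> assume \<nu>: "\<nu> \<in> {u y<..<u x} - {}"
        obtain z where z: "x \<le> z" "z \<le> y" "u z = \<nu>"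
          using IVT2'[of u y \<nu> x] \<nu> xy(2) continuous_on_subset[OF u_cont, of "{x..y}"] by auto
        have "z \<noteq> a" using z(3) \<nu> u_le[of x] u_a by auto
        then have "z < a" using z xy by simp
        moreover have "z \<in> R" using z \<nu> xy(1) by (force simp: R_def L_def)
        ultimately show "\<nu> \<in> u ` (R \<inter> {..<a})" using z(3) by blast
      qed
    qed auto
    then show False using zero less by simp
  qed
  show "u y \<le> u x" if xy: "a \<le> x" "x \<le> y" for x y
  proof (rule ccontr)
    assume "\<not> u y \<le> u x"
    then have less: "u x < u y" by simp
    \<comment> \<open>Going from a to x and up to y costs at least (m - u x) + (u y - u x). Coming
      down again to a value u z < u y - u x brings the total above m + (u y - u x).\<close>
    then obtain N where N: "a \<le> N" "\<And>z. N \<le> z \<Longrightarrow> u z < u y - u x" using u_small[of "u y - u x"] by auto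
    define z where "z = max N y"
    have z: "y \<le> z" "u z < u y - u x" using N(2)[of z] by (auto simp: z_def)
    have "ennreal (m - u x) + ennreal (u y - u x) + ennreal (u y - u z)
      \<le> variation {a..x} + variation {x..y} + variation {y..z}"
      by (intro add_mono order_trans[OF ennreal_leI u_increment_le]) (use u_a xy z(1) in auto)
    also have "\<dots> = (\<integral>\<^sup>+t. ennreal \<bar>g t\<bar> * indicator {a..x} t + ennreal \<bar>g t\<bar> * indicator {x..y} t + ennreal \<bar>g t\<bar> * indicator {y..z} t \<partial>lborel)"
      by (simp add: nn_integral_add)
    also have "\<dots> \<le> variation {a..}"
      using AE_lborel_singleton[of x] AE_lborel_singleton[of y] xy
      by (intro nn_integral_mono_AE) (auto elim!: eventually_elim2 split: split_indicator)
    also have "\<dots> \<le> ennreal m" by (rule tail_le)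
    finally have "ennreal ((m - u x) + (u y - u x) + (u y - u z)) \<le> ennreal m"
      using u_le[of x] less z u_nonneg[of x] by (simp flip: ennreal_plus)
    then have "(m - u x) + (u y - u x) + (u y - u z) \<le> m"
      using m_pos by (simp add: ennreal_le_iff)
    then show False using z(2) less u_nonneg[of x] by simp
  qed
qed

theorem rearrangement_energy: "energy_controlled p g u v"
proof -
  obtain h k where h: "h \<in> borel_measurable borel" "\<forall>y<0. h y = 0"
    "\<forall>x y. set_integrable lborel {x..y} h"
    "\<forall>x y. 0 \<le> x \<longrightarrow> x \<le> y \<longrightarrow> v y - v x = (LINT t:{x..y}|lborel. h t)"
    and k: "k \<in> borel_measurable borel" and hk: "\<forall>y. \<bar>h y\<bar> \<le> k y"
    and hm: "(\<integral>\<^sup>+y\<in>{c..}. ennreal \<bar>h y\<bar> \<partial>lborel) \<le> ennreal m"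
    and push: "distr (density lborel (\<lambda>x. ennreal \<bar>g x\<bar> * indicator W x)) borel T = density lborel (\<lambda>y. ennreal (k y))"
    by (rule tamped_density)
  note [measurable] = h(1) k
  have k0: "0 \<le> k y" for y using hk[rule_format, of y] by linarith
  have kg: "(\<integral>\<^sup>+y. ennreal (k y powr p) \<partial>lborel) \<le> (\<integral>\<^sup>+x\<in>W. ennreal (\<bar>g x\<bar> powr p) \<partial>lborel)"
    by (rule pushforward_powr_integral_le[OF p W_meas T_meas _ _ k k0 push T_contraction]) auto
  have hkp: "\<bar>h y\<bar> powr p \<le> k y powr p" for y using hk p by (intro powr_mono2) auto
  have hk': "energy p h \<le> (\<integral>\<^sup>+y. ennreal (k y powr p) \<partial>lborel)"
    by (intro nn_integral_mono ennreal_leI hkp)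
  have gg: "(\<integral>\<^sup>+x\<in>W. ennreal (\<bar>g x\<bar> powr p) \<partial>lborel) \<le> energy p g"
    by (intro nn_integral_mono) (auto split: split_indicator)
  have gfin: "energy p g < \<infinity>"
    using g_powr by (simp add: nn_integral_eq_integral)
  have "\<forall>y\<ge>0. v y = u y" if eq: "energy p h = energy p g"
  proof -
    have "AE y in lborel. ennreal (\<bar>h y\<bar> powr p) = ennreal (k y powr p)"
    proof (rule AE_eq_of_nn_integral_eq)
      show "(\<integral>\<^sup>+y. ennreal (k y powr p) \<partial>lborel) \<le> energy p h"
        using kg gg eq by simp
      show "energy p h < \<infinity>" using gfin eq by simp
    qed (use hkp in \<open>auto intro: ennreal_leI\<close>)
    then have hk_eq: "AE y in lborel. \<bar>h y\<bar> = k y"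
    proof eventually_elim
      case (elim y)
      then have "\<bar>h y\<bar> powr p = k y powr p" by simp
      moreover have "\<bar>h y\<bar> powr p < k y powr p" if "\<bar>h y\<bar> < k y"
        using that p by (intro powr_less_mono2) auto
      ultimately show ?case using hk[rule_format, of y] by force
    qed
    have "AE x in lborel. ennreal (\<bar>g x\<bar> powr p) * indicator W x = ennreal (\<bar>g x\<bar> powr p)"
    proof (rule AE_eq_of_nn_integral_eq[where f = "\<lambda>x. ennreal (\<bar>g x\<bar> powr p) * indicator W x"
          and g = "\<lambda>x. ennreal (\<bar>g x\<bar> powr p)"])
      show "energy p g \<le> (\<integral>\<^sup>+x\<in>W. ennreal (\<bar>g x\<bar> powr p) \<partial>lborel)"
        using order_trans[OF hk' kg] by (simp add: eq)
      show "(\<integral>\<^sup>+x\<in>W. ennreal (\<bar>g x\<bar> powr p) \<partial>lborel) < \<infinity>" using gg gfin by (rule order_le_less_trans)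
    qed (auto split: split_indicator)
    then have off: "AE x in lborel. x \<notin> W \<longrightarrow> g x = 0"
      by eventually_elim (auto split: split_indicator_asm)
    \<comment> \<open>T places R beyond c, where the pushed variation has density |h| and the
      descending branch of v has at most m to spend.\<close>
    have "variation (W \<inter> R) \<le> variation {x \<in> W. T x \<in> {c..}}"
      by (intro nn_integral_mono) (auto simp: T_def R_def split: split_indicator)
    also have "\<dots> = mass k {c..}"
      using preimage_integral_eq[of "{c..}"] by (simp add: push emeasure_density)
    also have "\<dots> = (\<integral>\<^sup>+y\<in>{c..}. ennreal \<bar>h y\<bar> \<partial>lborel)"
      using hk_eq by (intro nn_integral_cong_AE) (auto elim!: eventually_mono)
    also note hm
    finally have small: "variation (W \<inter> R) \<le> ennreal m" .
    show ?thesis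
      using v_eq_u_of_unimodal[OF unimodal_of_small_variation[OF off small]] by blast
  qed
  then show ?thesis
    using h hk' kg gg unfolding energy_controlled_def by (intro exI[of _ h]) (auto intro: order_trans)
qed

end

section \<open>Identification of the tamping\<close>

lemma null_set_subset: "N \<in> null_sets lebesgue \<Longrightarrow> A \<subseteq> N \<Longrightarrow> A \<in> null_sets lebesgue"
  by (rule null_sets_completion_subset[rotated])

text \<open>The union of all hollows is uncountable and not evidently measurable; agreement with a
  measurable set off a null set supplies measurability by completeness.\<close>

lemma emeasure_lebesgue_cong_null:
  assumes N: "N \<in> null_sets lebesgue" and A: "A \<in> sets lebesgue" and eq: "A - N = B - N"
  shows "B \<in> sets lebesgue" "emeasure lebesgue B = emeasure lebesgue A"
proof -
  have B: "B = (A - N) \<union> (B \<inter> N)" using eq by auto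
  have n: "B \<inter> N \<in> null_sets lebesgue" by (rule null_set_subset[OF N]) auto
  have d: "A - N \<in> sets lebesgue" using A N by auto
  show "B \<in> sets lebesgue" by (subst B) (use n d in auto)
  have "emeasure lebesgue B = emeasure lebesgue (A - N)"
    by (subst B) (rule emeasure_Un_null_set[OF d n])
  also have "\<dots> = emeasure lebesgue A" by (rule emeasure_Diff_null_set[OF N A])
  finally show "emeasure lebesgue B = emeasure lebesgue A" .
qed

text \<open>A set with non-null parts on both sides of x keeps points on both sides after any null
  change, and convexity fills the gap.\<close>

lemma conv_ess_memI:
  assumes "A \<inter> {..<x} \<notin> null_sets lebesgue" "A \<inter> {x<..} \<notin> null_sets lebesgue"
  shows "x \<in> conv_ess A"
  unfolding conv_ess_def
proof (rule InterI, clarify)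
  fix B :: "real set" assume B: "sym_diff A B \<in> null_sets lebesgue"
  have "\<exists>y\<in>B. y < x"
  proof (rule ccontr)
    assume "\<not> (\<exists>y\<in>B. y < x)"
    then have "A \<inter> {..<x} \<subseteq> sym_diff A B" by auto
    then show False using null_set_subset[OF B] assms(1) by blast
  qed
  then obtain y where y: "y \<in> B" "y < x" by blast
  have "\<exists>z\<in>B. x < z"
  proof (rule ccontr)
    assume "\<not> (\<exists>z\<in>B. x < z)"
    then have "A \<inter> {x<..} \<subseteq> sym_diff A B" by auto
    then show False using null_set_subset[OF B] assms(2) by blast
  qed
  then obtain z where z: "z \<in> B" "x < z" by blast
  have "closed_segment y z \<subseteq> convex hull B"
    using y z hull_subset[of B convex] by (intro closed_segment_subset convex_convex_hull) auto
  then show "x \<in> convex hull B" using y z by (auto simp: closed_segment_eq_real_ivl)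
qed

text \<open>If A were null to the left of x, dropping that part and x itself would be a null change,
  and the convex hull of the rest stays strictly to the right of x.\<close>

lemma conv_ess_left_mass:
  assumes "x \<in> conv_ess A" "A \<subseteq> {0..}"
  shows "A \<inter> {..<x} \<notin> null_sets lebesgue"
proof
  assume null: "A \<inter> {..<x} \<in> null_sets lebesgue"
  let ?B = "A \<inter> {x<..}"
  have "sym_diff A ?B \<subseteq> (A \<inter> {..<x}) \<union> {x}" by auto
  moreover have "(A \<inter> {..<x}) \<union> {x} \<in> null_sets lebesgue"
    using null by (intro null_sets.Un) (auto intro: null_sets_completionI finite_imp_null_set_lborel)
  ultimately have "sym_diff A ?B \<in> null_sets lebesgue" by (rule null_set_subset[rotated])
  moreover have "?B \<subseteq> {0..}" using assms(2) by auto
  ultimately have "x \<in> convex hull ?B" using assms(1) unfolding conv_ess_def by blast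
  moreover have "convex hull ?B \<subseteq> {x<..}" by (intro hull_minimal) auto
  ultimately show False by auto
qed

text \<open>The supremum is attained because [0, X) is the union of the intervals [0, X - 1/(n+1)],
  on each of which A is null. It is finite because A is the union of its bounded parts and is not
  null.\<close>

lemma inf_ess_attained:
  assumes A: "A \<subseteq> {0..}" and pos: "A \<notin> null_sets lebesgue" "A \<in> sets lebesgue"
  obtains X where "0 \<le> X" "inf_ess A = ereal X" "A \<inter> {0..X} \<in> null_sets lebesgue"
    "\<forall>x\<ge>0. A \<inter> {0..x} \<in> null_sets lebesgue \<longrightarrow> x \<le> X"
proof -
  define Z where "Z = {x. 0 \<le> x \<and> A \<inter> {0..x} \<in> null_sets lebesgue}"
  have Z_eq: "{x. 0 \<le> x \<and> emeasure lebesgue (A \<inter> {0..x}) = 0} = Z"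
    using pos(2) by (auto simp: Z_def null_sets_def)
  have "A \<inter> {0..0} \<in> null_sets lebesgue"
    by (rule null_set_subset[of "{0}"]) (auto intro: null_sets_completionI finite_imp_null_set_lborel)
  then have "0 \<in> Z" by (simp add: Z_def)
  have "\<exists>n::nat. A \<inter> {0..real n} \<notin> null_sets lebesgue"
  proof (rule ccontr)
    assume "\<not> ?thesis"
    then have "(\<Union>n::nat. A \<inter> {0..real n}) \<in> null_sets lebesgue" by (intro null_sets_UN) auto
    moreover have "A \<subseteq> (\<Union>n::nat. A \<inter> {0..real n})"
    proof
      fix x assume "x \<in> A"
      moreover obtain n :: nat where "x \<le> real n" using real_arch_simple by blast
      ultimately show "x \<in> (\<Union>n::nat. A \<inter> {0..real n})" using A by auto
    qed
    ultimately show False using null_set_subset pos(1) by blast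
  qed
  then obtain n :: nat where n: "A \<inter> {0..real n} \<notin> null_sets lebesgue" by blast
  have Z_le: "x \<le> real n" if "x \<in> Z" for x
  proof (rule ccontr)
    assume "\<not> x \<le> real n"
    then have "A \<inter> {0..real n} \<subseteq> A \<inter> {0..x}" by auto
    moreover have "A \<inter> {0..x} \<in> null_sets lebesgue" using that by (simp add: Z_def)
    ultimately show False using n null_set_subset by blast
  qed
  have bdd: "bdd_above Z" using Z_le by (intro bdd_aboveI[of _ "real n"])
  define X where "X = Sup Z"
  have X0: "0 \<le> X" unfolding X_def using \<open>0 \<in> Z\<close> bdd by (rule cSup_upper)
  have null: "A \<inter> {0..X} \<in> null_sets lebesgue"
  proof -
    have "A \<inter> {0..X - 1 / Suc n} \<in> null_sets lebesgue" for n
    proof -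
      have "X - 1 / Suc n < Sup Z" by (simp add: X_def)
      then obtain z where "z \<in> Z" "X - 1 / Suc n < z" using less_cSupE \<open>0 \<in> Z\<close> by (metis empty_iff)
      then show ?thesis by (rule_tac null_set_subset[of "A \<inter> {0..z}"]) (auto simp: Z_def)
    qed
    then have "(\<Union>n. A \<inter> {0..X - 1 / Suc n}) \<union> {X} \<in> null_sets lebesgue"
      by (intro null_sets.Un null_sets_UN) (auto intro: null_sets_completionI finite_imp_null_set_lborel)
    moreover have "A \<inter> {0..X} \<subseteq> (\<Union>n. A \<inter> {0..X - 1 / Suc n}) \<union> {X}"
    proof
      fix x assume x: "x \<in> A \<inter> {0..X}"
      show "x \<in> (\<Union>n. A \<inter> {0..X - 1 / Suc n}) \<union> {X}"
      proof (cases "x = X")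
        case False
        then obtain n where "inverse (real (Suc n)) < X - x" using reals_Archimedean[of "X - x"] x by auto
        then have "x \<in> A \<inter> {0..X - 1 / Suc n}" using x by (auto simp: inverse_eq_divide)
        then show ?thesis by blast
      qed simp
    qed
    ultimately show ?thesis by (rule null_set_subset)
  qed
  have "inf_ess A = ereal X"
    unfolding inf_ess_def Z_eq
  proof (rule antisym)
    show "(SUP x\<in>Z. ereal x) \<le> ereal X"
      using bdd by (intro SUP_least) (auto simp: X_def intro: cSup_upper)
    show "ereal X \<le> (SUP x\<in>Z. ereal x)"
      using X0 null by (intro SUP_upper) (auto simp: Z_def)
  qed
  moreover have "\<forall>x\<ge>0. A \<inter> {0..x} \<in> null_sets lebesgue \<longrightarrow> x \<le> X"
    using bdd by (auto simp: X_def Z_def intro: cSup_upper)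
  ultimately show ?thesis using X0 null that by blast
qed

section \<open>The hollows of a profile and the superlevel intervals of its tamping\<close>

context half_line_profile
begin

text \<open>Continuity gives an interval on which u exceeds t. It is taken to the right of y since y
  may be 0, and y < x leaves room for it before x.\<close>

lemma right_nbhd_not_null:
  assumes "t < u y" "0 \<le> y" "y < x" "{z \<in> {0..}. t \<le> u z} - N \<subseteq> A" "N \<in> null_sets lebesgue"
  shows "A \<inter> {..<x} \<notin> null_sets lebesgue"
proof
  assume null: "A \<inter> {..<x} \<in> null_sets lebesgue"
  obtain d where d: "0 < d" "\<forall>z. \<bar>z - y\<bar> < d \<longrightarrow> u z \<in> {t<..}"
    by (rule isCont_ball[OF u_isCont[of y], of "{t<..}"]) (use assms(1) in auto)
  define e where "e = min x (y + d)"
  have "{y<..<e} \<subseteq> (A \<inter> {..<x}) \<union> N"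
  proof
    fix z assume z: "z \<in> {y<..<e}"
    then have "t < u z" using d(2) by (auto simp: e_def)
    then show "z \<in> (A \<inter> {..<x}) \<union> N" using z assms(2,4) by (auto simp: e_def)
  qed
  then have "{y<..<e} \<in> null_sets lebesgue"
    using null_set_subset null_sets.Un[OF null assms(5)] by blast
  then have "emeasure lebesgue {y<..<e} = 0" by (rule null_setsD1)
  moreover have "y < e" using assms(3) d(1) by (simp add: e_def)
  ultimately show False by simp
qed

context
  fixes \<phi> :: "real \<Rightarrow> real"
  assumes \<phi>: "AE x in lebesgue_on {0..}. \<phi> x = u x"
begin

definition "N\<^sub>\<phi> = {x \<in> {0..}. \<phi> x \<noteq> u x}"

lemma N_null: "N\<^sub>\<phi> \<in> null_sets lebesgue"
proof -
  have "AE x in lebesgue. x \<in> {0..} \<longrightarrow> \<phi> x = u x"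
    using \<phi> by (subst (asm) AE_restrict_space_iff) auto
  then obtain N where "{x \<in> space lebesgue. \<not> (x \<in> {0..} \<longrightarrow> \<phi> x = u x)} \<subseteq> N"
    "emeasure lebesgue N = 0" "N \<in> sets lebesgue"
    by (rule AE_E)
  then show ?thesis by (rule_tac null_set_subset[OF null_setsI]) (auto simp: N\<^sub>\<phi>_def)
qed

lemma superlevel_eq: "superlevel \<phi> \<nu> - N\<^sub>\<phi> = {x \<in> {0..}. \<nu> \<le> u x} - N\<^sub>\<phi>"
  by (auto simp: superlevel_def N\<^sub>\<phi>_def)

lemma superlevel_emeasure:
  "superlevel \<phi> \<nu> \<in> sets lebesgue"
  "emeasure lebesgue (superlevel \<phi> \<nu>) = emeasure lborel {x \<in> {0..}. \<nu> \<le> u x}"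
proof -
  have A: "{x \<in> {0..}. \<nu> \<le> u x} \<in> sets lborel" by measurable
  then have A': "{x \<in> {0..}. \<nu> \<le> u x} \<in> sets lebesgue" by (rule sets_completionI_sets)
  have "emeasure lebesgue {x \<in> {0..}. \<nu> \<le> u x} = emeasure lborel {x \<in> {0..}. \<nu> \<le> u x}"
    using A by simp
  then show "superlevel \<phi> \<nu> \<in> sets lebesgue"
    "emeasure lebesgue (superlevel \<phi> \<nu>) = emeasure lborel {x \<in> {0..}. \<nu> \<le> u x}"
    using emeasure_lebesgue_cong_null[OF N_null A' superlevel_eq[symmetric]] by auto
qed

lemma superlevel_subset: "superlevel \<phi> \<nu> \<subseteq> {0..}"
  by (auto simp: superlevel_def)

text \<open>If a record is below the level t, so is every earlier point; the superlevel set then has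
  no mass to its left, and the essential hull does not reach it.\<close>

lemma not_hollow:
  assumes "x \<in> L" "x \<notin> N\<^sub>\<phi>" shows "x \<notin> hollows_below \<infinity> \<phi>"
proof
  assume "x \<in> hollows_below \<infinity> \<phi>"
  then obtain t where t: "x \<in> conv_ess (superlevel \<phi> t)" "x \<notin> superlevel \<phi> t"
    by (auto simp: hollows_below_def hollows_def)
  have "u x < t" using t(2) assms by (auto simp: superlevel_def L_def N\<^sub>\<phi>_def)
  have "u z < t" if "0 \<le> z" "z < x" for z
    using assms(1) that \<open>u x < t\<close> by (force simp: L_def)
  then have "superlevel \<phi> t \<inter> {..<x} \<subseteq> N\<^sub>\<phi>"
    by (force simp: superlevel_def N\<^sub>\<phi>_def)
  then have "superlevel \<phi> t \<inter> {..<x} \<in> null_sets lebesgue" by (rule null_set_subset[OF N_null])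
  then show False using conv_ess_left_mass[OF t(1) superlevel_subset] by blast
qed

text \<open>A non-record has a larger value u y somewhere before it; beyond a the point a itself
  serves. A level between u x and u y then has mass to the left of x.\<close>

lemma hollow:
  assumes x: "0 \<le> x" "x \<notin> N\<^sub>\<phi>" "x \<notin> L" "u x < \<nu>" "\<nu> \<le> m"
    and right: "superlevel \<phi> \<nu> \<inter> {x<..} \<notin> null_sets lebesgue"
  shows "x \<in> hollows_below \<infinity> \<phi>"
proof -
  obtain y where y: "0 \<le> y" "y < x" "u x < u y"
  proof (cases "x < a")
    case True
    then obtain y where "0 \<le> y" "y \<le> x" "u x < u y" using x by (auto simp: L_def not_le)
    then show ?thesis using that[of y] by (cases "y = x") auto
  next
    case False
    then have "a < x" using x(4,5) u_a by (cases "x = a") auto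
    then show ?thesis using that[of a] a_nonneg u_a x(4,5) by simp
  qed
  \<comment> \<open>The midpoint separates u x from u y, and the cap by \<nu> keeps the mass of
    {\<phi> >= \<nu>} to the right of x available.\<close>
  define t where "t = min ((u x + u y) / 2) \<nu>"
  have t: "u x < t" "t < u y" "t \<le> \<nu>" using y x(4) by (auto simp: t_def min_def)
  have "superlevel \<phi> t \<inter> {..<x} \<notin> null_sets lebesgue"
    by (rule right_nbhd_not_null[OF t(2) y(1,2) _ N_null]) (use superlevel_eq in blast)
  moreover have "superlevel \<phi> t \<inter> {x<..} \<notin> null_sets lebesgue"
  proof
    assume "superlevel \<phi> t \<inter> {x<..} \<in> null_sets lebesgue"
    moreover have "superlevel \<phi> \<nu> \<inter> {x<..} \<subseteq> superlevel \<phi> t \<inter> {x<..}"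
      using t(3) by (auto simp: superlevel_def)
    ultimately show False using right null_set_subset by blast
  qed
  ultimately have "x \<in> conv_ess (superlevel \<phi> t)" by (rule conv_ess_memI)
  moreover have "x \<notin> superlevel \<phi> t" using x(1,2) t(1) by (auto simp: superlevel_def N\<^sub>\<phi>_def)
  ultimately show ?thesis by (auto simp: hollows_below_def hollows_def)
qed

text \<open>Left of X, the essential infimum of {\<phi> >= \<nu>}, almost every value is below
  \<nu>, and almost every point is in a hollow exactly when it is no record. Removing the hollows
  from [0, X] thus leaves records below \<nu>, and these are all of them, as none lies beyond X;
  their measure is \<open>l \<nu>\<close>.\<close>

lemma tamp_y_eq:
  assumes \<nu>: "0 < \<nu>" "\<nu> \<le> m" and pos: "emeasure lebesgue (superlevel \<phi> \<nu>) \<noteq> 0"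
  shows "tamp_y \<phi> \<nu> = l \<nu>"
proof -
  have "superlevel \<phi> \<nu> \<notin> null_sets lebesgue" using pos by (auto simp: null_sets_def)
  then obtain X where X: "0 \<le> X" "inf_ess (superlevel \<phi> \<nu>) = ereal X"
    "superlevel \<phi> \<nu> \<inter> {0..X} \<in> null_sets lebesgue"
    "\<forall>x\<ge>0. superlevel \<phi> \<nu> \<inter> {0..x} \<in> null_sets lebesgue \<longrightarrow> x \<le> X"
    using inf_ess_attained[OF superlevel_subset _ superlevel_emeasure(1)] by metis
  let ?L = "{x \<in> L. u x < \<nu>}"
  have L_sub: "?L \<subseteq> {0..X}"
  proof
    fix x assume x: "x \<in> ?L"
    then have "u z < \<nu>" if "0 \<le> z" "z \<le> x" for z using that by (force simp: L_def)
    then have "superlevel \<phi> \<nu> \<inter> {0..x} \<subseteq> N\<^sub>\<phi>" by (force simp: superlevel_def N\<^sub>\<phi>_def)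
    then have "superlevel \<phi> \<nu> \<inter> {0..x} \<in> null_sets lebesgue" by (rule null_set_subset[OF N_null])
    then show "x \<in> {0..X}" using X(4) x by (auto simp: L_def)
  qed
  have right: "superlevel \<phi> \<nu> \<inter> {x<..} \<notin> null_sets lebesgue" if "x \<le> X" for x
  proof
    assume "superlevel \<phi> \<nu> \<inter> {x<..} \<in> null_sets lebesgue"
    then have "(superlevel \<phi> \<nu> \<inter> {0..X}) \<union> (superlevel \<phi> \<nu> \<inter> {x<..}) \<in> null_sets lebesgue"
      using X(3) by (rule null_sets.Un[rotated])
    moreover have "superlevel \<phi> \<nu> \<subseteq> (superlevel \<phi> \<nu> \<inter> {0..X}) \<union> (superlevel \<phi> \<nu> \<inter> {x<..})"
      using that superlevel_subset by force
    ultimately show False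
      using null_set_subset \<open>superlevel \<phi> \<nu> \<notin> null_sets lebesgue\<close> by blast
  qed
  \<comment> \<open>Off this null set \<phi> and u agree, and u < \<nu> throughout [0, X].\<close>
  let ?N = "N\<^sub>\<phi> \<union> (superlevel \<phi> \<nu> \<inter> {0..X})"
  have "({0..X} - ?L) - ?N = (hollows_below \<infinity> \<phi> \<inter> {0..X}) - ?N"
  proof (intro set_eqI iffI)
    fix x assume x: "x \<in> ({0..X} - ?L) - ?N"
    then have "u x < \<nu>" by (auto simp: superlevel_def N\<^sub>\<phi>_def)
    then have "x \<in> hollows_below \<infinity> \<phi>"
      using x \<nu> by (intro hollow[of x \<nu>] right) auto
    then show "x \<in> (hollows_below \<infinity> \<phi> \<inter> {0..X}) - ?N" using x by auto
  next
    fix x assume x: "x \<in> (hollows_below \<infinity> \<phi> \<inter> {0..X}) - ?N"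
    then show "x \<in> ({0..X} - ?L) - ?N" using not_hollow[of x] by auto
  qed
  then have "emeasure lebesgue (hollows_below \<infinity> \<phi> \<inter> {0..X}) = emeasure lebesgue ({0..X} - ?L)"
    by (intro emeasure_lebesgue_cong_null(2)[OF null_sets.Un[OF N_null X(3)]]) auto
  also have "\<dots> = emeasure lborel ({0..X} - ?L)" by simp
  also have "\<dots> = emeasure lborel {0..X} - emeasure lborel ?L"
    using L_sub L_fin by (intro emeasure_Diff) (auto simp: less_top)
  also have "\<dots> = ennreal (X - l \<nu>)"
    using X(1) L_fin[of "\<lambda>x. u x < \<nu>"] l_bounds(1)[of \<nu>]
    by (simp add: l_def emeasure_eq_ennreal_measure less_top ennreal_minus)
  finally have "emeasure lebesgue (hollows_below \<infinity> \<phi> \<inter> {0..X}) = ennreal (X - l \<nu>)" .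
  moreover have "l \<nu> \<le> X"
  proof -
    have "l \<nu> \<le> measure lborel {0..X}"
      unfolding l_def using L_sub
      by (intro measure_mono_fmeasurable fmeasurableI) (auto simp: emeasure_lborel_Icc_eq)
    then show ?thesis using X(1) by simp
  qed
  ultimately have "measure lebesgue (hollows_below \<infinity> \<phi> \<inter> {0..X}) = X - l \<nu>"
    by (simp add: measure_def)
  then show ?thesis using X(2) by (simp add: tamp_y_def tamp_x_def)
qed

lemma superlevel_measure:
  assumes \<nu>: "0 < \<nu>"
  shows "measure lebesgue (superlevel \<phi> \<nu>) = (c - l \<nu>) + r \<nu>"
proof -
  have fin: "emeasure lborel {x \<in> R. \<nu> \<le> u x} \<noteq> \<infinity>" using R_fin[OF \<nu>, of "\<lambda>x. \<nu> \<le> u x"] by auto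
  have finL: "emeasure lborel {x \<in> L. Q x} \<noteq> \<infinity>" for Q using L_fin[of Q] by auto
  have "measure lebesgue (superlevel \<phi> \<nu>) = measure lborel {x \<in> {0..}. \<nu> \<le> u x}"
    by (simp add: measure_def superlevel_emeasure(2))
  also have "{x \<in> {0..}. \<nu> \<le> u x} = {x \<in> L. \<nu> \<le> u x} \<union> {x \<in> R. \<nu> \<le> u x}"
    using L_subset by (auto simp: R_def)
  also have "measure lborel \<dots> = measure lborel {x \<in> L. \<nu> \<le> u x} + r \<nu>"
    unfolding r_def using fin finL by (intro measure_Union) (auto simp: R_def)
  also have "measure lborel {x \<in> L. \<nu> \<le> u x} = c - l \<nu>"
  proof -
    have "c = measure lborel ({x \<in> L. \<nu> \<le> u x} \<union> {x \<in> L. u x < \<nu>})"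
      unfolding c_def by (rule arg_cong[where f = "measure lborel"]) auto
    also have "\<dots> = measure lborel {x \<in> L. \<nu> \<le> u x} + l \<nu>"
      unfolding l_def using finL by (intro measure_Union) auto
    finally show ?thesis by simp
  qed
  finally show ?thesis .
qed

lemma superlevel_empty:
  assumes "m < \<nu>" shows "emeasure lebesgue (superlevel \<phi> \<nu>) = 0"
proof -
  have "\<not> \<nu> \<le> u x" for x using assms u_le[of x] by linarith
  then have "{x \<in> {0..}. \<nu> \<le> u x} = {}" by blast
  then show ?thesis unfolding superlevel_emeasure(2) by (simp only: emeasure_empty)
qed

lemma superlevel_pos:
  assumes "\<nu> < m" shows "emeasure lebesgue (superlevel \<phi> \<nu>) \<noteq> 0"
proof
  assume "emeasure lebesgue (superlevel \<phi> \<nu>) = 0"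
  then have "superlevel \<phi> \<nu> \<in> null_sets lebesgue" using superlevel_emeasure(1) by (intro null_setsI)
  then have "superlevel \<phi> \<nu> \<inter> {..<a + 1} \<in> null_sets lebesgue"
    by (rule null_set_subset) auto
  moreover have "superlevel \<phi> \<nu> \<inter> {..<a + 1} \<notin> null_sets lebesgue"
    by (rule right_nbhd_not_null[of \<nu> a, OF _ a_nonneg _ _ N_null]) (use superlevel_eq u_a assms in auto)
  ultimately show False by blast
qed

lemma tamp_S_eq:
  assumes \<nu>: "0 < \<nu>"
  shows "tamp_S \<phi> \<nu> = (if emeasure lebesgue (superlevel \<phi> \<nu>) = 0 then {} else {l \<nu>..c + r \<nu>})"
proof (cases "emeasure lebesgue (superlevel \<phi> \<nu>) = 0")
  case False
  then have "\<nu> \<le> m" using superlevel_empty by force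
  have "emeasure lebesgue (superlevel \<phi> \<nu>) \<noteq> \<infinity>"
    using superlevel_fin[OF \<nu>] by (simp add: superlevel_emeasure(2))
  then show ?thesis
    using False by (simp add: tamp_S_def tamp_y_eq[OF \<nu> \<open>\<nu> \<le> m\<close>] superlevel_measure[OF \<nu>])
qed (simp add: tamp_S_def)

theorem tamping_eq_v: "tamping \<phi> y = ennreal (v y)"
proof (rule antisym)
  show "tamping \<phi> y \<le> ennreal (v y)"
    unfolding tamping_def
  proof (rule SUP_least)
    fix \<nu> assume "\<nu> \<in> {\<nu>. 0 < \<nu> \<and> y \<in> tamp_S \<phi> \<nu>}"
    then have \<nu>: "0 < \<nu>" "emeasure lebesgue (superlevel \<phi> \<nu>) \<noteq> 0" "l \<nu> \<le> y" "y \<le> c + r \<nu>"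
      by (auto simp: tamp_S_eq split: if_splits)
    then have "\<nu> \<le> m" using superlevel_empty by force
    \<comment> \<open>\<nu> may be m itself, which v leaves out; all smaller positive levels qualify
      as well, and their supremum is \<nu>.\<close>
    have "\<nu> \<le> v y"
    proof (rule dense_le_bounded[OF \<nu>(1)])
      fix \<nu>' assume \<nu>': "0 < \<nu>'" "\<nu>' < \<nu>"
      show "\<nu>' \<le> v y"
        using \<nu>' \<nu> \<open>\<nu> \<le> m\<close> l_mono[of \<nu>' \<nu>] r_antimono[of \<nu>' \<nu>] by (intro v_geI) auto
    qed
    then show "ennreal \<nu> \<le> ennreal (v y)" by (rule ennreal_leI)
  qed
  show "ennreal (v y) \<le> tamping \<phi> y"
  proof (rule ccontr)
    assume "\<not> ennreal (v y) \<le> tamping \<phi> y"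
    then have less: "tamping \<phi> y < ennreal (v y)" by simp
    then obtain s where s: "0 \<le> s" "tamping \<phi> y = ennreal s"
      by (cases "tamping \<phi> y") auto
    then have "s < v y" using less by (simp add: ennreal_less_iff)
    then obtain \<nu> where \<nu>: "s < \<nu>" "\<nu> < v y" using dense by blast
    have pos: "0 < \<nu>" using \<nu>(1) s(1) by simp
    have "y \<in> tamp_S \<phi> \<nu>"
      using less_vD[OF pos \<nu>(2)] superlevel_pos by (simp add: tamp_S_eq[OF pos])
    then have "ennreal \<nu> \<le> tamping \<phi> y"
      unfolding tamping_def using pos by (intro SUP_upper) auto
    then show False using s \<nu>(1) by (simp add: ennreal_le_iff)
  qed
qed

end

end

section \<open>Decay and nonnegativity of the continuous representative\<close>

lemma continuous_nonneg_of_AE: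
  fixes u :: "real \<Rightarrow> real"
  assumes u: "continuous_on UNIV u" and ae: "AE x in lborel. 0 \<le> x \<longrightarrow> 0 \<le> u x" and "0 \<le> x"
  shows "0 \<le> u x"
proof (rule ccontr)
  assume "\<not> 0 \<le> u x"
  moreover have "isCont u x" using u by (simp add: continuous_on_eq_continuous_at)
  ultimately obtain d where d: "0 < d" "\<forall>z. \<bar>z - x\<bar> < d \<longrightarrow> u z \<in> {..<0}"
    using isCont_ball[where u = u and y = x and S = "{..<0}"] by auto
  have "AE z in lborel. z \<notin> {x<..<x + d}"
    using ae
  proof eventually_elim
    case (elim z)
    show ?case
    proof
      assume z: "z \<in> {x<..<x + d}"
      then have "u z < 0" using d(2) by auto
      then show False using elim z \<open>0 \<le> x\<close> by auto
    qed
  qed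
  then have "{x<..<x + d} \<in> null_sets lborel" by (subst AE_iff_null_sets) auto
  then show False using d(1) by (auto dest: null_setsD1)
qed

text \<open>For z > \<delta> the factor (z/\<delta>)^(p-1) is at least 1. The point is to bound an
  integral over a unit interval by a small constant plus a multiple of an L^p tail, in place of
  Hoelder's inequality.\<close>

lemma le_add_powr_scaled:
  fixes z \<delta> p :: real
  assumes "1 \<le> p" "0 < \<delta>" "0 \<le> z"
  shows "z \<le> \<delta> + \<delta> powr (1 - p) * z powr p"
proof (cases "z \<le> \<delta>")
  case False
  then have z: "0 < z" "1 \<le> z / \<delta>" using assms by auto
  have "1 \<le> (z / \<delta>) powr (p - 1)" using z assms by (intro ge_one_powr_ge_zero) auto
  then have "z \<le> z * (z / \<delta>) powr (p - 1)" using z(1) by simp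
  also have "\<dots> = \<delta> powr (1 - p) * z powr p"
    using z(1) assms by (simp add: powr_divide powr_diff field_simps)
  finally show ?thesis using assms by simp
qed (use assms in \<open>simp add: add_increasing2\<close>)

lemma unit_interval_integral_le:
  fixes w :: "real \<Rightarrow> real"
  assumes p: "1 \<le> p" and \<delta>: "0 < \<delta>" and w[measurable]: "w \<in> borel_measurable borel"
    and int: "integrable lborel (\<lambda>t. \<bar>w t\<bar> powr p)"
  shows "(LINT t:{x..x + 1}|lborel. \<bar>w t\<bar>) \<le> \<delta> + \<delta> powr (1 - p) * (\<integral>t. \<bar>w t\<bar> powr p * indicator {x..} t \<partial>lborel)"
proof -
  have i1: "integrable lborel (\<lambda>t. \<delta> * indicator {x..x + 1} t)"
    using set_integrable_one[of x "x + 1"] by (auto simp: set_integrable_def)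
  have i2: "integrable lborel (\<lambda>t. \<delta> powr (1 - p) * (\<bar>w t\<bar> powr p * indicator {x..} t))"
    using integrable_mult_indicator[OF _ int, of "{x..}"] by (auto simp: mult.commute)
  have "(LINT t:{x..x + 1}|lborel. \<bar>w t\<bar>)
      \<le> (\<integral>t. \<delta> * indicator {x..x + 1} t + \<delta> powr (1 - p) * (\<bar>w t\<bar> powr p * indicator {x..} t) \<partial>lborel)"
    unfolding set_lebesgue_integral_def
  proof (rule integral_mono)
    show "integrable lborel (\<lambda>t. indicator {x..x + 1} t *\<^sub>R \<bar>w t\<bar>)"
      using set_integrable_abs[OF set_integrable_of_powr[OF p w int]] by (simp add: set_integrable_def)
    show "indicator {x..x + 1} t *\<^sub>R \<bar>w t\<bar> \<le> \<delta> * indicator {x..x + 1} t + \<delta> powr (1 - p) * (\<bar>w t\<bar> powr p * indicator {x..} t)" for t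
      using le_add_powr_scaled[OF p \<delta>, of "\<bar>w t\<bar>"] by (auto split: split_indicator)
  qed (use i1 i2 in simp)
  also have "\<dots> = \<delta> + \<delta> powr (1 - p) * (\<integral>t. \<bar>w t\<bar> powr p * indicator {x..} t \<partial>lborel)"
    using i1 i2 by simp
  finally show ?thesis .
qed

lemma tail_integral_tendsto_0:
  fixes f :: "real \<Rightarrow> real"
  assumes "integrable lborel f"
  shows "((\<lambda>x. \<integral>t. f t * indicator {x..} t \<partial>lborel) \<longlongrightarrow> 0) at_top"
proof -
  have [measurable]: "f \<in> borel_measurable borel" using assms by auto
  have "((\<lambda>x. \<integral>t. f t * indicator {x..} t \<partial>lborel) \<longlongrightarrow> integral\<^sup>L lborel (\<lambda>t::real. 0::real)) at_top"
  proof (rule integral_dominated_convergence_at_top)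
    show "integrable lborel (\<lambda>t. norm (f t))" using assms by simp
    show "\<forall>\<^sub>F x in at_top. AE t in lborel. norm (f t * indicator {x..} t) \<le> norm (f t)"
      by (auto intro!: always_eventually split: split_indicator)
    show "AE t in lborel. ((\<lambda>x. f t * indicator {x..} t) \<longlongrightarrow> 0) at_top"
    proof (rule AE_I2)
      fix t
      show "((\<lambda>x. f t * indicator {x..} t) \<longlongrightarrow> 0) at_top"
      proof (rule tendsto_eventually)
        show "\<forall>\<^sub>F x in at_top. f t * indicator {x..} t = 0"
          using eventually_gt_at_top[of t] by eventually_elim simp
      qed
    qed
  qed auto
  then show ?thesis by simp
qed

text \<open>On [x, x + 1] the function drops by at most the integral of |g|, so u x is at most the
  mean of u there plus that integral. Each of the two is at most \<delta> plus a multiple of an L^p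
  tail, and \<delta> = e/3 leaves a margin.\<close>

lemma W1p_decay:
  fixes u g :: "real \<Rightarrow> real"
  assumes p: "1 \<le> p" and g[measurable]: "g \<in> borel_measurable borel"
    and g_int: "\<And>x y. set_integrable lborel {x..y} g"
    and diff: "\<And>x y. x \<le> y \<Longrightarrow> u y - u x = (LINT t:{x..y}|lborel. g t)"
    and cont: "continuous_on UNIV u" and nonneg: "\<And>x. 0 \<le> u x"
    and gp: "integrable lborel (\<lambda>x. \<bar>g x\<bar> powr p)"
    and up: "integrable lborel (\<lambda>x. indicator {0..} x * \<bar>u x\<bar> powr p)"
  shows "(u \<longlongrightarrow> 0) at_top"
proof (rule tendstoI)
  fix e :: real assume "0 < e"
  define \<delta> where "\<delta> = e / 3"
  have \<delta>: "0 < \<delta>" using \<open>0 < e\<close> by (simp add: \<delta>_def)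
  have [measurable]: "u \<in> borel_measurable borel" using cont by (rule borel_measurable_continuous_onI)
  define w where "w x = indicator {0..} x * u x" for x
  have w[measurable]: "w \<in> borel_measurable borel" unfolding w_def by measurable
  have wp: "integrable lborel (\<lambda>x. \<bar>w x\<bar> powr p)"
  proof -
    have "(\<lambda>x. \<bar>w x\<bar> powr p) = (\<lambda>x. indicator {0..} x * \<bar>u x\<bar> powr p)"
      using p by (auto simp: w_def split: split_indicator)
    then show ?thesis using up by simp
  qed
  define Q where "Q x = (\<delta> + \<delta> powr (1 - p) * (\<integral>t. \<bar>w t\<bar> powr p * indicator {x..} t \<partial>lborel))
     + (\<delta> + \<delta> powr (1 - p) * (\<integral>t. \<bar>g t\<bar> powr p * indicator {x..} t \<partial>lborel))" for x
  have "(Q \<longlongrightarrow> (\<delta> + \<delta> powr (1 - p) * 0) + (\<delta> + \<delta> powr (1 - p) * 0)) at_top"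
    unfolding Q_def by (intro tendsto_intros tail_integral_tendsto_0 wp gp)
  moreover have "2 * \<delta> < e" using \<open>0 < e\<close> by (simp add: \<delta>_def)
  ultimately have "\<forall>\<^sub>F x in at_top. Q x < e"
    by (intro order_tendstoD(2)[where a = e]) auto
  then show "\<forall>\<^sub>F x in at_top. dist (u x) 0 < e"
    using eventually_ge_at_top[of 0]
  proof eventually_elim
    case (elim x)
    let ?G = "LINT t:{x..x + 1}|lborel. \<bar>g t\<bar>"
    have "u x - ?G \<le> u y" if y: "y \<in> {x..x + 1}" for y
    proof -
      have "u x - u y \<le> \<bar>LINT t:{x..y}|lborel. g t\<bar>" using diff[of x y] y by simp
      also have "\<dots> \<le> (LINT t:{x..y}|lborel. \<bar>g t\<bar>)"
        using integral_norm_bound[of lborel "\<lambda>t. indicator {x..y} t *\<^sub>R g t"]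
        by (simp add: set_lebesgue_integral_def abs_mult)
      also have "\<dots> \<le> ?G"
        unfolding set_lebesgue_integral_def
      proof (rule integral_mono)
        show "integrable lborel (\<lambda>t. indicator {x..y} t *\<^sub>R \<bar>g t\<bar>)" "integrable lborel (\<lambda>t. indicator {x..x + 1} t *\<^sub>R \<bar>g t\<bar>)"
          using set_integrable_abs[OF g_int] by (simp_all add: set_integrable_def)
      qed (use y in \<open>auto split: split_indicator\<close>)
      finally show ?thesis by simp
    qed
    then have "(LINT y:{x..x + 1}|lborel. u x - ?G) \<le> (LINT y:{x..x + 1}|lborel. \<bar>w y\<bar>)"
      using elim nonneg
      by (intro set_integral_mono borel_integrable_atLeastAtMost' continuous_on_const
          set_integrable_abs set_integrable_of_powr[OF p w wp]) (auto simp: w_def)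
    then have "u x - ?G \<le> (LINT y:{x..x + 1}|lborel. \<bar>w y\<bar>)"
      by (simp add: set_lebesgue_integral_def)
    then have "u x \<le> Q x"
      using unit_interval_integral_le[OF p \<delta> w wp, of x] unit_interval_integral_le[OF p \<delta> g gp, of x]
      by (simp add: Q_def)
    then show ?case using elim nonneg[of x] by (simp add: dist_real_def)
  qed
qed

text \<open>Decay confines the maximum to a compact interval, on which the maximum points form a
  closed set and hence have a least element.\<close>

lemma first_maximum:
  fixes u :: "real \<Rightarrow> real"
  assumes cont: "continuous_on UNIV u" and nonneg: "\<And>x. 0 \<le> u x" and lim: "(u \<longlongrightarrow> 0) at_top"
    and pos: "0 \<le> x0" "u x0 \<noteq> 0" and neg: "\<And>x. x \<le> 0 \<Longrightarrow> u x = u 0"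
  obtains a where "0 \<le> a" "0 < u a" "\<forall>x. u x \<le> u a" "\<forall>x. 0 \<le> x \<and> x < a \<longrightarrow> u x < u a"
proof -
  have x0: "0 < u x0" using nonneg[of x0] pos(2) by simp
  have "\<forall>\<^sub>F x in at_top. u x < u x0" using lim x0 by (rule order_tendstoD)
  then obtain M where M: "\<And>x. M \<le> x \<Longrightarrow> u x < u x0" by (auto simp: eventually_at_top_linorder)
  have "x0 \<le> M" using M[of x0] by force
  obtain b where b: "b \<in> {0..M}" "\<And>x. x \<in> {0..M} \<Longrightarrow> u x \<le> u b"
    using continuous_attains_sup[of "{0..M}" u] \<open>x0 \<le> M\<close> pos(1) continuous_on_subset[OF cont]
    by (metis atLeastatMost_empty_iff2 compact_Icc dual_order.trans top_greatest)
  have ub: "u x0 \<le> u b" using b(2)[of x0] \<open>x0 \<le> M\<close> pos(1) by simp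
  have max: "u x \<le> u b" for x
  proof -
    consider "x \<le> 0" | "x \<in> {0..M}" | "M \<le> x" by fastforce
    then show ?thesis
    proof cases
      case 1
      then show ?thesis using neg[OF 1] b(2)[of 0] \<open>x0 \<le> M\<close> pos(1) by simp
    next
      case 3
      then show ?thesis using M[of x] ub by simp
    qed (rule b(2))
  qed
  let ?K = "{0..M} \<inter> {x. u b \<le> u x}"
  have "closed {x. u b \<le> u x}" by (intro closed_Collect_le continuous_on_const cont)
  then have "compact ?K" by (intro compact_Int_closed) auto
  then obtain a where a: "a \<in> ?K" "\<And>z. z \<in> ?K \<Longrightarrow> a \<le> z"
    using compact_attains_inf[of ?K] b(1) by blast
  have ua: "u a = u b" using a(1) max[of a] by auto
  show ?thesis
  proof (rule that[of a])
    show "\<forall>x. 0 \<le> x \<and> x < a \<longrightarrow> u x < u a" using a ua by force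
    show "0 < u a" using ua ub x0 by linarith
  qed (use a(1) ua max in auto)
qed

section \<open>The Polya--Szego inequality for the tamping\<close>

lemma tamping_eq_0:
  assumes "AE x in lebesgue_on {0..}. \<phi> x = 0" shows "tamping \<phi> y = 0"
proof -
  have "tamp_S \<phi> \<nu> = {}" if "0 < \<nu>" for \<nu>
  proof -
    have "AE x in lborel. 0 \<le> x \<longrightarrow> \<phi> x = 0" using assms by (simp add: AE_half_line_iff)
    then have "AE x in lebesgue. x \<notin> superlevel \<phi> \<nu>"
      using that by (intro AE_completion) (auto simp: superlevel_def elim!: eventually_mono)
    then obtain N where "{x \<in> space lebesgue. \<not> x \<notin> superlevel \<phi> \<nu>} \<subseteq> N"
      "emeasure lebesgue N = 0" "N \<in> sets lebesgue" by (rule AE_E)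
    then have "superlevel \<phi> \<nu> \<in> null_sets lebesgue"
      by (rule_tac null_set_subset[OF null_setsI]) auto
    then have "emeasure lebesgue (superlevel \<phi> \<nu>) = 0" by (rule null_setsD1)
    then show ?thesis by (simp add: tamp_S_def)
  qed
  then have "{\<nu>. 0 < \<nu> \<and> y \<in> tamp_S \<phi> \<nu>} = {}" by auto
  then show ?thesis by (simp only: tamping_def image_empty Sup_empty bot_ennreal)
qed

lemma powr_integral_half_line:
  fixes f f' :: "real \<Rightarrow> real"
  assumes f: "f \<in> borel_measurable (lebesgue_on {0..})" and [measurable]: "f' \<in> borel_measurable borel"
    and "\<And>x. x < 0 \<Longrightarrow> f' x = 0" and eq: "AE x in lebesgue_on {0..}. f x = f' x"
  shows "(\<integral>x. \<bar>f x\<bar> powr p \<partial>lebesgue_on {0..}) = (\<integral>x. \<bar>f' x\<bar> powr p \<partial>lborel)"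
proof -
  have f': "f' \<in> borel_measurable (lebesgue_on {0..})"
    by (rule half_line_measurable) simp
  have "(\<integral>x. \<bar>f x\<bar> powr p \<partial>lebesgue_on {0..}) = (\<integral>x. \<bar>f' x\<bar> powr p \<partial>lebesgue_on {0..})"
    using f f' eq by (intro integral_cong_AE) (auto elim!: eventually_mono)
  also have "\<dots> = (\<integral>x. \<bar>f' x\<bar> powr p \<partial>lborel)"
    using assms(3) by (intro integral_half_line) auto
  finally show ?thesis .
qed

theorem corollary3p13:
  fixes p :: real and \<phi> g :: "real \<Rightarrow> real"
  assumes "1 \<le> p"
    and "in_W1p p \<phi>"
    and "AE x in lebesgue_on {0..}. 0 \<le> \<phi> x"
    and "has_weak_derivative \<phi> g"
  shows "(AE x in lebesgue_on {0..}. tamping \<phi> x < \<infinity>) \<and>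
    (\<exists>h. has_weak_derivative (\<lambda>x. enn2real (tamping \<phi> x)) h \<and> in_Lp p h \<and>
      (\<integral>x. \<bar>h x\<bar> powr p \<partial>lebesgue_on {0..}) \<le> (\<integral>x. \<bar>g x\<bar> powr p \<partial>lebesgue_on {0..}) \<and>
      ((\<integral>x. \<bar>h x\<bar> powr p \<partial>lebesgue_on {0..}) = (\<integral>x. \<bar>g x\<bar> powr p \<partial>lebesgue_on {0..}) \<longleftrightarrow>
       (AE x in lebesgue_on {0..}. ennreal (\<phi> x) = tamping \<phi> x)))"
proof -
  obtain u g' where rep: "g' \<in> borel_measurable borel" "\<forall>x\<le>0. g' x = 0"
    "\<forall>x y. set_integrable lborel {x..y} g'"
    "\<forall>x y. x \<le> y \<longrightarrow> u y - u x = (LINT t:{x..y}|lborel. g' t)" "continuous_on UNIV u"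
    "AE x in lebesgue_on {0..}. \<phi> x = u x" "AE x in lebesgue_on {0..}. g x = g' x"
    "integrable lborel (\<lambda>x. \<bar>g' x\<bar> powr p)" "integrable lborel (\<lambda>x. indicator {0..} x * \<bar>u x\<bar> powr p)"
    by (rule W1p_representative[OF assms(1,2,4)])
  note rep = rep[rule_format]
  note [measurable] = rep(1)
  have neg: "u x = u 0" if "x \<le> 0" for x
  proof -
    have "(LINT t:{x..0}|lborel. g' t) = (LINT t:{x..0}|lborel. 0)"
      using rep(2) by (intro set_lebesgue_integral_cong) auto
    then show ?thesis using rep(4)[OF that] by simp
  qed
  have "AE x in lebesgue_on {0..}. 0 \<le> u x" using assms(3) rep(6) by eventually_elim simp
  then have "0 \<le> u x" if "0 \<le> x" for x
    using that by (intro continuous_nonneg_of_AE[OF rep(5)]) (auto simp: AE_half_line_iff)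
  then have nonneg: "0 \<le> u x" for x using neg[of x] by (cases "0 \<le> x") auto
  have lim: "(u \<longlongrightarrow> 0) at_top"
    by (rule W1p_decay[OF assms(1) rep(1,3,4,5) nonneg rep(8,9)])
  define V where "V x = enn2real (tamping \<phi> x)" for x
  have "(\<forall>y. tamping \<phi> y = ennreal (V y)) \<and> energy_controlled p g' u V"
  \<comment> \<open>The zero function has no positive maximum and hence no profile in the sense of
    the locale; its tamping is zero.\<close>
  proof (cases "\<exists>x0\<ge>0. u x0 \<noteq> 0")
    case True
    then obtain x0 where "0 \<le> x0" "u x0 \<noteq> 0" by blast
    then obtain a where a: "0 \<le> a" "0 < u a" "\<forall>x. u x \<le> u a" "\<forall>x. 0 \<le> x \<and> x < a \<longrightarrow> u x < u a"
      using first_maximum[OF rep(5) nonneg lim _ _ neg] by metis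
    interpret half_line_profile p a "u a" g' u
      by unfold_locales (use assms(1) rep a nonneg lim in auto)
    have tv: "tamping \<phi> y = ennreal (v y)" for y by (rule tamping_eq_v[OF rep(6)])
    then have V: "V = v" using v_bounds(1) by (auto simp: V_def)
    show ?thesis unfolding V using tv rearrangement_energy by blast
  next
    case False
    have "AE x in lebesgue_on {0..}. \<phi> x = 0"
      using rep(6) False by (auto simp: AE_half_line_iff elim!: eventually_mono)
    then have t0: "tamping \<phi> y = 0" for y by (rule tamping_eq_0)
    then have "V y = 0" for y by (simp add: V_def)
    then show ?thesis
      using t0 False unfolding energy_controlled_def
      by (intro conjI exI[of _ "\<lambda>_. 0"]) (auto simp: set_integrable_def set_lebesgue_integral_def)
  qed
  then obtain h where tV: "\<forall>y. tamping \<phi> y = ennreal (V y)" and h: "h \<in> borel_measurable borel" "\<forall>y<0. h y = 0"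
    "\<forall>x y. set_integrable lborel {x..y} h"
    "\<forall>x y. 0 \<le> x \<longrightarrow> x \<le> y \<longrightarrow> V y - V x = (LINT t:{x..y}|lborel. h t)"
    and le: "energy p h \<le> energy p g'"
    and eq: "energy p h = energy p g'
        \<Longrightarrow> \<forall>y\<ge>0. V y = u y"
    unfolding energy_controlled_def by (elim conjE exE) blast
  note h = h[rule_format]
  note [measurable] = h(1)
  have wd: "has_weak_derivative V h"
    by (rule primitive_has_weak_derivative[OF h(1,3,4,2)])
  have "energy p g' < \<infinity>"
    using rep(8) by (simp add: nn_integral_eq_integral)
  then have hp: "integrable lborel (\<lambda>x. \<bar>h x\<bar> powr p)"
    using le by (intro integrableI_nonneg) auto
  have hm: "h \<in> borel_measurable (lebesgue_on {0..})"
    by (rule half_line_measurable) simp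
  have Lp: "in_Lp p h"
    unfolding in_Lp_def using hm hp h(2) by (subst integral_half_line(2)) auto
  have gm: "g \<in> borel_measurable (lebesgue_on {0..})"
    using borel_representative[of g] assms(4) by (auto simp: has_weak_derivative_def)
  have Ig: "(\<integral>x. \<bar>g x\<bar> powr p \<partial>lebesgue_on {0..}) = (\<integral>x. \<bar>g' x\<bar> powr p \<partial>lborel)"
    by (rule powr_integral_half_line[OF gm rep(1) _ rep(7)]) (simp add: rep(2))
  have Ih: "(\<integral>x. \<bar>h x\<bar> powr p \<partial>lebesgue_on {0..}) = (\<integral>x. \<bar>h x\<bar> powr p \<partial>lborel)"
    by (rule powr_integral_half_line[OF hm h(1,2)]) auto
  have nn: "energy p h = ennreal (\<integral>x. \<bar>h x\<bar> powr p \<partial>lborel)"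
    "energy p g' = ennreal (\<integral>x. \<bar>g' x\<bar> powr p \<partial>lborel)"
    using hp rep(8) by (simp_all add: nn_integral_eq_integral)
  have "(\<integral>x. \<bar>h x\<bar> powr p \<partial>lebesgue_on {0..}) = (\<integral>x. \<bar>g x\<bar> powr p \<partial>lebesgue_on {0..}) \<longleftrightarrow>
       (AE x in lebesgue_on {0..}. ennreal (\<phi> x) = tamping \<phi> x)"
  proof
    assume "(\<integral>x. \<bar>h x\<bar> powr p \<partial>lebesgue_on {0..}) = (\<integral>x. \<bar>g x\<bar> powr p \<partial>lebesgue_on {0..})"
    then have "\<forall>y\<ge>0. V y = u y" using Ig Ih nn by (intro eq) simp
    then show "AE x in lebesgue_on {0..}. ennreal (\<phi> x) = tamping \<phi> x"
      using rep(6) by (auto simp: AE_half_line_iff tV elim!: eventually_mono)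
  next
    assume ae: "AE x in lebesgue_on {0..}. ennreal (\<phi> x) = tamping \<phi> x"
    have "AE x in lebesgue_on {0..}. \<phi> x = V x"
      using ae assms(3) by eventually_elim (metis V_def enn2real_ennreal)
    then have gh: "AE x in lebesgue_on {0..}. g x = h x"
      by (rule has_weak_derivative_unique[OF assms(4) wd])
    have "(\<integral>x. \<bar>g x\<bar> powr p \<partial>lebesgue_on {0..}) = (\<integral>x. \<bar>h x\<bar> powr p \<partial>lborel)"
      by (rule powr_integral_half_line[OF gm h(1) _ gh]) (simp add: h(2))
    then show "(\<integral>x. \<bar>h x\<bar> powr p \<partial>lebesgue_on {0..}) = (\<integral>x. \<bar>g x\<bar> powr p \<partial>lebesgue_on {0..})"
      using Ih by simp
  qed
  moreover have "(\<integral>x. \<bar>h x\<bar> powr p \<partial>lebesgue_on {0..}) \<le> (\<integral>x. \<bar>g x\<bar> powr p \<partial>lebesgue_on {0..})"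
    using le unfolding nn Ig Ih by (simp add: ennreal_le_iff)
  moreover have "AE x in lebesgue_on {0..}. tamping \<phi> x < \<infinity>"
    by (simp add: tV)
  ultimately show ?thesis
    using wd Lp unfolding V_def by blast
qed

end
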